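(* Let $q$ be a power of a prime, and let $K$ and $L$ be finite separable extensions of $\mathbb{F}_q(T)$. Then $K$ and $L$ are arithmetically equivalent over $\mathbb{F}_q(T)$ with no exceptions (that is, $f_K(\mathfrak{p})=f_L(\mathfrak{p})$ for every non-zero prime $\mathfrak{p}$ of $\mathbb{F}_q[T]$) if and only if $\zeta_{K/\mathbb{F}_q(T)}^{[0]} = \zeta_{L/\mathbb{F}_q(T)}^{[0]}$, where $\zeta^{[0]}$ denotes the lifted Goss zeta function.
   Context: $\mathcal{O}_K$ is the integral closure of $\mathbb{F}_q[T]$ in $K$. For a non-zero prime $\mathfrak{p}$ of $\mathbb{F}_q[T]$, the splitting type $f_K(\mathfrak{p})$ is the non-decreasing tuple of inertia degrees over $\mathfrak{p}$ of the primes of $\mathcal{O}_K$ above $\mathfrak{p}$. Lifted Goss zeta function. Let $p$ be the characteristic, $F=\mathbb{F}_q(T)$, $v_\infty$ the valuation at infinity (so $-v_\infty(f)=\deg f$ for polynomials $f$) with absolute value $\|\cdot\|_\infty$, $F_\infty$ the completion of $F$, and $\mathbb{C}_F$ the completion of an algebraic closure of $F_\infty$ for the extended absolute value. Put $S_\infty=\mathbb{C}_F^*\times\mathbb{Z}_p$. For $f\in\mathbb{F}_q[T]$ monic let $\langle f\rangle = T^{-\deg f}f=1+m_f$ with $\|m_f\|_\infty<1$; for $s=(x,y)\in S_\infty$ set $f^s=x^{\deg f}\langle f\rangle^y$, where $\langle f\rangle^y=\prod_{i}(1+m_f^{p^i})^{a_i}$ for the $p$-adic expansion $y=\sum_i a_ip^i$,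 $0\le a_i\le p-1$; and $f^{-s}=(f^s)^{-1}$. For a non-zero prime $\mathfrak{P}$ of $\mathcal{O}_K$ lying over the monic irreducible $f$, with inertia degree $d=[\mathcal{O}_K/\mathfrak{P}:\mathbb{F}_q[T]/(f)]$, put $N_q^K(\mathfrak{P})=f^d$, extended multiplicatively to non-zero ideals. Let $W$ be the ring of ($p$-typical) Witt vectors of $\mathbb{C}_F$ and $\chi:\mathbb{C}_F\to W$, $\chi(a)=(a,0,0,\dots)$, the Teichmüller map. $W$ carries the weak topology, with fundamental system of neighbourhoods of $0$ given by $V_{I,m}=\{(x_n)_{n}\in W: x_0,\dots,x_m\in I\}$, for $I$ an open ideal of $\mathcal{O}_{\mathbb{C}_F}=\{x\in\mathbb{C}_F:\|x\|_\infty\le1\}$ and $m\in\mathbb{N}$. The lifted Goss zeta function of $K/\mathbb{F}_q(T)$ is $$\zeta_{K/\mathbb{F}_q(T)}^{[0]}(s)=\sum_{\mathfrak{I}}\chi\big(N_q^K(\mathfrak{I})^{-s}\big)=\sum_{f\in\mathbb{F}_q[T]\text{ monic}}B_K(f)\,\chi(f^{-s})\in W,$$ where $\mathfrak{I}$ runs over non-zero ideals of $\mathcal{O}_K$ and $B_K(f)\in\mathbb{Z}_{\ge0}$ is the number of ideals of $\mathcal{O}_K$ with norm $f$. The series is considered as a $W$-valued function on the half-plane $\{s=(x,y)\in S_\infty:\|x\|_\infty>1\}$, where it converges for the weak topology; equality of zeta functions means equality of functions there. *)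

theory Defs
  imports "HOL-Analysis.Infinite_Sum" "HOL-Analysis.Infinite_Products"
    "HOL-Algebra.Algebraic_Closure_Type" "HOL-Algebra.Embedded_Algebras"
    "HOL-Algebra.Ideal_Product" "HOL-Algebra.QuotRing" "HOL-Library.Poly_Mapping"
begin

section \<open>Integer polynomials in arbitrary variables\<close>

type_synonym 'v zpoly = "('v \<Rightarrow>\<^sub>0 nat) \<Rightarrow>\<^sub>0 int"

definition zvar :: "'v \<Rightarrow> 'v zpoly"
  where "zvar i = Poly_Mapping.single (Poly_Mapping.single i 1) 1"

definition zeval :: "('v \<Rightarrow> 'a::comm_ring_1) \<Rightarrow> 'v zpoly \<Rightarrow> 'a"
  where "zeval x P = (\<Sum>m\<in>Poly_Mapping.keys P.
           of_int (Poly_Mapping.lookup P m) * (\<Prod>i\<in>Poly_Mapping.keys m. x i ^ Poly_Mapping.lookup m i))"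

abbreviation zmono :: "('v \<Rightarrow> 'a::comm_ring_1) \<Rightarrow> ('v \<Rightarrow>\<^sub>0 nat) \<Rightarrow> 'a"
  where "zmono x m \<equiv> (\<Prod>i\<in>Poly_Mapping.keys m. x i ^ Poly_Mapping.lookup m i)"

lemma zmono_superset:
  assumes "finite A" "Poly_Mapping.keys m \<subseteq> A"
  shows "zmono x m = (\<Prod>i\<in>A. x i ^ Poly_Mapping.lookup m i)"
  using assms by (intro prod.mono_neutral_left) (auto simp: in_keys_iff)

lemma zmono_add: "zmono x (m + n) = zmono x m * zmono x n"
proof -
  let ?A = "Poly_Mapping.keys m \<union> Poly_Mapping.keys n"
  have "zmono x (m + n) = (\<Prod>i\<in>?A. x i ^ Poly_Mapping.lookup (m + n) i)"
    using Poly_Mapping.keys_add[of m n] by (intro zmono_superset) auto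
  also have "\<dots> = (\<Prod>i\<in>?A. x i ^ Poly_Mapping.lookup m i) * (\<Prod>i\<in>?A. x i ^ Poly_Mapping.lookup n i)"
    by (simp add: lookup_add power_add prod.distrib)
  also have "\<dots> = zmono x m * zmono x n"
    by (simp add: zmono_superset[of ?A])
  finally show ?thesis .
qed

lemma zeval_superset:
  assumes "finite A" "Poly_Mapping.keys P \<subseteq> A"
  shows "zeval x P = (\<Sum>m\<in>A. of_int (Poly_Mapping.lookup P m) * zmono x m)"
  unfolding zeval_def using assms by (intro sum.mono_neutral_left) (auto simp: in_keys_iff)

lemma zeval_add [simp]: "zeval x (P + Q) = zeval x P + zeval x Q"
proof -
  let ?A = "Poly_Mapping.keys P \<union> Poly_Mapping.keys Q"
  have "zeval x (P + Q) = (\<Sum>m\<in>?A. of_int (Poly_Mapping.lookup (P + Q) m) * zmono x m)"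
    using Poly_Mapping.keys_add[of P Q] by (intro zeval_superset) auto
  then show ?thesis
    by (simp add: lookup_add distrib_right sum.distrib zeval_superset[of ?A P] zeval_superset[of ?A Q])
qed

lemma zeval_0 [simp]: "zeval x 0 = 0"
  by (simp add: zeval_def)

lemma zeval_single [simp]: "zeval x (Poly_Mapping.single m c) = of_int c * zmono x m"
  by (simp add: zeval_def)

lemma zeval_1 [simp]: "zeval x 1 = 1"
  unfolding single_one[symmetric] zeval_single by simp

lemma zeval_zvar [simp]: "zeval x (zvar i) = x i"
  by (simp add: zvar_def)

lemma zeval_sum [simp]: "zeval x (sum f A) = (\<Sum>i\<in>A. zeval x (f i))"
  by (induction A rule: infinite_finite_induct) auto

lemma zpoly_monomials: "P = (\<Sum>m\<in>Poly_Mapping.keys P. Poly_Mapping.single m (Poly_Mapping.lookup P m))"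
proof (rule poly_mapping_eqI)
  fix k
  show "Poly_Mapping.lookup P k =
      Poly_Mapping.lookup (\<Sum>m\<in>Poly_Mapping.keys P. Poly_Mapping.single m (Poly_Mapping.lookup P m)) k"
    by (cases "k \<in> Poly_Mapping.keys P")
       (auto simp: lookup_sum lookup_single when_def sum.delta in_keys_iff)
qed

lemma zeval_mult [simp]: "zeval x (P * Q) = zeval x P * zeval x Q"
proof -
  have "P * Q = (\<Sum>m\<in>Poly_Mapping.keys P. \<Sum>n\<in>Poly_Mapping.keys Q.
      Poly_Mapping.single (m + n) (Poly_Mapping.lookup P m * Poly_Mapping.lookup Q n))"
    by (subst (1) zpoly_monomials[of P], subst (1) zpoly_monomials[of Q])
       (simp add: sum_product Poly_Mapping.mult_single)
  then have "zeval x (P * Q) = (\<Sum>m\<in>Poly_Mapping.keys P. \<Sum>n\<in>Poly_Mapping.keys Q.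
      of_int (Poly_Mapping.lookup P m * Poly_Mapping.lookup Q n) * (zmono x m * zmono x n))"
    by (simp add: zmono_add)
  also have "\<dots> = zeval x P * zeval x Q"
    unfolding zeval_def sum_product by (intro sum.cong refl) (simp add: mult_ac)
  finally show ?thesis .
qed

lemma zeval_power [simp]: "zeval x (P ^ n) = zeval x P ^ n"
  by (induction n) auto

lemma zeval_of_nat [simp]: "zeval x (of_nat n) = of_nat n"
  by (induction n) auto

lemma zeval_uminus [simp]: "zeval x (- P) = - zeval x P"
  using zeval_add[of x P "- P"] by (simp add: eq_neg_iff_add_eq_0 add.commute del: zeval_add)

lemma zeval_minus [simp]: "zeval x (P - Q) = zeval x P - zeval x Q"
  using zeval_add[of x P "- Q"] by simp

lemma zeval_prod [simp]: "zeval x (prod f A) = (\<Prod>i\<in>A. zeval x (f i))"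
  by (induction A rule: infinite_finite_induct) auto

lemma zeval_of_int [simp]: "zeval x (of_int n) = of_int n"
  by (cases n) auto

lemma zeval_zeval: "zeval y (zeval x P) = zeval (\<lambda>i. zeval y (x i)) P"
  unfolding zeval_def[of x P] by (simp add: zeval_def[of "\<lambda>i. zeval y (x i)"])

lemma lookup_of_nat_mult:
  "Poly_Mapping.lookup (of_nat k * P :: 'v zpoly) m = of_nat k * Poly_Mapping.lookup P m"
  by (induction k) (auto simp: distrib_right lookup_add)

lemma zpoly_of_nat_cancel:
  assumes "of_nat k * P = of_nat k * (Q :: 'v zpoly)" "k > 0"
  shows "P = Q"
proof (rule poly_mapping_eqI)
  fix m
  show "Poly_Mapping.lookup P m = Poly_Mapping.lookup Q m"
    using arg_cong[OF assms(1), of "\<lambda>R. Poly_Mapping.lookup R m"] assms(2)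
    by (simp add: lookup_of_nat_mult)
qed

lemma prod_zvar_power: "finite A \<Longrightarrow> (\<Prod>i\<in>A. zvar i ^ f i) =
    (Poly_Mapping.single (\<Sum>i\<in>A. Poly_Mapping.single i (f i)) 1 :: 'v zpoly)"
proof (induction A rule: finite_induct)
  case (insert a A)
  have "zvar a ^ n = (Poly_Mapping.single (Poly_Mapping.single a n) 1 :: 'v zpoly)" for n
    by (induction n) (auto simp: zvar_def Poly_Mapping.mult_single single_add[symmetric])
  with insert show ?case by (simp add: Poly_Mapping.mult_single)
qed simp

lemma zeval_id: "zeval zvar P = P"
proof -
  have monom: "zmono zvar m = (Poly_Mapping.single m 1 :: 'v zpoly)" for m :: "'v \<Rightarrow>\<^sub>0 nat"
  proof -
    have "(\<Sum>i\<in>Poly_Mapping.keys m. Poly_Mapping.single i (Poly_Mapping.lookup m i)) = m"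
      by (rule poly_mapping_eqI)
         (auto simp: lookup_sum lookup_single when_def sum.delta in_keys_iff)
    then show ?thesis by (simp add: prod_zvar_power)
  qed
  have const: "(of_int c :: 'v zpoly) = Poly_Mapping.single 0 c" for c
    using single_of_int[of c, where ?'b = int and ?'a = "'v \<Rightarrow>\<^sub>0 nat"] by (simp only: of_int_eq_id id_apply)
  show ?thesis
    unfolding zeval_def monom const by (subst (3) zpoly_monomials) (simp add: Poly_Mapping.mult_single)
qed

section \<open>Witt vectors\<close>

definition ghost :: "nat \<Rightarrow> nat \<Rightarrow> (nat \<Rightarrow> 'a::comm_ring_1) \<Rightarrow> 'a"
  where "ghost p n x = (\<Sum>i\<le>n. of_nat p ^ i * x i ^ (p ^ (n - i)))"

text \<open>The integral polynomials whose ghost components are prescribed by \<open>G\<close>; lemma \<open>ghost_witt_polys\<close>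
  below shows that they exist and are unique for the \<open>G\<close> used here (Dwork's criterion).\<close>

definition witt_polys :: "nat \<Rightarrow> (nat \<Rightarrow> 'v zpoly) \<Rightarrow> nat \<Rightarrow> 'v zpoly"
  where "witt_polys p G = (THE S. \<forall>n. ghost p n S = G n)"

lemma ghost_zeval: "ghost p n (\<lambda>k. zeval x (S k)) = zeval x (ghost p n S)"
  by (simp add: ghost_def)

lemma ghost_split: "ghost p n x = (\<Sum>i<n. of_nat p ^ i * x i ^ (p ^ (n - i))) + of_nat p ^ n * x n"
  by (simp add: ghost_def lessThan_Suc_atMost[symmetric])

lemma ghost_inj:
  fixes S S' :: "nat \<Rightarrow> 'v zpoly"
  assumes "p > 0" "\<And>n. ghost p n S = ghost p n S'"
  shows "S = S'"
proof
  fix n show "S n = S' n"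
  proof (induction n rule: less_induct)
    case (less n)
    have "of_nat (p ^ n) * S n = of_nat (p ^ n) * S' n"
      using assms(2)[of n] less unfolding ghost_split by simp
    then show ?case
      by (rule zpoly_of_nat_cancel) (use assms in simp)
  qed
qed

lemma add_power_prime_dvd:
  fixes a b :: "'a::comm_ring_1"
  assumes "Factorial_Ring.prime (p::nat)"
  shows "of_nat p dvd (a + b) ^ p - (a ^ p + b ^ p)"
proof -
  have p: "p > 0" using assms prime_gt_0_nat by blast
  define t where "t k = of_nat (p choose k) * a ^ k * b ^ (p - k)" for k
  have "(a + b) ^ p = (\<Sum>k\<le>p. t k)" by (simp add: binomial_ring t_def)
  also have "{..p} = insert 0 (insert p {0<..<p})" using p by auto
  also have "(\<Sum>k\<in>\<dots>. t k) = b ^ p + (a ^ p + (\<Sum>k\<in>{0<..<p}. t k))"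
    using p by (subst sum.insert; simp add: t_def)
  finally have "(a + b) ^ p - (a ^ p + b ^ p) = (\<Sum>k\<in>{0<..<p}. t k)" by simp
  moreover have "of_nat p dvd t k" if "k \<in> {0<..<p}" for k
  proof -
    have "p dvd (p choose k)" using that assms by (intro dvd_choose_prime) auto
    then have "(of_nat p :: 'a) dvd of_nat (p choose k)" by (metis dvdE dvd_triv_left of_nat_mult)
    then show ?thesis unfolding t_def by (intro dvd_mult2)
  qed
  ultimately show ?thesis by (simp only:) (intro dvd_sum)
qed

definition zfrob :: "nat \<Rightarrow> 'v zpoly \<Rightarrow> 'v zpoly"
  where "zfrob p = zeval (\<lambda>i. zvar i ^ p)"

lemma zfrob_simps [simp]:
  "zfrob p (P + Q) = zfrob p P + zfrob p Q" "zfrob p (P * Q) = zfrob p P * zfrob p Q"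
  "zfrob p (- P) = - zfrob p P" "zfrob p (P ^ n) = zfrob p P ^ n" "zfrob p (zvar i) = zvar i ^ p"
  "zfrob p (of_nat n) = of_nat n" "zfrob p (sum f A) = (\<Sum>i\<in>A. zfrob p (f i))"
  by (simp_all add: zfrob_def)

lemma zfrob_cong:
  fixes P :: "'v zpoly"
  assumes p: "Factorial_Ring.prime (p::nat)"
  shows "of_nat p dvd P ^ p - zfrob p P"
proof -
  have p0: "p > 0" using p prime_gt_0_nat by blast
  define D where "D = {P :: 'v zpoly. of_nat p dvd P ^ p - zfrob p P}"
  have add: "P + Q \<in> D" if "P \<in> D" "Q \<in> D" for P Q
  proof -
    have "(P + Q) ^ p - zfrob p (P + Q) =
        ((P + Q) ^ p - (P ^ p + Q ^ p)) + (P ^ p - zfrob p P) + (Q ^ p - zfrob p Q)"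
      by simp
    then show ?thesis
      using that add_power_prime_dvd[OF p, of P Q] unfolding D_def mem_Collect_eq
      by (metis dvd_add)
  qed
  have mult: "P * Q \<in> D" if "P \<in> D" "Q \<in> D" for P Q
  proof -
    have "(P * Q) ^ p - zfrob p (P * Q) =
        P ^ p * (Q ^ p - zfrob p Q) + (P ^ p - zfrob p P) * zfrob p Q"
      by (simp add: algebra_simps power_mult_distrib)
    then show ?thesis
      using that unfolding D_def mem_Collect_eq by (metis dvd_add dvd_mult dvd_mult2)
  qed
  have zero: "0 \<in> D" using p0 by (simp add: D_def zfrob_def power_0_left)
  have one: "1 \<in> D" by (simp add: D_def zfrob_def)
  have minus: "- P \<in> D" if "P \<in> D" for P
  proof -
    have "(- P) ^ p - zfrob p (- P) = - ((P + - P) ^ p - (P ^ p + (- P) ^ p)) - (P ^ p - zfrob p P)"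
      using zero_power[OF p0, where ?'a = "'v zpoly"] by simp
    then show ?thesis
      using that add_power_prime_dvd[OF p, of P "- P"] unfolding D_def mem_Collect_eq
      by (metis dvd_diff dvd_minus_iff)
  qed
  have nat: "of_nat n \<in> D" for n by (induction n) (auto intro: add one zero)
  have int: "of_int c \<in> D" for c
    by (cases c) (use nat minus in \<open>auto simp del: of_nat_Suc\<close>)
  have var: "zvar i \<in> D" for i by (simp add: D_def)
  have pow: "Q ^ n \<in> D" if "Q \<in> D" for Q n by (induction n) (auto intro: that mult one)
  have prod: "prod f A \<in> D" if "\<And>i. f i \<in> D" for f :: "'v \<Rightarrow> 'v zpoly" and A
    by (induction A rule: infinite_finite_induct) (auto intro: that mult one)
  have sum: "sum f A \<in> D" if "\<And>i. f i \<in> D" for f :: "('v \<Rightarrow>\<^sub>0 nat) \<Rightarrow> 'v zpoly" and A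
    by (induction A rule: infinite_finite_induct) (auto intro: that add zero)
  have "zeval zvar P \<in> D"
    unfolding zeval_def by (intro sum mult int prod pow var)
  then show ?thesis by (simp add: zeval_id D_def)
qed

lemma prime_power_cong:
  fixes a b :: "'a::comm_ring_1"
  assumes "of_nat p dvd a - b"
  shows "of_nat p ^ Suc k dvd a ^ (p ^ k) - b ^ (p ^ k)"
proof (induction k)
  case (Suc k)
  define u v where "u = a ^ (p ^ k)" and "v = b ^ (p ^ k)"
  have uv: "of_nat p ^ Suc k dvd u - v" using Suc by (simp add: u_def v_def)
  have "of_nat p dvd u - v" using uv unfolding power_Suc by (rule dvd_mult_left)
  have pw: "of_nat p dvd u ^ i - v ^ i" for i
    unfolding power_diff_sumr2[of u i v] using \<open>of_nat p dvd u - v\<close> by (rule dvd_mult2)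
  have "(\<Sum>i<p. v ^ (p - Suc i) * u ^ i) =
      (\<Sum>i<p. v ^ (p - Suc i) * (u ^ i - v ^ i)) + of_nat p * v ^ (p - 1)"
  proof -
    have "v ^ (p - Suc i) * u ^ i = v ^ (p - Suc i) * (u ^ i - v ^ i) + v ^ (p - 1)" if "i < p" for i
    proof -
      have "v ^ (p - Suc i) * v ^ i = v ^ (p - 1)"
        using that by (simp add: power_add[symmetric])
      then show ?thesis by (simp add: algebra_simps)
    qed
    then show ?thesis by (simp add: sum.distrib)
  qed
  moreover have "of_nat p dvd \<dots>"
    using pw by (intro dvd_add dvd_sum) auto
  ultimately have "of_nat p dvd (\<Sum>i<p. v ^ (p - Suc i) * u ^ i)" by simp
  with uv have "of_nat p ^ Suc k * of_nat p dvd (u - v) * (\<Sum>i<p. v ^ (p - Suc i) * u ^ i)"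
    by (rule mult_dvd_mono)
  also have "(u - v) * (\<Sum>i<p. v ^ (p - Suc i) * u ^ i) = u ^ p - v ^ p"
    by (rule power_diff_sumr2[symmetric])
  finally show ?case
    by (simp add: u_def v_def power_mult[symmetric] mult_ac)
qed (use assms in simp)

lemma witt_polys_exist:
  fixes G :: "nat \<Rightarrow> 'v zpoly"
  assumes p: "Factorial_Ring.prime (p::nat)"
    and G: "\<And>n. of_nat p ^ Suc n dvd G (Suc n) - zfrob p (G n)"
  shows "\<exists>S. \<forall>n. ghost p n S = G n"
proof -
  have "\<exists>S. \<forall>n. (\<Sum>i<n. of_nat p ^ i * S i ^ (p ^ (n - i))) + of_nat p ^ n * S n = G n"
  proof (rule dependent_wellorder_choice)
    fix n and S :: "nat \<Rightarrow> 'v zpoly"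
    assume IH: "(\<Sum>i<m. of_nat p ^ i * S i ^ (p ^ (m - i))) + of_nat p ^ m * S m = G m" if "m < n" for m
    have "of_nat p ^ n dvd G n - (\<Sum>i<n. of_nat p ^ i * S i ^ (p ^ (n - i)))"
    proof (cases n)
      case (Suc m)
      have *: "ghost p m S = G m" using IH[of m] Suc by (simp add: ghost_split)
      have "of_nat p ^ Suc m dvd of_nat p ^ i * zfrob p (S i) ^ (p ^ (m - i)) - of_nat p ^ i * S i ^ (p ^ (Suc m - i))"
        if "i \<le> m" for i
      proof -
        have "of_nat p ^ Suc (m - i) dvd zfrob p (S i) ^ (p ^ (m - i)) - (S i ^ p) ^ (p ^ (m - i))"
          by (intro prime_power_cong) (metis zfrob_cong[OF p] dvd_minus_iff minus_diff_eq)
        then have "of_nat p ^ i * of_nat p ^ Suc (m - i) dvd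
            of_nat p ^ i * (zfrob p (S i) ^ (p ^ (m - i)) - (S i ^ p) ^ (p ^ (m - i)))"
          by (intro mult_dvd_mono) auto
        moreover have "(of_nat p :: 'v zpoly) ^ i * of_nat p ^ Suc (m - i) = of_nat p ^ Suc m"
          using that by (simp add: power_add[symmetric] flip: power_Suc)
        moreover have "(S i ^ p) ^ (p ^ (m - i)) = S i ^ (p ^ (Suc m - i))"
          using that by (simp add: power_mult[symmetric] Suc_diff_le)
        ultimately show ?thesis by (simp add: right_diff_distrib)
      qed
      then have "of_nat p ^ Suc m dvd (\<Sum>i\<le>m. of_nat p ^ i * zfrob p (S i) ^ (p ^ (m - i))
           - of_nat p ^ i * S i ^ (p ^ (Suc m - i)))"
        by (intro dvd_sum) auto
      also have "\<dots> = zfrob p (G m) - (\<Sum>i<n. of_nat p ^ i * S i ^ (p ^ (n - i)))"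
        by (simp add: sum_subtractf *[symmetric] ghost_def Suc lessThan_Suc_atMost)
      finally have "of_nat p ^ n dvd (zfrob p (G m) - (\<Sum>i<n. of_nat p ^ i * S i ^ (p ^ (n - i))))
          + (G n - zfrob p (G m))"
        using G[of m] Suc by (intro dvd_add) auto
      then show ?thesis by simp
    qed simp
    then obtain r where "G n - (\<Sum>i<n. of_nat p ^ i * S i ^ (p ^ (n - i))) = of_nat p ^ n * r" by (elim dvdE)
    then show "\<exists>r. (\<Sum>i<n. of_nat p ^ i * S i ^ (p ^ (n - i))) + of_nat p ^ n * r = G n"
      by (intro exI[of _ r]) (simp add: diff_eq_eq add.commute)
  qed simp
  then show ?thesis unfolding ghost_split .
qed

lemma ghost_witt_polys:
  fixes G :: "nat \<Rightarrow> 'v zpoly"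
  assumes p: "Factorial_Ring.prime (p::nat)"
    and G: "\<And>n. of_nat p ^ Suc n dvd G (Suc n) - zfrob p (G n)"
  shows "ghost p n (witt_polys p G) = G n"
proof -
  have "\<exists>!S. \<forall>n. ghost p n S = G n"
  proof (rule ex_ex1I)
    show "\<exists>S. \<forall>n. ghost p n S = G n" by (rule witt_polys_exist[OF assms])
    show "S = S'" if "\<forall>n. ghost p n S = G n" "\<forall>n. ghost p n S' = G n" for S S'
      using that by (intro ghost_inj[OF prime_gt_0_nat[OF p]]) simp
  qed
  from theI'[OF this] show ?thesis by (simp add: witt_polys_def)
qed

text \<open>The variables of the universal sum and product polynomials are \<open>X\<^sub>i = zvar (Inl i)\<close> and
  \<open>Y\<^sub>i = zvar (Inr i)\<close>.\<close>

definition witt_add :: "nat \<Rightarrow> (nat \<Rightarrow> 'a::comm_ring_1) \<Rightarrow> (nat \<Rightarrow> 'a) \<Rightarrow> nat \<Rightarrow> 'a"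
  where "witt_add p x y n = zeval (case_sum x y) (witt_polys p
           (\<lambda>n. ghost p n (\<lambda>i. zvar (Inl i)) + ghost p n (\<lambda>i. zvar (Inr i))) n)"

definition witt_mult :: "nat \<Rightarrow> (nat \<Rightarrow> 'a::comm_ring_1) \<Rightarrow> (nat \<Rightarrow> 'a) \<Rightarrow> nat \<Rightarrow> 'a"
  where "witt_mult p x y n = zeval (case_sum x y) (witt_polys p
           (\<lambda>n. ghost p n (\<lambda>i. zvar (Inl i)) * ghost p n (\<lambda>i. zvar (Inr i))) n)"

definition witt_neg :: "nat \<Rightarrow> (nat \<Rightarrow> 'a::comm_ring_1) \<Rightarrow> nat \<Rightarrow> 'a"
  where "witt_neg p x n = zeval x (witt_polys p (\<lambda>n. - ghost p n zvar) n)"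

definition witt_const :: "'a::comm_ring_1 \<Rightarrow> nat \<Rightarrow> 'a"
  where "witt_const a n = (if n = 0 then a else 0)"

lemma dwork_ghost_zvar:
  "of_nat p ^ Suc n dvd ghost p (Suc n) (\<lambda>i. zvar (h i)) - zfrob p (ghost p n (\<lambda>i. zvar (h i)))"
proof -
  have "zfrob p (ghost p n (\<lambda>i. zvar (h i))) = (\<Sum>i\<le>n. of_nat p ^ i * zvar (h i) ^ (p ^ (Suc n - i)))"
    by (auto simp: ghost_def power_mult[symmetric] Suc_diff_le intro!: sum.cong)
  then show ?thesis
    by (simp add: ghost_split[of p "Suc n"] lessThan_Suc_atMost)
qed

lemma dvd_diff_add:
  fixes a b c d m :: "'a::comm_ring_1"
  assumes "m dvd a - b" "m dvd c - d"
  shows "m dvd (a + c) - (b + d)" "m dvd a * c - b * d"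
proof -
  show "m dvd (a + c) - (b + d)" using dvd_add[OF assms] by (simp add: algebra_simps)
  have "a * c - b * d = (a - b) * c + b * (c - d)" by (simp add: algebra_simps)
  then show "m dvd a * c - b * d" using assms by (metis dvd_add dvd_mult dvd_mult2)
qed

lemma dvd_diff_uminus: "m dvd a - b \<Longrightarrow> m dvd (- a) - (- b)" for a b m :: "'a::comm_ring_1"
  using dvd_minus_iff[of m "a - b"] by simp

context
  fixes p :: nat
  assumes p: "Factorial_Ring.prime p"
begin

lemma ghost_witt_add: "ghost p n (witt_add p x y) = ghost p n x + ghost p n y"
proof -
  let ?G = "\<lambda>n. ghost p n (\<lambda>i. zvar (Inl i)) + ghost p n (\<lambda>i. zvar (Inr i)) :: (nat + nat) zpoly"
  have "ghost p n (witt_polys p ?G) = ?G n"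
    by (rule ghost_witt_polys[OF p]) (simp only: zfrob_simps dvd_diff_add dwork_ghost_zvar)
  then show ?thesis
    unfolding witt_add_def ghost_zeval by (simp flip: ghost_zeval)
qed

lemma ghost_witt_mult: "ghost p n (witt_mult p x y) = ghost p n x * ghost p n y"
proof -
  let ?G = "\<lambda>n. ghost p n (\<lambda>i. zvar (Inl i)) * ghost p n (\<lambda>i. zvar (Inr i)) :: (nat + nat) zpoly"
  have "ghost p n (witt_polys p ?G) = ?G n"
    by (rule ghost_witt_polys[OF p]) (simp only: zfrob_simps dvd_diff_add dwork_ghost_zvar)
  then show ?thesis
    unfolding witt_mult_def ghost_zeval by (simp flip: ghost_zeval)
qed

lemma ghost_witt_neg: "ghost p n (witt_neg p x) = - ghost p n x"
proof -
  let ?G = "\<lambda>n. - ghost p n zvar :: nat zpoly"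
  have "ghost p n (witt_polys p ?G) = ?G n"
    by (rule ghost_witt_polys[OF p], unfold zfrob_simps)
       (rule dvd_diff_uminus dwork_ghost_zvar)+
  then show ?thesis
    unfolding witt_neg_def ghost_zeval by (simp flip: ghost_zeval)
qed

lemma ghost_witt_const: "ghost p n (witt_const a) = a ^ (p ^ n)"
proof -
  have "ghost p n (witt_const a) = (\<Sum>i\<le>n. if i = 0 then a ^ (p ^ n) else 0)"
    unfolding ghost_def by (rule sum.cong) (use prime_gt_0_nat[OF p] in \<open>auto simp: witt_const_def zero_power\<close>)
  then show ?thesis by simp
qed

lemma witt_natural:
  "zeval z (witt_add p x y n) = witt_add p (\<lambda>i. zeval z (x i)) (\<lambda>i. zeval z (y i)) n"
  "zeval z (witt_mult p x y n) = witt_mult p (\<lambda>i. zeval z (x i)) (\<lambda>i. zeval z (y i)) n"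
  "zeval z (witt_neg p x n) = witt_neg p (\<lambda>i. zeval z (x i)) n"
  "zeval z (witt_const a n) = witt_const (zeval z a) n"
  unfolding witt_add_def witt_mult_def witt_neg_def witt_const_def zeval_zeval
  by (auto intro!: arg_cong[where f = "\<lambda>f. zeval f _"] split: sum.splits)

text \<open>An identity between Witt vector expressions may be checked on ghost components after
  passing to the universal ring, which is torsion-free.\<close>

lemma witt_identity:
  fixes L R :: "nat \<Rightarrow> 'v zpoly"
  assumes "\<And>n. ghost p n L = ghost p n R"
  shows "(\<lambda>n. zeval z (L n)) = (\<lambda>n. zeval z (R n))"
  using ghost_inj[OF prime_gt_0_nat[OF p] assms] by simp

lemma witt_ring_identities:
  fixes x y z :: "nat \<Rightarrow> 'a::comm_ring_1"
  shows "witt_add p (witt_add p x y) z = witt_add p x (witt_add p y z)"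
    and "witt_add p x y = witt_add p y x"
    and "witt_add p (witt_const 0) x = x"
    and "witt_add p (witt_neg p x) x = witt_const 0"
    and "witt_mult p (witt_mult p x y) z = witt_mult p x (witt_mult p y z)"
    and "witt_mult p x y = witt_mult p y x"
    and "witt_mult p (witt_const 1) x = x"
    and "witt_mult p (witt_add p x y) z = witt_add p (witt_mult p x z) (witt_mult p y z)"
proof -
  let ?X1 = "\<lambda>i. zvar (Inl i) :: (nat + nat + nat) zpoly"
  let ?X2 = "\<lambda>i. zvar (Inr (Inl i)) :: (nat + nat + nat) zpoly"
  let ?X3 = "\<lambda>i. zvar (Inr (Inr i)) :: (nat + nat + nat) zpoly"
  note I = witt_identity[where z = "case_sum x (case_sum y z)"]
  note g = ghost_witt_add ghost_witt_mult ghost_witt_neg ghost_witt_const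
  have p0: "p > 0" using prime_gt_0_nat[OF p] .
  note s = witt_natural zeval_zvar zeval_0 zeval_1 sum.case
  show "witt_add p (witt_add p x y) z = witt_add p x (witt_add p y z)"
    using I[of "witt_add p (witt_add p ?X1 ?X2) ?X3" "witt_add p ?X1 (witt_add p ?X2 ?X3)"]
    by (simp only: s g) (simp add: add_ac)
  show "witt_add p x y = witt_add p y x"
    using I[of "witt_add p ?X1 ?X2" "witt_add p ?X2 ?X1"] by (simp only: s g) (simp add: add_ac)
  show "witt_add p (witt_const 0) x = x"
    using I[of "witt_add p (witt_const 0) ?X1" ?X1] p0 by (simp only: s g) (simp add: zero_power)
  show "witt_add p (witt_neg p x) x = witt_const 0"
    using I[of "witt_add p (witt_neg p ?X1) ?X1" "witt_const 0"] p0
    by (simp only: s g) (simp add: zero_power)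
  show "witt_mult p (witt_mult p x y) z = witt_mult p x (witt_mult p y z)"
    using I[of "witt_mult p (witt_mult p ?X1 ?X2) ?X3" "witt_mult p ?X1 (witt_mult p ?X2 ?X3)"]
    by (simp only: s g) (simp add: mult_ac)
  show "witt_mult p x y = witt_mult p y x"
    using I[of "witt_mult p ?X1 ?X2" "witt_mult p ?X2 ?X1"] by (simp only: s g) (simp add: mult_ac)
  show "witt_mult p (witt_const 1) x = x"
    using I[of "witt_mult p (witt_const 1) ?X1" ?X1] by (simp only: s g) simp
  show "witt_mult p (witt_add p x y) z = witt_add p (witt_mult p x z) (witt_mult p y z)"
    using I[of "witt_mult p (witt_add p ?X1 ?X2) ?X3" "witt_add p (witt_mult p ?X1 ?X3) (witt_mult p ?X2 ?X3)"]
    by (simp only: s g) (simp add: algebra_simps)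
qed

end

text \<open>The \<open>p\<close>-typical Witt vectors, with \<open>p\<close> the characteristic of the coefficient ring.\<close>

typedef 'a witt = "UNIV :: (nat \<Rightarrow> 'a) set" morphisms witt_coord Witt ..

setup_lifting type_definition_witt

instantiation witt :: (comm_ring_prime_char) comm_ring_1
begin

lift_definition zero_witt :: "'a witt" is "witt_const 0" .
lift_definition one_witt :: "'a witt" is "witt_const 1" .
lift_definition plus_witt :: "'a witt \<Rightarrow> 'a witt \<Rightarrow> 'a witt" is "witt_add CHAR('a)" .
lift_definition times_witt :: "'a witt \<Rightarrow> 'a witt \<Rightarrow> 'a witt" is "witt_mult CHAR('a)" .
lift_definition uminus_witt :: "'a witt \<Rightarrow> 'a witt" is "witt_neg CHAR('a)" .
definition minus_witt :: "'a witt \<Rightarrow> 'a witt \<Rightarrow> 'a witt" where "minus_witt x y = x + - y"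

instance
proof
  fix x y z :: "'a witt"
  note W = witt_ring_identities[OF CHAR_prime[where ?'a = 'a]]
  show "x + y + z = x + (y + z)" by transfer (rule W)
  show "x + y = y + x" by transfer (rule W)
  show "0 + x = x" by transfer (rule W)
  show "- x + x = 0" by transfer (rule W)
  show "x - y = x + - y" by (rule minus_witt_def)
  show "x * y * z = x * (y * z)" by transfer (rule W)
  show "x * y = y * x" by transfer (rule W)
  show "1 * x = x" by transfer (rule W)
  show "(x + y) * z = x * z + y * z" by transfer (rule W)
  show "(0 :: 'a witt) \<noteq> 1" by transfer (auto simp: witt_const_def fun_eq_iff)
qed

end

lift_definition teichmueller :: "'a::comm_ring_prime_char \<Rightarrow> 'a witt" is witt_const .

text \<open>Up to index \<open>m\<close>, the sum and negation polynomials only involve variables of index at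
  most \<open>m\<close> and have no constant term.\<close>

definition zlocal :: "'v set \<Rightarrow> 'v zpoly set"
  where "zlocal V = {P. \<forall>m\<in>Poly_Mapping.keys P. m \<noteq> 0 \<and> Poly_Mapping.keys m \<subseteq> V}"

lemma zlocal_0: "0 \<in> zlocal V" by (simp add: zlocal_def)

lemma zlocal_zvar: "i \<in> V \<Longrightarrow> zvar i \<in> zlocal V"
  by (auto simp: zlocal_def zvar_def dest: arg_cong[where f = "\<lambda>m. Poly_Mapping.lookup m i"])

lemma zlocal_add: "P \<in> zlocal V \<Longrightarrow> Q \<in> zlocal V \<Longrightarrow> P + Q \<in> zlocal V"
  using Poly_Mapping.keys_add[of P Q] unfolding zlocal_def by auto

lemma zlocal_uminus: "P \<in> zlocal V \<Longrightarrow> - P \<in> zlocal V"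
  unfolding zlocal_def by (auto simp: in_keys_iff)

lemma zlocal_diff: "P \<in> zlocal V \<Longrightarrow> Q \<in> zlocal V \<Longrightarrow> P - Q \<in> zlocal V"
  using zlocal_add[of P V "- Q"] zlocal_uminus[of Q V] by simp

lemma zlocal_mult:
  assumes "P \<in> zlocal V" "Q \<in> zlocal V"
  shows "P * Q \<in> zlocal V"
  unfolding zlocal_def mem_Collect_eq
proof
  fix k assume "k \<in> Poly_Mapping.keys (P * Q)"
  then obtain m n where k: "k = m + n" "m \<in> Poly_Mapping.keys P" "n \<in> Poly_Mapping.keys Q"
    using Poly_Mapping.keys_mult[of P Q] by auto
  have "m \<noteq> 0" using k assms by (auto simp: zlocal_def)
  then obtain i where "Poly_Mapping.lookup m i \<noteq> 0"
    using poly_mapping_eqI[of m 0] by auto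
  then have "Poly_Mapping.lookup k i \<noteq> 0" by (simp add: k lookup_add)
  then have "k \<noteq> 0" by auto
  moreover have "Poly_Mapping.keys k \<subseteq> V"
    using k assms Poly_Mapping.keys_add[of m n] unfolding zlocal_def by fast
  ultimately show "k \<noteq> 0 \<and> Poly_Mapping.keys k \<subseteq> V" ..
qed

lemma zlocal_power: "P \<in> zlocal V \<Longrightarrow> n > 0 \<Longrightarrow> P ^ n \<in> zlocal V"
proof (induction n)
  case (Suc n)
  then show ?case by (cases "n = 0") (auto intro: zlocal_mult)
qed simp

lemma zlocal_sum: "(\<And>i. i \<in> A \<Longrightarrow> f i \<in> zlocal V) \<Longrightarrow> sum f A \<in> zlocal V"
  by (induction A rule: infinite_finite_induct) (auto intro: zlocal_add zlocal_0)

lemma zlocal_of_nat_mult: "k > 0 \<Longrightarrow> of_nat k * P \<in> zlocal V \<longleftrightarrow> P \<in> zlocal V"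
  unfolding zlocal_def by (auto simp: in_keys_iff lookup_of_nat_mult)

lemma zlocal_ghost_cancel:
  fixes S :: "nat \<Rightarrow> 'v zpoly"
  assumes p: "p > 0" and S: "\<And>n. ghost p n S \<in> zlocal (V n)" and V: "\<And>i n. i \<le> n \<Longrightarrow> V i \<subseteq> V n"
  shows "S n \<in> zlocal (V n)"
proof (induction n rule: less_induct)
  case (less n)
  have mono: "P \<in> zlocal (V n)" if "P \<in> zlocal (V i)" "i \<le> n" for P i
    using that V[of i n] unfolding zlocal_def by blast
  have "of_nat (p ^ n) * S n = ghost p n S - (\<Sum>i<n. of_nat (p ^ i) * S i ^ (p ^ (n - i)))"
    unfolding ghost_split by simp
  also have "\<dots> \<in> zlocal (V n)"
  proof (intro zlocal_diff zlocal_sum S)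
    fix i assume "i \<in> {..<n}"
    then have "S i ^ (p ^ (n - i)) \<in> zlocal (V n)"
      using p by (intro zlocal_power mono[OF less]) auto
    then show "of_nat (p ^ i) * S i ^ (p ^ (n - i)) \<in> zlocal (V n)"
      using p by (subst zlocal_of_nat_mult) auto
  qed
  finally show ?case using p by (subst (asm) zlocal_of_nat_mult) auto
qed

lemma zlocal_ghost_zvar:
  assumes "p > 0" "\<And>i. i \<le> n \<Longrightarrow> h i \<in> V"
  shows "ghost p n (\<lambda>i. zvar (h i)) \<in> zlocal V"
  unfolding ghost_def of_nat_power[symmetric] using assms
  by (intro zlocal_sum, subst zlocal_of_nat_mult) (auto intro!: zlocal_power zlocal_zvar)

lemma zeval_zlocal:
  assumes P: "P \<in> zlocal V" and x: "\<And>i. i \<in> V \<Longrightarrow> x i \<in> (I :: 'a::comm_ring_1 set)"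
    and I: "0 \<in> I" "\<And>a b. a \<in> I \<Longrightarrow> b \<in> I \<Longrightarrow> a + b \<in> I" "\<And>a. a \<in> I \<Longrightarrow> - a \<in> I"
      "\<And>a b. a \<in> I \<Longrightarrow> b \<in> I \<Longrightarrow> a * b \<in> I"
  shows "zeval x P \<in> I"
proof -
  have nat: "of_nat n * a \<in> I" if "a \<in> I" for n a
    by (induction n) (auto simp: distrib_right intro: I that)
  have int: "of_int c * a \<in> I" if "a \<in> I" for c a
    by (cases c) (use nat I(3) that in \<open>auto simp del: of_nat_Suc\<close>)
  have pow: "a ^ n \<in> I" if "a \<in> I" "n > 0" for a n
    using that(2) by (induction n rule: nat_induct_non_zero) (auto intro: that I)
  have prod: "prod f A \<in> I" if "finite A" "A \<noteq> {}" "\<And>i. i \<in> A \<Longrightarrow> f i \<in> I" for f :: "'b \<Rightarrow> 'a" and A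
    using that by (induction A rule: finite_ne_induct) (auto intro: I)
  have sum: "sum f A \<in> I" if "\<And>i. i \<in> A \<Longrightarrow> f i \<in> I" for f :: "('b \<Rightarrow>\<^sub>0 nat) \<Rightarrow> 'a" and A
    using that by (induction A rule: infinite_finite_induct) (auto intro: I)
  show ?thesis
    unfolding zeval_def
  proof (rule sum, rule int, rule prod)
    fix m assume m: "m \<in> Poly_Mapping.keys P"
    then show "Poly_Mapping.keys m \<noteq> {}" using P by (auto simp: zlocal_def)
    fix i assume i: "i \<in> Poly_Mapping.keys m"
    then have "i \<in> V" using m P by (auto simp: zlocal_def)
    then show "x i ^ Poly_Mapping.lookup m i \<in> I"
      by (rule pow[OF x]) (use i in \<open>simp add: in_keys_iff\<close>)
  qed simp
qed

context
  fixes p :: nat and I :: "'a::comm_ring_1 set"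
  assumes p: "Factorial_Ring.prime p"
    and I: "0 \<in> I" "\<And>a b. a \<in> I \<Longrightarrow> b \<in> I \<Longrightarrow> a + b \<in> I" "\<And>a. a \<in> I \<Longrightarrow> - a \<in> I"
      "\<And>a b. a \<in> I \<Longrightarrow> b \<in> I \<Longrightarrow> a * b \<in> I"
begin

lemma witt_add_closed:
  assumes "\<And>i. i \<le> n \<Longrightarrow> x i \<in> I" "\<And>i. i \<le> n \<Longrightarrow> y i \<in> I"
  shows "witt_add p x y n \<in> I"
proof -
  let ?V = "\<lambda>n. Inl ` {..n} \<union> Inr ` {..n} :: (nat + nat) set"
  let ?G = "\<lambda>n. ghost p n (\<lambda>i. zvar (Inl i)) + ghost p n (\<lambda>i. zvar (Inr i)) :: (nat + nat) zpoly"
  have p0: "p > 0" using prime_gt_0_nat[OF p] .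
  have "ghost p n (witt_polys p ?G) = ?G n" for n
    by (rule ghost_witt_polys[OF p]) (simp only: zfrob_simps dvd_diff_add dwork_ghost_zvar)
  moreover have "?G n \<in> zlocal (?V n)" for n
    by (intro zlocal_add zlocal_ghost_zvar p0) auto
  ultimately have "witt_polys p ?G n \<in> zlocal (?V n)"
    by (intro zlocal_ghost_cancel[OF p0, where S = "witt_polys p ?G" and V = "?V"]) auto
  then show ?thesis
    unfolding witt_add_def by (rule zeval_zlocal) (use assms I in auto)
qed

lemma witt_neg_closed:
  assumes "\<And>i. i \<le> n \<Longrightarrow> x i \<in> I"
  shows "witt_neg p x n \<in> I"
proof -
  let ?G = "\<lambda>n. - ghost p n zvar :: nat zpoly"
  have p0: "p > 0" using prime_gt_0_nat[OF p] .
  have "ghost p n (witt_polys p ?G) = ?G n" for n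
    by (rule ghost_witt_polys[OF p], unfold zfrob_simps)
       (rule dvd_diff_uminus dwork_ghost_zvar)+
  moreover have "?G n \<in> zlocal {..n}" for n
    by (intro zlocal_uminus zlocal_ghost_zvar[where h = "\<lambda>i. i"] p0) auto
  ultimately have "witt_polys p ?G n \<in> zlocal {..n}"
    by (intro zlocal_ghost_cancel[OF p0, where S = "witt_polys p ?G" and V = atMost]) auto
  then show ?thesis
    unfolding witt_neg_def by (rule zeval_zlocal) (use assms I in auto)
qed

end

section \<open>The weak topology\<close>

text \<open>The constant \<open>norm\<close> of the library is tied to real vector spaces, hence a separate symbol for
  the absolute value.\<close>

class nonarch_valued_field = field + metric_space +
  fixes absval :: "'a \<Rightarrow> real"
  assumes dist_absval: "dist x y = absval (x - y)"
    and absval_mult: "absval (x * y) = absval x * absval y"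
    and absval_add_le_max: "absval (x + y) \<le> max (absval x) (absval y)"
begin

lemma absval_eq_0_iff: "absval x = 0 \<longleftrightarrow> x = 0"
  using dist_absval[of x 0] dist_eq_0_iff[of x 0] by simp

lemma absval_1: "absval 1 = 1"
  using absval_mult[of 1 1] absval_eq_0_iff[of 1] by simp

lemma absval_minus: "absval (- x) = absval x"
  using dist_absval[of x 0] dist_absval[of 0 x] by (simp add: dist_commute)

end

definition valuation_ring :: "'a::nonarch_valued_field ring"
  where "valuation_ring = ring_of_type_algebra\<lparr>carrier := {x. absval x \<le> 1}\<rparr>"

lemma valuation_ring_simps:
  "carrier valuation_ring = {x. absval x \<le> 1}" "\<zero>\<^bsub>valuation_ring\<^esub> = 0" "\<one>\<^bsub>valuation_ring\<^esub> = 1"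
  "x \<oplus>\<^bsub>valuation_ring\<^esub> y = x + y" "x \<otimes>\<^bsub>valuation_ring\<^esub> y = x * y"
  by (simp_all add: valuation_ring_def ring_of_type_algebra_def)

lemma cring_valuation_ring: "cring (valuation_ring :: 'a::nonarch_valued_field ring)"
proof (intro cringI abelian_groupI comm_monoidI)
  fix x y :: 'a assume "x \<in> carrier valuation_ring" "y \<in> carrier valuation_ring"
  then show "x \<oplus>\<^bsub>valuation_ring\<^esub> y \<in> carrier valuation_ring"
    using absval_add_le_max[of x y] by (auto simp: valuation_ring_simps)
next
  fix x y :: 'a assume "x \<in> carrier valuation_ring" "y \<in> carrier valuation_ring"
  moreover have "0 \<le> absval x" "0 \<le> absval y"
    using dist_absval[of x 0] dist_absval[of y 0] by (metis diff_zero zero_le_dist)+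
  ultimately show "x \<otimes>\<^bsub>valuation_ring\<^esub> y \<in> carrier valuation_ring"
    by (auto simp: valuation_ring_simps absval_mult mult_le_one)
next
  fix x :: 'a assume "x \<in> carrier valuation_ring"
  then show "\<exists>y\<in>carrier valuation_ring. y \<oplus>\<^bsub>valuation_ring\<^esub> x = \<zero>\<^bsub>valuation_ring\<^esub>"
    by (intro bexI[of _ "- x"]) (auto simp: valuation_ring_simps absval_minus)
next
  show "\<zero>\<^bsub>valuation_ring\<^esub> \<in> carrier (valuation_ring :: 'a ring)"
    using absval_eq_0_iff[of "0::'a"] by (simp add: valuation_ring_simps)
qed (auto simp: valuation_ring_simps absval_1 algebra_simps)

text \<open>The valuation ring is open, so being open in it and being open in the field agree.\<close>

definition open_ideal :: "'a::nonarch_valued_field set \<Rightarrow> bool"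
  where "open_ideal I \<longleftrightarrow> ideal I valuation_ring \<and> open I"

definition weak_nbhd :: "'a::nonarch_valued_field set \<Rightarrow> nat \<Rightarrow> 'a witt set"
  where "weak_nbhd I m = {w. \<forall>k\<le>m. witt_coord w k \<in> I}"

lemma open_ideal_carrier: "open_ideal {x :: 'a::nonarch_valued_field. absval x \<le> 1}"
  unfolding open_ideal_def
proof
  show "ideal {x :: 'a. absval x \<le> 1} valuation_ring"
    using ring.oneideal[OF cring.axioms(1)[OF cring_valuation_ring]] by (simp add: valuation_ring_simps)
  show "open {x :: 'a. absval x \<le> 1}"
    unfolding open_dist
  proof (intro ballI exI conjI allI impI)
    fix x y :: 'a assume "x \<in> {x. absval x \<le> 1}" "dist y x < 1"
    then show "y \<in> {x. absval x \<le> 1}"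
      using absval_add_le_max[of "y - x" x] by (auto simp: dist_absval)
  qed simp
qed

lemma open_ideal_ball:
  assumes "0 < r" "r \<le> 1"
  shows "open_ideal {x :: 'a::nonarch_valued_field. absval x < r}"
  unfolding open_ideal_def
proof
  have nn: "0 \<le> absval x" for x :: 'a
    using dist_absval[of x 0] by (metis diff_zero zero_le_dist)
  have sub: "absval (- x) < r \<longleftrightarrow> absval x < r" for x :: 'a by (simp add: absval_minus)
  interpret cring "valuation_ring :: 'a ring" by (rule cring_valuation_ring)
  have inv: "\<ominus>\<^bsub>valuation_ring\<^esub> x = - x" if "absval x \<le> 1" for x :: 'a
    using that by (intro minus_equality) (auto simp: valuation_ring_simps absval_minus)
  have m: "absval (x * y) < r" if "absval x < r" "absval y \<le> 1" for x y :: 'a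
    using mult_left_mono[OF that(2) nn[of x]] that(1) by (simp add: absval_mult)
  show "ideal {x :: 'a. absval x < r} valuation_ring"
  proof (intro idealI)
    show "subgroup {x :: 'a. absval x < r} (add_monoid valuation_ring)"
    proof
      fix x y :: 'a assume "x \<in> {x. absval x < r}" "y \<in> {x. absval x < r}"
      then show "x \<otimes>\<^bsub>add_monoid valuation_ring\<^esub> y \<in> {x. absval x < r}"
        using absval_add_le_max[of x y] by (auto simp: valuation_ring_simps)
    next
      fix x :: 'a assume "x \<in> {x. absval x < r}"
      then show "inv\<^bsub>add_monoid valuation_ring\<^esub> x \<in> {x. absval x < r}"
        using inv[of x] assms by (auto simp: a_inv_def absval_minus)
    qed (use assms absval_eq_0_iff[of "0::'a"] in \<open>auto simp: valuation_ring_simps\<close>)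
  next
    fix a x :: 'a assume "a \<in> {x. absval x < r}" "x \<in> carrier valuation_ring"
    then have "absval (a * x) < r" using m by (simp add: valuation_ring_simps)
    then show "x \<otimes>\<^bsub>valuation_ring\<^esub> a \<in> {x. absval x < r}" "a \<otimes>\<^bsub>valuation_ring\<^esub> x \<in> {x. absval x < r}"
      by (simp_all add: valuation_ring_simps mult.commute[of x a])
  qed (rule ring_axioms)
  show "open {x :: 'a. absval x < r}"
    unfolding open_dist
  proof (intro ballI exI conjI allI impI)
    fix x y :: 'a assume "x \<in> {x. absval x < r}" "dist y x < r"
    then show "y \<in> {x. absval x < r}"
      using absval_add_le_max[of "y - x" x] by (auto simp: dist_absval)
  qed (rule assms)
qed

lemma open_ideal_Int: "open_ideal I \<Longrightarrow> open_ideal J \<Longrightarrow> open_ideal (I \<inter> J)"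
  unfolding open_ideal_def
  by (intro conjI ring.i_intersect[OF cring.axioms(1)[OF cring_valuation_ring]] open_Int) simp_all

lemma open_ideal_closed:
  assumes "open_ideal (I :: 'a::nonarch_valued_field set)"
  shows "0 \<in> I" "a \<in> I \<Longrightarrow> b \<in> I \<Longrightarrow> a + b \<in> I" "a \<in> I \<Longrightarrow> - a \<in> I"
    "a \<in> I \<Longrightarrow> b \<in> I \<Longrightarrow> a * b \<in> I"
proof -
  interpret ideal I "valuation_ring :: 'a ring" using assms by (simp add: open_ideal_def)
  show "0 \<in> I" using additive_subgroup.zero_closed[OF additive_subgroup_axioms]
    by (simp add: valuation_ring_simps)
  show "a \<in> I \<Longrightarrow> b \<in> I \<Longrightarrow> a + b \<in> I" using additive_subgroup.a_closed[OF additive_subgroup_axioms, of a b] by (simp add: valuation_ring_simps)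
  show "a \<in> I \<Longrightarrow> b \<in> I \<Longrightarrow> a * b \<in> I" using I_l_closed[of b a] Icarr by (simp add: valuation_ring_simps)
  show "a \<in> I \<Longrightarrow> - a \<in> I"
    using I_l_closed[of a "-1"] by (simp add: valuation_ring_simps absval_minus absval_1)
qed

lemma weak_nbhd_subgroup:
  fixes I :: "'a::{nonarch_valued_field, field_prime_char} set"
  assumes "open_ideal I"
  shows "0 \<in> weak_nbhd I m" "v \<in> weak_nbhd I m \<Longrightarrow> w \<in> weak_nbhd I m \<Longrightarrow> v + w \<in> weak_nbhd I m"
    "v \<in> weak_nbhd I m \<Longrightarrow> - v \<in> weak_nbhd I m"
proof -
  note I = open_ideal_closed[OF assms]
  show "0 \<in> weak_nbhd I m" using I by (simp add: weak_nbhd_def zero_witt.rep_eq witt_const_def)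
  show "v + w \<in> weak_nbhd I m" if "v \<in> weak_nbhd I m" "w \<in> weak_nbhd I m"
    using that unfolding weak_nbhd_def mem_Collect_eq plus_witt.rep_eq
    by (auto intro!: witt_add_closed CHAR_prime I)
  show "- v \<in> weak_nbhd I m" if "v \<in> weak_nbhd I m"
    using that unfolding weak_nbhd_def mem_Collect_eq uminus_witt.rep_eq
    by (auto intro!: witt_neg_closed CHAR_prime I)
qed

text \<open>The weak topology. The sets \<open>weak_nbhd I m\<close> are subgroups, so their translates are open and
  the open sets below are those of the group topology with neighbourhood base \<open>weak_nbhd I m\<close> at 0.\<close>

instantiation witt :: ("{nonarch_valued_field, field_prime_char}") t2_space
begin

definition open_witt :: "'a witt set \<Rightarrow> bool"
  where "open_witt U \<longleftrightarrow> (\<forall>x\<in>U. \<exists>I m. open_ideal I \<and> (+) x ` weak_nbhd I m \<subseteq> U)"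

instance
proof
  show "open (UNIV :: 'a witt set)" using open_ideal_carrier by (auto simp: open_witt_def)
  show "open (S \<inter> T)" if "open S" "open T" for S T :: "'a witt set"
    unfolding open_witt_def
  proof
    fix x assume "x \<in> S \<inter> T"
    then obtain I m where "open_ideal I" "(+) x ` weak_nbhd I m \<subseteq> S"
      using \<open>open S\<close> unfolding open_witt_def by blast
    moreover obtain J n where "open_ideal J" "(+) x ` weak_nbhd J n \<subseteq> T"
      using \<open>open T\<close> \<open>x \<in> S \<inter> T\<close> unfolding open_witt_def by blast
    moreover have "weak_nbhd (I \<inter> J) (max m n) \<subseteq> weak_nbhd I m \<inter> weak_nbhd J n"
      by (auto simp: weak_nbhd_def)
    ultimately show "\<exists>I m. open_ideal I \<and> (+) x ` weak_nbhd I m \<subseteq> S \<inter> T"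
      by (intro exI[of _ "I \<inter> J"] exI[of _ "max m n"]) (blast intro: open_ideal_Int)
  qed
  show "open (\<Union>K)" if "\<forall>S\<in>K. open S" for K :: "'a witt set set"
    using that unfolding open_witt_def by (meson Union_iff Union_upper subset_trans)
  show "\<exists>U V. open U \<and> open V \<and> x \<in> U \<and> y \<in> V \<and> U \<inter> V = {}" if "x \<noteq> y" for x y :: "'a witt"
  proof -
    have "y - x \<noteq> 0" using that by simp
    then obtain k where k: "witt_coord (y - x) k \<noteq> 0"
      by (auto simp: zero_witt.rep_eq witt_const_def fun_eq_iff simp flip: witt_coord_inject)
    define r where "r = min 1 (absval (witt_coord (y - x) k))"
    have "absval (witt_coord (y - x) k) > 0"
      using k absval_eq_0_iff[of "witt_coord (y - x) k"] dist_absval[of "witt_coord (y - x) k" 0]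
      by (metis diff_zero zero_le_dist order_le_less)
    then have r: "0 < r" "r \<le> 1" by (auto simp: r_def)
    define V where "V = weak_nbhd {z :: 'a. absval z < r} k"
    note I = open_ideal_ball[OF r, where ?'a = 'a]
    note sub = weak_nbhd_subgroup[OF I, where m = k, folded V_def]
    have op: "open ((+) z ` V)" for z
      unfolding open_witt_def
    proof
      fix w assume "w \<in> (+) z ` V"
      then have "(+) w ` V \<subseteq> (+) z ` V" using sub(2) by (auto simp: add.assoc)
      then show "\<exists>I m. open_ideal I \<and> (+) w ` weak_nbhd I m \<subseteq> (+) z ` V"
        unfolding V_def using I by (intro exI conjI)
    qed
    have "(+) x ` V \<inter> (+) y ` V = {}"
    proof (rule ccontr)
      assume "(+) x ` V \<inter> (+) y ` V \<noteq> {}"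
      then obtain v w where "v \<in> V" "w \<in> V" "x + v = y + w" by auto
      then have "y - x = v + - w" by (simp add: algebra_simps)
      then have "y - x \<in> V" using sub(2)[of v "- w"] sub(3)[of w] \<open>v \<in> V\<close> \<open>w \<in> V\<close> by simp
      then have "absval (witt_coord (y - x) k) < r" by (simp add: V_def weak_nbhd_def)
      then show False by (simp add: r_def)
    qed
    moreover have "z \<in> (+) z ` V" for z using sub(1) by (intro image_eqI[of _ _ 0]) simp_all
    ultimately show ?thesis
      by (intro exI[of _ "(+) x ` V"] exI[of _ "(+) y ` V"] conjI op)
  qed
qed

end

section \<open>Extensions of the rational function field\<close>

text \<open>An extension \<open>K\<close> of \<open>F\<close> is a field type \<open>'k\<close> with a ring homomorphism \<open>\<phi>\<close> from \<open>F\<close>. An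
  irreducible polynomial with root \<open>x\<close> is, up to a unit, the minimal polynomial of \<open>x\<close>; it is separable if its
  roots in an algebraic closure are simple.\<close>

definition finite_separable_extension :: "('f::field \<Rightarrow> 'k::field) \<Rightarrow> bool"
  where "finite_separable_extension \<phi> \<longleftrightarrow>
    \<phi> \<in> ring_hom ring_of_type_algebra ring_of_type_algebra \<and>
    ring.finite_dimension (ring_of_type_algebra :: 'k ring) (range \<phi>) UNIV \<and>
    (\<forall>x. \<exists>P. Factorial_Ring.irreducible P \<and> rsquarefree (map_poly to_ac P) \<and> poly (map_poly \<phi> P) x = 0)"

definition poly_embed :: "('q::field poly fract \<Rightarrow> 'k) \<Rightarrow> 'q poly \<Rightarrow> 'k"
  where "poly_embed \<phi> g = \<phi> (Fract g 1)"

definition integer_ring :: "('q::field poly fract \<Rightarrow> 'k::field) \<Rightarrow> 'k ring"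
  where "integer_ring \<phi> = ring_of_type_algebra
    \<lparr>carrier := {x. \<exists>P. lead_coeff P = 1 \<and> poly (map_poly (poly_embed \<phi>) P) x = 0}\<rparr>"

definition nonzero_primes :: "('a, 'b) ring_scheme \<Rightarrow> 'a set set"
  where "nonzero_primes R = {P. primeideal P R \<and> P \<noteq> {\<zero>\<^bsub>R\<^esub>}}"

definition contraction :: "('q::field poly fract \<Rightarrow> 'k::field) \<Rightarrow> 'k set \<Rightarrow> 'q poly set"
  where "contraction \<phi> P = {g. poly_embed \<phi> g \<in> P}"

text \<open>The residue field of the prime below \<open>P\<close> is identified with its image in the residue ring of \<open>P\<close>.\<close>

definition inertia_degree :: "('q::field poly fract \<Rightarrow> 'k::field) \<Rightarrow> 'k set \<Rightarrow> nat"
  where "inertia_degree \<phi> P = (let R = integer_ring \<phi> in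
    ring.dim (R Quot P) (range (\<lambda>g. P +>\<^bsub>R\<^esub> poly_embed \<phi> g)) (carrier (R Quot P)))"

definition splitting_type :: "('q::field poly fract \<Rightarrow> 'k::field) \<Rightarrow> 'q poly set \<Rightarrow> nat list"
  where "splitting_type \<phi> \<pp> = sorted_list_of_multiset (image_mset (inertia_degree \<phi>)
    (mset_set {P \<in> nonzero_primes (integer_ring \<phi>). contraction \<phi> P = \<pp>}))"

definition arithmetically_equivalent ::
    "('q::field poly fract \<Rightarrow> 'k::field) \<Rightarrow> ('q poly fract \<Rightarrow> 'l::field) \<Rightarrow> bool"
  where "arithmetically_equivalent \<phi> \<psi> \<longleftrightarrow>
    (\<forall>\<pp> \<in> nonzero_primes ring_of_type_algebra. splitting_type \<phi> \<pp> = splitting_type \<psi> \<pp>)"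

definition prime_norm :: "('q::field poly fract \<Rightarrow> 'k::field) \<Rightarrow> 'k set \<Rightarrow> 'q poly"
  where "prime_norm \<phi> P =
    (THE f. lead_coeff f = 1 \<and> Factorial_Ring.irreducible f \<and> contraction \<phi> P = {g. f dvd g})
      ^ inertia_degree \<phi> P"

text \<open>The multiplicative extension of \<open>prime_norm\<close> along the factorisation into primes, which is
  unique up to order since the ring of integers is a Dedekind domain.\<close>

definition ideal_norm :: "('q::field poly fract \<Rightarrow> 'k::field) \<Rightarrow> 'k set \<Rightarrow> 'q poly"
  where "ideal_norm \<phi> I = (let R = integer_ring \<phi> in
    (THE N. \<exists>Ps. set Ps \<subseteq> nonzero_primes R \<and> I = foldr (ideal_prod R) Ps (carrier R)
        \<and> N = prod_list (map (prime_norm \<phi>) Ps)))"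

section \<open>The lifted Goss zeta function\<close>

definition val_infinity :: "'q::field poly fract \<Rightarrow> int"
  where "val_infinity x =
    (THE v. \<exists>a b. a \<noteq> 0 \<and> b \<noteq> 0 \<and> x = Fract a b \<and> v = int (degree b) - int (degree a))"

lemma val_infinity_Fract:
  assumes "a \<noteq> 0" "b \<noteq> 0"
  shows "val_infinity (Fract a b) = int (degree b) - int (degree a)"
  unfolding val_infinity_def
proof (rule the_equality)
  fix v assume "\<exists>c d. c \<noteq> 0 \<and> d \<noteq> 0 \<and> Fract a b = Fract c d \<and> v = int (degree d) - int (degree c)"
  then obtain c d where cd: "c \<noteq> 0" "d \<noteq> 0" "a * d = c * b" "v = int (degree d) - int (degree c)"
    using assms by (auto simp: eq_fract)
  then have "degree a + degree d = degree c + degree b"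
    using assms by (metis degree_mult_eq)
  then show "v = int (degree b) - int (degree a)" using cd by linarith
qed (use assms in blast)

text \<open>Normalised by \<open>|T| = q\<close>; the topology and the condition \<open>|x| > 1\<close> do not depend on this choice.\<close>

definition abs_infinity :: "'q::finite_field poly fract \<Rightarrow> real"
  where "abs_infinity x = (if x = 0 then 0 else real CARD('q) powi (- val_infinity x))"

definition completion_map ::
    "('a::field \<Rightarrow> real) \<Rightarrow> ('a \<Rightarrow> 'b::{nonarch_valued_field, complete_space}) \<Rightarrow> bool"
  where "completion_map N i \<longleftrightarrow>
    i \<in> ring_hom ring_of_type_algebra ring_of_type_algebra \<and>
    (\<forall>x. absval (i x) = N x) \<and> closure (range i) = UNIV"

definition algebraic_closure_map ::
    "('a::nonarch_valued_field \<Rightarrow> 'b::{nonarch_valued_field, alg_closed_field}) \<Rightarrow> bool"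
  where "algebraic_closure_map j \<longleftrightarrow>
    j \<in> ring_hom ring_of_type_algebra ring_of_type_algebra \<and>
    (\<forall>x. absval (j x) = absval x) \<and>
    (\<forall>x. \<exists>P. P \<noteq> 0 \<and> poly (map_poly j P) x = 0)"

text \<open>The inverse limit of the rings \<open>\<int>/p\<^sup>n\<close>, each class being represented by its least
  non-negative residue \<open>y n\<close>. Then \<open>y (n + 1)\<close> is the partial sum up to \<open>i = n\<close> of \<open>a\<^sub>i p\<^sup>i\<close>
  with \<open>a\<^sub>i = padic_digit p y i\<close>.\<close>

definition padic_integers :: "nat \<Rightarrow> (nat \<Rightarrow> nat) set"
  where "padic_integers p = {y. \<forall>n. y n < p ^ n \<and> y (Suc n) mod p ^ n = y n}"

definition padic_digit :: "nat \<Rightarrow> (nat \<Rightarrow> nat) \<Rightarrow> nat \<Rightarrow> nat"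
  where "padic_digit p y i = y (Suc i) div p ^ i"

definition one_unit_part ::
    "('q::field poly fract \<Rightarrow> 'c::field) \<Rightarrow> 'q poly \<Rightarrow> 'c"
  where "one_unit_part \<iota> f = inverse (poly_embed \<iota> [:0, 1:] ^ degree f) * poly_embed \<iota> f"

definition one_unit_power ::
    "'c::{nonarch_valued_field, field_prime_char} \<Rightarrow> (nat \<Rightarrow> nat) \<Rightarrow> 'c"
  where "one_unit_power u y =
    prodinf (\<lambda>i. (1 + (u - 1) ^ (CHAR('c) ^ i)) ^ padic_digit CHAR('c) y i)"

definition goss_power ::
    "('q::field poly fract \<Rightarrow> 'c::{nonarch_valued_field, field_prime_char}) \<Rightarrow>
      'q poly \<Rightarrow> 'c \<times> (nat \<Rightarrow> nat) \<Rightarrow> 'c"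
  where "goss_power \<iota> f s = fst s ^ degree f * one_unit_power (one_unit_part \<iota> f) (snd s)"

definition goss_space :: "('c::field_prime_char \<times> (nat \<Rightarrow> nat)) set"
  where "goss_space = (UNIV - {0}) \<times> padic_integers CHAR('c)"

definition goss_half_plane :: "('c::{nonarch_valued_field, field_prime_char} \<times> (nat \<Rightarrow> nat)) set"
  where "goss_half_plane = {s \<in> goss_space. absval (fst s) > 1}"

definition lifted_goss_zeta ::
    "('q::field poly fract \<Rightarrow> 'c::{nonarch_valued_field, field_prime_char}) \<Rightarrow>
      ('q poly fract \<Rightarrow> 'k::field) \<Rightarrow> 'c \<times> (nat \<Rightarrow> nat) \<Rightarrow> 'c witt"
  where "lifted_goss_zeta \<iota> \<phi> s =
    (\<Sum>\<^sub>\<infinity>I\<in>{I. ideal I (integer_ring \<phi>) \<and> I \<noteq> {0}}.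
      teichmueller (inverse (goss_power \<iota> (ideal_norm \<phi> I) s)))"

end

theory Submission
  imports Defs "Jordan_Normal_Form.Char_Poly"
begin

text \<open>The ring \<open>R\<close> of integers of \<open>K\<close> has finite quotients \<open>R/aR\<close>: residues modulo \<open>a\<close> serve as
  digits of distinct sums \<open>\<Sum>j<k. a\<^sup>j y\<^sub>j\<close>, and there are few such sums since \<open>K\<close> is
  finite-dimensional. The pigeonhole principle for powers modulo \<open>c\<close> then replaces the Noetherian and
  integral closure arguments for Dedekind domains: nonzero primes are maximal, and \<open>xI \<subseteq> I\<close> yields
  \<open>x\<^sup>j - x\<^sup>i \<in> R\<close> for some \<open>i < j\<close>, hence \<open>x \<in> R\<close>. So ideals
  correspond to multisets of primes, and a norm-preserving bijection between the primes identifies the two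
  zeta functions.

  Conversely, let \<open>D(f)\<close> be the difference of the numbers of ideals of norm \<open>f\<close>, and suppose that \<open>p\<^sup>k\<close>
  divides all \<open>D(f)\<close>. The Witt component of index \<open>k\<close> of a truncation of \<open>\<Sum>f. D(f) \<chi>(f\<^sup>-\<^sup>s)\<close> is the
  \<open>p\<^sup>k\<close>-th power of a truncation of \<open>\<Sum>f. (D(f)/p\<^sup>k) f\<^sup>-\<^sup>s\<close>, and it is small because the infinite
  sum vanishes. At \<open>s = (x, n)\<close> with \<open>n\<close> a natural number, letting \<open>|x|\<close> grow isolates the terms of
  least degree; the vanishing of their sum for all \<open>n\<close> is a Vandermonde system in the distinct one-units
  \<open>\<langle>f\<rangle>\<close>, so \<open>p\<close> divides \<open>D(f)/p\<^sup>k\<close>. Thus \<open>D = 0\<close>, and the numbers of ideals of norm \<open>f\<^sup>k\<close>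
  determine the numbers of primes of each degree above \<open>f\<close>.\<close>

section \<open>Unique factorisation of ideals\<close>

text \<open>Component 0 of the zeta function sees the numbers of ideals only modulo
  \<open>p\<close>. The Teichmueller lift keeps the rest: multiplication by \<open>p\<close> on Witt
  vectors is injective and moves component 0, raised to the power \<open>p\<close>, to component 1.
  So once \<open>p^k\<close> divides all differences, their next digit is visible in component
  \<open>k\<close>. The obstacle is that Witt addition is not componentwise. Tails of the series are
  therefore estimated inside the subgroups \<open>weak_nbhd\<close>, with the index \<open>m\<close>
  left arbitrary, so that any component can be inspected after truncation. Natural exponents are
  chosen because the one-unit power is then an ordinary power, and powers of \<open>T\<close> serve
  as \<open>x\<close> because their absolute values are known and unbounded. On the side of the
  ideals, \<open>ideal_norm\<close> is a definite description over factorisations into primes;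
  unique factorisation is what gives it a value.\<close>

lemma ring_of_type_simps [simp]:
  "carrier ring_of_type_algebra = UNIV"
  "zero (ring_of_type_algebra\<lparr>carrier := C\<rparr>) = 0" "one (ring_of_type_algebra\<lparr>carrier := C\<rparr>) = 1"
  "add (ring_of_type_algebra\<lparr>carrier := C\<rparr>) = (+)"
  "mult (ring_of_type_algebra\<lparr>carrier := C\<rparr>) = (*)"
  "zero ring_of_type_algebra = 0" "one ring_of_type_algebra = 1"
  "add ring_of_type_algebra = (+)" "mult ring_of_type_algebra = (*)"
  by (simp_all add: ring_of_type_algebra_def)

text \<open>The ring is a set of elements of the field with the operations of the type, so that
  products \<open>x * i\<close> with a fraction \<open>x\<close> outside \<open>R\<close> make
  sense; the inversion of primes relies on them.\<close>

locale subring_of_field =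
  fixes R :: "'k::field set"
  assumes zero_closed: "0 \<in> R" and one_closed: "1 \<in> R"
    and add_closed: "x \<in> R \<Longrightarrow> y \<in> R \<Longrightarrow> x + y \<in> R"
    and mult_closed: "x \<in> R \<Longrightarrow> y \<in> R \<Longrightarrow> x * y \<in> R"
    and uminus_closed: "x \<in> R \<Longrightarrow> - x \<in> R"
begin

abbreviation Rg :: "'k ring"
  where "Rg \<equiv> ring_of_type_algebra\<lparr>carrier := R\<rparr>"

lemma diff_closed: "x \<in> R \<Longrightarrow> y \<in> R \<Longrightarrow> x - y \<in> R"
  using add_closed[of x "- y"] uminus_closed by simp

lemma power_closed: "x \<in> R \<Longrightarrow> x ^ n \<in> R"
  by (induction n) (auto intro: one_closed mult_closed)

lemma cring_Rg: "cring Rg"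
proof (intro cringI abelian_groupI comm_monoidI)
  fix x assume "x \<in> carrier Rg"
  then show "\<exists>y\<in>carrier Rg. y \<oplus>\<^bsub>Rg\<^esub> x = \<zero>\<^bsub>Rg\<^esub>"
    by (intro bexI[of _ "- x"]) (auto intro: uminus_closed)
qed (auto simp: algebra_simps intro: zero_closed one_closed add_closed mult_closed)

sublocale Rg: cring Rg by (rule cring_Rg)

lemma a_inv_eq: "x \<in> R \<Longrightarrow> \<ominus>\<^bsub>Rg\<^esub> x = - x"
  by (rule Rg.minus_equality) (auto intro: uminus_closed)

lemma ideal_iff:
  "ideal I Rg \<longleftrightarrow> I \<subseteq> R \<and> 0 \<in> I \<and> (\<forall>x\<in>I. \<forall>y\<in>I. x + y \<in> I) \<and> (\<forall>r\<in>R. \<forall>x\<in>I. r * x \<in> I)"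
    (is "_ \<longleftrightarrow> ?rhs")
proof
  assume "ideal I Rg"
  then interpret ideal I Rg .
  show ?rhs
    using a_subset additive_subgroup.zero_closed[OF additive_subgroup_axioms]
      additive_subgroup.a_closed[OF additive_subgroup_axioms] I_l_closed by simp
next
  assume I: ?rhs
  show "ideal I Rg"
  proof (intro idealI)
    show "subgroup I (add_monoid Rg)"
    proof
      fix x assume x: "x \<in> I"
      then have "x \<in> R" using I by blast
      moreover have "- x \<in> I" using I x uminus_closed[OF one_closed] by (metis mult_minus1)
      ultimately show "inv\<^bsub>add_monoid Rg\<^esub> x \<in> I"
        using a_inv_eq[of x] by (simp add: a_inv_def)
    qed (use I in auto)
  next
    fix a x assume "a \<in> I" "x \<in> carrier Rg"
    then show "x \<otimes>\<^bsub>Rg\<^esub> a \<in> I" "a \<otimes>\<^bsub>Rg\<^esub> x \<in> I"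
      using I by (simp_all add: mult.commute[of a])
  qed (rule Rg.ring_axioms)
qed

lemma ideal_closed:
  assumes "ideal I Rg"
  shows "I \<subseteq> R" "0 \<in> I" "x \<in> I \<Longrightarrow> y \<in> I \<Longrightarrow> x + y \<in> I" "r \<in> R \<Longrightarrow> x \<in> I \<Longrightarrow> r * x \<in> I"
    "x \<in> I \<Longrightarrow> x \<in> R" "x \<in> I \<Longrightarrow> - x \<in> I" "x \<in> I \<Longrightarrow> y \<in> I \<Longrightarrow> x - y \<in> I"
    "x \<in> I \<Longrightarrow> r \<in> R \<Longrightarrow> x * r \<in> I"
proof -
  note I = assms[unfolded ideal_iff]
  show "I \<subseteq> R" "0 \<in> I" and c: "x \<in> I \<Longrightarrow> y \<in> I \<Longrightarrow> x + y \<in> I" for x y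
    using I by auto
  show m: "r \<in> R \<Longrightarrow> x \<in> I \<Longrightarrow> r * x \<in> I" for r x using I by auto
  show "x \<in> I \<Longrightarrow> x \<in> R" using I by auto
  show u: "x \<in> I \<Longrightarrow> - x \<in> I" for x using m[OF uminus_closed[OF one_closed], of x] by simp
  show "x \<in> I \<Longrightarrow> y \<in> I \<Longrightarrow> x - y \<in> I" using c[of x "- y"] u[of y] by simp
  show "x \<in> I \<Longrightarrow> r \<in> R \<Longrightarrow> x * r \<in> I" using m by (simp add: mult.commute)
qed

lemma ideal_eq_R_iff: "ideal I Rg \<Longrightarrow> I = R \<longleftrightarrow> 1 \<in> I"
  using ideal_closed(1,4)[of I] one_closed by (metis mult.right_neutral subsetI subset_antisym)

lemma primeideal_iff:
  "primeideal P Rg \<longleftrightarrow>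
    ideal P Rg \<and> P \<noteq> R \<and> (\<forall>a\<in>R. \<forall>b\<in>R. a * b \<in> P \<longrightarrow> a \<in> P \<or> b \<in> P)"
  by (auto simp: primeideal_def primeideal_axioms_def cring_Rg)

lemma ideal_nonzero: "ideal I Rg \<Longrightarrow> I \<noteq> {0} \<Longrightarrow> \<exists>c\<in>I. c \<noteq> 0"
  using ideal_closed(2) by blast

lemma principal_ideal: "c \<in> R \<Longrightarrow> ideal ((*) c ` R) Rg"
  unfolding ideal_iff
proof (intro conjI ballI)
  assume c: "c \<in> R"
  show "(*) c ` R \<subseteq> R" using c mult_closed by auto
  show "0 \<in> (*) c ` R" by (rule image_eqI[of _ _ 0]) (auto intro: zero_closed)
  fix x y assume "x \<in> (*) c ` R" "y \<in> (*) c ` R"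
  then show "x + y \<in> (*) c ` R" using add_closed by (auto simp flip: distrib_left)
next
  fix r x assume r: "r \<in> R" "x \<in> (*) c ` R"
  then obtain t where "t \<in> R" "x = c * t" by auto
  then show "r * x \<in> (*) c ` R"
    by (intro image_eqI[of _ _ "r * t"]) (auto intro: r mult_closed)
qed

text \<open>This is the product of \<open>I\<close> with the fractional ideal generated by 1 and
  \<open>x\<close>. The fraction \<open>x\<close> may lie outside \<open>R\<close>; the hypothesis
  keeps the product inside.\<close>

lemma ideal_add_smult:
  assumes I: "ideal I Rg" and xI: "\<And>i. i \<in> I \<Longrightarrow> x * i \<in> R"
  shows "ideal {i + x * i' |i i'. i \<in> I \<and> i' \<in> I} Rg"
  unfolding ideal_iff
proof (intro conjI ballI)
  note c = ideal_closed[OF I]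
  show "{i + x * i' |i i'. i \<in> I \<and> i' \<in> I} \<subseteq> R" using c xI by (auto intro: add_closed)
  show "0 \<in> {i + x * i' |i i'. i \<in> I \<and> i' \<in> I}" using c(2) by (intro CollectI exI[of _ 0]) simp
  fix y z assume "y \<in> {i + x * i' |i i'. i \<in> I \<and> i' \<in> I}" "z \<in> {i + x * i' |i i'. i \<in> I \<and> i' \<in> I}"
  then obtain a b a' b' where "a \<in> I" "b \<in> I" "a' \<in> I" "b' \<in> I" "y = a + x * b" "z = a' + x * b'" by auto
  then show "y + z \<in> {i + x * i' |i i'. i \<in> I \<and> i' \<in> I}"
    by (intro CollectI exI[of _ "a + a'"] exI[of _ "b + b'"]) (auto simp: algebra_simps c)
next
  fix r y assume "r \<in> R" "y \<in> {i + x * i' |i i'. i \<in> I \<and> i' \<in> I}"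
  then obtain a b where "r \<in> R" "a \<in> I" "b \<in> I" "y = a + x * b" by auto
  then show "r * y \<in> {i + x * i' |i i'. i \<in> I \<and> i' \<in> I}"
    using ideal_closed(4)[OF I]
    by (intro CollectI exI[of _ "r * a"] exI[of _ "r * b"] conjI) (simp_all add: distrib_left mult.left_commute)
qed

lemma ideal_add_principal:
  assumes I: "ideal I Rg" and a: "a \<in> R"
  shows "ideal {i + r * a |i r. i \<in> I \<and> r \<in> R} Rg"
  unfolding ideal_iff
proof (intro conjI ballI)
  note c = ideal_closed[OF I]
  let ?J = "{i + r * a |i r. i \<in> I \<and> r \<in> R}"
  show "?J \<subseteq> R" using c a by (auto intro: add_closed mult_closed)
  show "0 \<in> ?J" using c(2) zero_closed by (intro CollectI exI[of _ 0]) simp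
  fix y z assume "y \<in> ?J" "z \<in> ?J"
  then obtain i r i' r' where "i \<in> I" "r \<in> R" "i' \<in> I" "r' \<in> R" "y = i + r * a" "z = i' + r' * a"
    by auto
  then show "y + z \<in> ?J"
    by (intro CollectI exI[of _ "i + i'"] exI[of _ "r + r'"]) (auto simp: algebra_simps c add_closed)
next
  let ?J = "{i + r * a |i r. i \<in> I \<and> r \<in> R}"
  fix s y assume "s \<in> R" "y \<in> ?J"
  then obtain i r where "s \<in> R" "i \<in> I" "r \<in> R" "y = i + r * a" by auto
  then show "s * y \<in> ?J"
    using ideal_closed(4)[OF I]
    by (intro CollectI exI[of _ "s * i"] exI[of _ "s * r"] conjI) (simp_all add: distrib_left mult.assoc mult_closed)
qed

lemma ideal_prod_subsetI:
  assumes "ideal K Rg" "\<And>i j. i \<in> I \<Longrightarrow> j \<in> J \<Longrightarrow> i * j \<in> K"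
  shows "ideal_prod Rg I J \<subseteq> K"
proof
  fix x assume "x \<in> ideal_prod Rg I J"
  then show "x \<in> K" by induction (use assms ideal_closed(3)[OF assms(1)] in auto)
qed

lemma ideal_prod_memI: "i \<in> I \<Longrightarrow> j \<in> J \<Longrightarrow> i * j \<in> ideal_prod Rg I J"
  using ideal_prod.prod[of i I j J Rg] by simp

lemma ideal_prod_subset:
  assumes "ideal I Rg" "ideal J Rg"
  shows "ideal_prod Rg I J \<subseteq> I" "ideal_prod Rg I J \<subseteq> J"
  using Rg.ideal_prod_inter[OF assms] by auto

lemma ideal_prod_mono:
  assumes "I \<subseteq> I'" "J \<subseteq> J'"
  shows "ideal_prod Rg I J \<subseteq> ideal_prod Rg I' J'"
proof
  fix x assume "x \<in> ideal_prod Rg I J"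
  then show "x \<in> ideal_prod Rg I' J'"
  proof induction
    case (prod i j)
    then show ?case using assms by (intro ideal_prod.prod) auto
  next
    case (sum a b)
    then show ?case by (intro ideal_prod.sum)
  qed
qed

lemma ideal_R: "ideal R Rg"
  using Rg.oneideal by simp

lemma ideal_prod_R: "ideal I Rg \<Longrightarrow> ideal_prod Rg I R = I"
  using Rg.ideal_prod_one[of I] by simp

text \<open>The same fold as in \<open>ideal_norm\<close>, with the unit ideal for the empty
  list.\<close>

abbreviation prodl :: "'k set list \<Rightarrow> 'k set"
  where "prodl Ps \<equiv> foldr (ideal_prod Rg) Ps R"

lemma ideal_prodl: "(\<And>P. P \<in> set Ps \<Longrightarrow> ideal P Rg) \<Longrightarrow> ideal (prodl Ps) Rg"
  by (induction Ps) (auto intro: ideal_R Rg.ideal_prod_is_ideal)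

lemma prodl_append:
  assumes "\<And>P. P \<in> set (us @ vs) \<Longrightarrow> ideal P Rg"
  shows "prodl (us @ vs) = ideal_prod Rg (prodl us) (prodl vs)"
  using assms
proof (induction us)
  case Nil
  then have v: "ideal (prodl vs) Rg" by (auto intro: ideal_prodl)
  then show ?case using ideal_prod_R[OF v] Rg.ideal_prod_commute[OF v ideal_R] by simp
next
  case (Cons u us)
  then have "ideal u Rg" "ideal (prodl us) Rg" "ideal (prodl vs) Rg" by (auto intro!: ideal_prodl)
  then show ?case using Cons by (simp add: Rg.ideal_prod_assoc)
qed

lemma prodl_split:
  assumes "\<And>Q. Q \<in> set (us @ P # vs) \<Longrightarrow> ideal Q Rg"
  shows "prodl (us @ P # vs) = ideal_prod Rg P (prodl (us @ vs))"
proof -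
  have i: "ideal P Rg" "ideal (prodl us) Rg" "ideal (prodl vs) Rg" using assms by (auto intro!: ideal_prodl)
  have "prodl (us @ P # vs) = ideal_prod Rg (prodl us) (ideal_prod Rg P (prodl vs))"
    using prodl_append[of us "P # vs"] assms by simp
  also have "\<dots> = ideal_prod Rg (ideal_prod Rg (prodl us) P) (prodl vs)"
    using i by (simp add: Rg.ideal_prod_assoc)
  also have "ideal_prod Rg (prodl us) P = ideal_prod Rg P (prodl us)"
    using i by (simp add: Rg.ideal_prod_commute)
  also have "ideal_prod Rg \<dots> (prodl vs) = ideal_prod Rg P (prodl (us @ vs))"
    using i assms by (subst prodl_append) (auto simp: Rg.ideal_prod_assoc)
  finally show ?thesis .
qed

text \<open>Since \<open>ideal_norm\<close> speaks of lists of primes, this is what allows the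
  passage to multisets.\<close>

lemma prodl_cong_mset:
  assumes "mset Ps = mset Qs" "\<And>P. P \<in> set Ps \<Longrightarrow> ideal P Rg"
  shows "prodl Ps = prodl Qs"
  using assms
proof (induction Ps arbitrary: Qs)
  case (Cons P Ps)
  then have "P \<in> set Qs" by (metis list.set_intros(1) set_mset_mset)
  then obtain us vs where Q: "Qs = us @ P # vs" by (meson split_list)
  have "set Qs = set (P # Ps)" using Cons.prems(1) by (metis set_mset_mset)
  then have "ideal Z Rg" if "Z \<in> set Qs" for Z using Cons.prems(2) that by simp
  then have "prodl Qs = ideal_prod Rg P (prodl (us @ vs))"
    unfolding Q by (rule prodl_split)
  also have "prodl (us @ vs) = prodl Ps"
    using Cons.prems by (intro Cons.IH[symmetric]) (simp_all add: Q)
  finally show ?case by simp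
qed simp

lemma prime_contains_factor:
  assumes P: "primeideal P Rg" and "prodl Ps \<subseteq> P" "\<And>Q. Q \<in> set Ps \<Longrightarrow> ideal Q Rg"
  shows "\<exists>Q\<in>set Ps. Q \<subseteq> P"
  using assms(2,3)
proof (induction Ps)
  case Nil
  then show ?case using P by (auto simp: primeideal_iff dest: ideal_closed)
next
  case (Cons Q Ps)
  have "Q \<subseteq> P \<or> prodl Ps \<subseteq> P"
    using Cons.prems P by (intro Rg.primeideal_divides_ideal_prod) (auto intro!: ideal_prodl)
  then show ?case using Cons by auto
qed

end

text \<open>The first axiom expresses finiteness of \<open>R/cR\<close> by a bound on sets of
  pairwise incongruent elements, which a counting argument delivers directly. The second is integral
  closedness for the single monic equations \<open>X^j - X^i = r\<close>, the only ones that the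
  pigeonhole principle produces.\<close>

locale finite_quotient_domain = subring_of_field R for R :: "'k::field set" +
  assumes finite_quotient: "c \<in> R \<Longrightarrow> c \<noteq> 0 \<Longrightarrow> \<exists>N. \<forall>Y\<subseteq>R. finite Y \<longrightarrow>
      (\<forall>y\<in>Y. \<forall>z\<in>Y. y - z \<in> (*) c ` R \<longrightarrow> y = z) \<longrightarrow> card Y \<le> N"
    and power_diff_integral: "x ^ j - x ^ i \<in> R \<Longrightarrow> i < j \<Longrightarrow> x \<in> R"
begin

lemma pigeonhole_quotient:
  fixes f :: "nat \<Rightarrow> 'k"
  assumes c: "c \<in> R" "c \<noteq> 0" and f: "\<And>n. f n \<in> R"
  shows "\<exists>i j. i < j \<and> f j - f i \<in> (*) c ` R"
proof (rule ccontr)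
  assume "\<not> ?thesis"
  then have *: "f j - f i \<notin> (*) c ` R" if "i < j" for i j using that by blast
  have u: "- x \<in> (*) c ` R" if "x \<in> (*) c ` R" for x
    using ideal_closed(6)[OF principal_ideal[OF c(1)] that] .
  have **: "f j - f i \<notin> (*) c ` R" if "i \<noteq> j" for i j
    using *[of i j] *[of j i] u[of "f j - f i"] that by (cases "i < j") auto
  have "0 \<in> (*) c ` R" using principal_ideal[OF c(1)] ideal_closed(2) by blast
  then have inj: "inj f" using ** by (intro injI) (metis diff_self)
  obtain N where N: "\<forall>Y\<subseteq>R. finite Y \<longrightarrow>
      (\<forall>y\<in>Y. \<forall>z\<in>Y. y - z \<in> (*) c ` R \<longrightarrow> y = z) \<longrightarrow> card Y \<le> N"
    using finite_quotient[OF c] by blast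
  have "y = z" if yz: "y \<in> f ` {..N}" "z \<in> f ` {..N}" "y - z \<in> (*) c ` R" for y z
  proof -
    obtain a b where "y = f a" "z = f b" using yz by blast
    then show ?thesis using **[of b a] yz(3) by (cases "b = a") auto
  qed
  moreover have "f ` {..N} \<subseteq> R" using f by blast
  ultimately have "card (f ` {..N}) \<le> N" using N[rule_format, of "f ` {..N}"] by blast
  then show False using inj by (simp add: card_image inj_on_subset)
qed

text \<open>The map \<open>q\<close> factors through \<open>R/cR\<close>: a finite part of its image
  lifts to pairwise incongruent elements, whose number is bounded.\<close>

lemma finite_image_quotient:
  assumes c: "c \<in> R" "c \<noteq> 0"
    and q: "\<And>x y. x \<in> R \<Longrightarrow> y \<in> R \<Longrightarrow> y - x \<in> (*) c ` R \<Longrightarrow> q x = q y"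
  shows "finite (q ` R)"
proof (rule ccontr)
  assume inf: "infinite (q ` R)"
  obtain N where N: "\<forall>Y\<subseteq>R. finite Y \<longrightarrow>
      (\<forall>y\<in>Y. \<forall>z\<in>Y. y - z \<in> (*) c ` R \<longrightarrow> y = z) \<longrightarrow> card Y \<le> N"
    using finite_quotient[OF c] by blast
  obtain T where T: "T \<subseteq> q ` R" "finite T" "card T = Suc N"
    using infinite_arbitrarily_large[of "q ` R" "Suc N"] inf by metis
  then obtain Y where Y: "Y \<subseteq> R" "T = q ` Y" "inj_on q Y"
    by (meson subset_image_inj)
  then have "finite Y" "card Y = Suc N" using T finite_image_iff card_image by metis+
  moreover have "\<forall>y\<in>Y. \<forall>z\<in>Y. y - z \<in> (*) c ` R \<longrightarrow> y = z"
    using Y q by (metis inj_onD subsetD)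
  ultimately show False using N Y(1) by (metis Suc_n_not_le_n)
qed

text \<open>An ideal containing \<open>c\<close> is a union of cosets of \<open>cR\<close>, and
  there are finitely many cosets.\<close>

lemma finite_ideals_containing:
  assumes c: "c \<in> R" "c \<noteq> 0"
  shows "finite {J. ideal J Rg \<and> c \<in> J}"
proof -
  define q where "q x = {y\<in>R. y - x \<in> (*) c ` R}" for x
  note pc = ideal_closed[OF principal_ideal[OF c(1)]]
  have "finite (q ` R)"
  proof (rule finite_image_quotient[OF c])
    fix x y assume xy: "x \<in> R" "y \<in> R" "y - x \<in> (*) c ` R"
    have "z - x \<in> (*) c ` R \<longleftrightarrow> z - y \<in> (*) c ` R" for z
      using pc(3)[OF _ xy(3), of "z - y"] pc(7)[OF _ xy(3), of "z - x"] by auto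
    then show "q x = q y" by (simp add: q_def)
  qed
  moreover have "{J. ideal J Rg \<and> c \<in> J} \<subseteq> Union ` Pow (q ` R)"
  proof
    fix J assume "J \<in> {J. ideal J Rg \<and> c \<in> J}"
    then have J: "ideal J Rg" "c \<in> J" by auto
    have "\<Union> (q ` J) = J"
    proof
      show "J \<subseteq> \<Union> (q ` J)" using ideal_closed(5)[OF J(1)] pc(2) by (auto simp: q_def)
      show "\<Union> (q ` J) \<subseteq> J"
      proof
        fix y assume "y \<in> \<Union> (q ` J)"
        then obtain x r where "x \<in> J" "r \<in> R" "y - x = c * r" by (auto simp: q_def)
        then show "y \<in> J"
          using ideal_closed(3,8)[OF J(1)] J(2) by (metis add.commute diff_add_cancel)
      qed
    qed
    moreover have "q ` J \<in> Pow (q ` R)" using ideal_closed(1)[OF J(1)] by blast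
    ultimately show "J \<in> Union ` Pow (q ` R)" by (metis image_eqI)
  qed
  ultimately show ?thesis by (meson finite_surj finite_Pow_iff)
qed

lemma finite_ideals_above:
  assumes "ideal I Rg" "I \<noteq> {0}"
  shows "finite {J. ideal J Rg \<and> I \<subseteq> J}"
proof -
  obtain c where "c \<in> I" "c \<noteq> 0" using ideal_nonzero assms by blast
  then show ?thesis
    using ideal_closed(5)[OF assms(1)]
    by (intro finite_subset[OF _ finite_ideals_containing[of c]]) auto
qed

lemma card_ideals_above_less:
  assumes "ideal I Rg" "I \<noteq> {0}" "ideal J Rg" "I \<subset> J"
  shows "card {K. ideal K Rg \<and> J \<subseteq> K} < card {K. ideal K Rg \<and> I \<subseteq> K}"
  by (rule psubset_card_mono[OF finite_ideals_above]) (use assms in auto)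

lemma stabilizer_integral:
  assumes I: "ideal I Rg" "I \<noteq> {0}" and x: "\<And>i. i \<in> I \<Longrightarrow> x * i \<in> I"
  shows "x \<in> R"
proof -
  obtain c where c: "c \<in> I" "c \<noteq> 0" using ideal_nonzero I by blast
  have "x ^ n * c \<in> I" for n by (induction n) (auto simp: c mult.assoc x)
  then have "x ^ n * c \<in> R" for n using ideal_closed(5)[OF I(1)] by blast
  \<comment> \<open>The multiplier \<open>c\<close> that brings the powers of \<open>x\<close> into
    \<open>R\<close> is also the modulus, so it cancels below.\<close>
  then obtain i j r where ij: "i < j" "r \<in> R" "x ^ j * c - x ^ i * c = c * r"
    using pigeonhole_quotient[of c "\<lambda>n. x ^ n * c"] c ideal_closed(5)[OF I(1)] by (metis imageE)
  then have "c * (x ^ j - x ^ i) = c * r" by (simp add: algebra_simps)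
  then have "x ^ j - x ^ i = r" using c by (metis mult_left_cancel)
  then show ?thesis using ij power_diff_integral[of x j i] by simp
qed

text \<open>This is the proof that a finite domain is a field. Two powers of some \<open>x\<close>
  in \<open>J\<close> but not in \<open>P\<close> agree modulo \<open>P\<close>; cancelling the
  lower one gives \<open>x^(j-i) - 1\<close> in \<open>P\<close>, hence 1 in
  \<open>J\<close>.\<close>

lemma primeideal_maximal:
  assumes P: "primeideal P Rg" "P \<noteq> {0}" and J: "ideal J Rg" "P \<subset> J"
  shows "J = R"
proof -
  note Pi = P(1)[unfolded primeideal_iff]
  obtain c where c: "c \<in> P" "c \<noteq> 0" using ideal_nonzero P Pi by blast
  obtain x where x: "x \<in> J" "x \<notin> P" using J by blast
  have xR: "x \<in> R" using ideal_closed(5)[OF J(1)] x by blast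
  obtain i j r where ij: "i < j" "r \<in> R" "x ^ j - x ^ i = c * r"
    using pigeonhole_quotient[of c "\<lambda>n. x ^ n"] c Pi ideal_closed(5)[of P] power_closed[OF xR] by blast
  have "x ^ j = x ^ i * x ^ (j - i)" using ij(1) by (simp flip: power_add)
  then have "x ^ i * (x ^ (j - i) - 1) = c * r" using ij(3) by (simp add: algebra_simps)
  also have "\<dots> \<in> P" using c ij ideal_closed(8)[of P] Pi by blast
  finally have *: "x ^ i * (x ^ (j - i) - 1) \<in> P" .
  have "x ^ n \<notin> P" for n
  proof (induction n)
    case 0
    then show ?case using Pi ideal_eq_R_iff by auto
  next
    case (Suc n)
    then show ?case using Pi x xR power_closed[OF xR, of n] by auto
  qed
  then have "x ^ (j - i) - 1 \<in> P"
    using * Pi power_closed[OF xR] diff_closed one_closed by blast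
  then have m: "x ^ (j - i) - 1 \<in> J" using J by blast
  have "x ^ (j - i) = x ^ (j - i - 1) * x" using ij(1) by (metis power_minus_mult zero_less_diff)
  then have "x ^ (j - i) \<in> J" using ideal_closed(4)[OF J(1) power_closed[OF xR] x(1)] by simp
  from ideal_closed(7)[OF J(1) this m] show ?thesis using ideal_eq_R_iff[OF J(1)] by simp
qed

lemma primeideal_eqI:
  assumes "primeideal P Rg" "P \<noteq> {0}" "primeideal Q Rg" "P \<subseteq> Q"
  shows "P = Q"
  using primeideal_maximal[of P Q] assms by (auto simp: primeideal_iff)

section \<open>Prime products, inversion of primes and factorisation\<close>

lemma nonzero_primes_iff: "P \<in> nonzero_primes Rg \<longleftrightarrow> primeideal P Rg \<and> P \<noteq> {0}"
  by (simp add: nonzero_primes_def)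

lemma nonzero_primes_ideal: "P \<in> nonzero_primes Rg \<Longrightarrow> ideal P Rg"
  by (simp add: nonzero_primes_iff primeideal_iff)

text \<open>If \<open>a * b\<close> lies in \<open>I\<close> but neither factor does, then
  \<open>(I + Ra)(I + Rb)\<close> lies in \<open>I\<close> and both factors are strictly larger
  ideals. The finite number of ideals above \<open>I\<close> drops and serves as the induction
  measure.\<close>

lemma ideal_contains_prime_product:
  assumes "ideal I Rg" "I \<noteq> {0}"
  shows "\<exists>Ps. set Ps \<subseteq> nonzero_primes Rg \<and> prodl Ps \<subseteq> I"
  using assms
proof (induction "card {J. ideal J Rg \<and> I \<subseteq> J}" arbitrary: I rule: less_induct)
  case less
  note I = less.prems
  consider "I = R" | "primeideal I Rg" |
    a b where "a \<in> R" "b \<in> R" "a * b \<in> I" "a \<notin> I" "b \<notin> I"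
    using I unfolding primeideal_iff by blast
  then show ?case
  proof cases
    case 1
    then show ?thesis by (intro exI[of _ "[]"]) auto
  next
    case 2
    then show ?thesis using ideal_prod_R I
      by (intro exI[of _ "[I]"]) (auto simp: nonzero_primes_iff)
  next
    case (3 a b)
    let ?A = "\<lambda>a. {i + r * a |i r. i \<in> I \<and> r \<in> R}"
    have *: "\<exists>Ps. set Ps \<subseteq> nonzero_primes Rg \<and> prodl Ps \<subseteq> ?A a" if a: "a \<in> R" "a \<notin> I" for a
    proof -
      have A: "ideal (?A a) Rg" using ideal_add_principal I a by blast
      have sub: "I \<subseteq> ?A a" using zero_closed by force
      have "a \<in> ?A a"
        by (intro CollectI exI[of _ 0] exI[of _ 1]) (simp add: one_closed ideal_closed(2)[OF I(1)])
      then have ps: "I \<subset> ?A a" using a sub by blast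
      have "?A a \<noteq> {0}"
      proof
        assume "?A a = {0}"
        then have "I \<subseteq> {0}" using sub by (rule subst)
        then show False using I(2) ideal_closed(2)[OF I(1)] by blast
      qed
      then show ?thesis using less.hyps[OF card_ideals_above_less[OF I A ps] A] by blast
    qed
    obtain Ps where Ps: "set Ps \<subseteq> nonzero_primes Rg" "prodl Ps \<subseteq> ?A a"
      using *[OF 3(1,4)] by (elim exE conjE)
    obtain Qs where Qs: "set Qs \<subseteq> nonzero_primes Rg" "prodl Qs \<subseteq> ?A b"
      using *[OF 3(2,5)] by (elim exE conjE)
    note PQ = Ps Qs
    have "prodl (Ps @ Qs) = ideal_prod Rg (prodl Ps) (prodl Qs)"
      using PQ by (intro prodl_append) (auto intro: nonzero_primes_ideal)
    also have "\<dots> \<subseteq> ideal_prod Rg (?A a) (?A b)" using PQ by (intro ideal_prod_mono) auto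
    also have "\<dots> \<subseteq> I"
    proof (rule ideal_prod_subsetI[OF I(1)])
      fix i j assume "i \<in> ?A a" "j \<in> ?A b"
      then obtain i' r j' s where ij: "i = i' + r * a" "i' \<in> I" "r \<in> R" "j = j' + s * b" "j' \<in> I" "s \<in> R"
        by blast
      have "i * j = j * i' + (r * a * j' + (r * s) * (a * b))" unfolding ij by (simp add: algebra_simps)
      moreover have "j \<in> R" using ij 3 ideal_closed(5)[OF I(1)] by (auto intro: add_closed mult_closed)
      ultimately show "i * j \<in> I"
        using ij 3 ideal_closed(3,4)[OF I(1)] mult_closed by auto
    qed
    finally show ?thesis using PQ by (intro exI[of _ "Ps @ Qs"]) auto
  qed
qed

text \<open>The multiplier is \<open>b / a\<close> with \<open>a\<close> in \<open>P\<close>: take a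
  shortest product of primes inside \<open>aR\<close>. By maximality one of its factors is
  \<open>P\<close>; removing it leaves a product with an element \<open>b\<close> outside
  \<open>aR\<close>, while \<open>P\<close> times that product is inside.\<close>

lemma exists_prime_multiplier:
  assumes "P \<in> nonzero_primes Rg"
  shows "\<exists>x. x \<notin> R \<and> (\<forall>p\<in>P. x * p \<in> R)"
proof -
  note P = assms[unfolded nonzero_primes_iff]
  note Pi = conjunct1[OF conjunct1[OF P, unfolded primeideal_iff]]
  obtain a where a: "a \<in> P" "a \<noteq> 0" using ideal_nonzero P Pi by blast
  have aR: "a \<in> R" using a ideal_closed(5)[OF Pi] by blast
  define good where "good Ps \<longleftrightarrow> set Ps \<subseteq> nonzero_primes Rg \<and> prodl Ps \<subseteq> (*) a ` R" for Ps
  have "(*) a ` R \<noteq> {0}" using a one_closed by force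
  then obtain Ps0 where "good Ps0"
    using ideal_contains_prime_product[OF principal_ideal[OF aR]] unfolding good_def by blast
  then obtain Ps where Ps: "good Ps" and min: "\<And>Qs. good Qs \<Longrightarrow> length Ps \<le> length Qs"
    using ex_has_least_nat[of good Ps0 length] by auto
  have id: "ideal Q Rg" if "Q \<in> set Ps" for Q
    using Ps that nonzero_primes_ideal by (auto simp: good_def)
  have "prodl Ps \<subseteq> P"
    using Ps a ideal_closed(8)[OF Pi] by (auto simp: good_def)
  then obtain Q where Q: "Q \<in> set Ps" "Q \<subseteq> P"
    using prime_contains_factor[of P Ps] P id by blast
  then have "Q = P" using Ps P by (intro primeideal_eqI) (auto simp: good_def nonzero_primes_iff)
  then obtain us vs where sp: "Ps = us @ P # vs" using Q by (meson split_list)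
  \<comment> \<open>The list without \<open>P\<close> is shorter, so minimality applies.\<close>
  have "\<not> good (us @ vs)" using min[of "us @ vs"] by (auto simp: sp)
  then obtain b where b: "b \<in> prodl (us @ vs)" "b \<notin> (*) a ` R"
    using Ps by (auto simp: good_def sp)
  have bR: "b \<in> R"
    using b ideal_closed(5)[OF ideal_prodl[of "us @ vs"]] id sp by auto
  have "(b / a) * p \<in> R" if p: "p \<in> P" for p
  proof -
    have "p * b \<in> ideal_prod Rg P (prodl (us @ vs))" using p b by (intro ideal_prod_memI)
    also have "\<dots> = prodl Ps" unfolding sp by (rule prodl_split[symmetric]) (use id sp in auto)
    finally have "p * b \<in> (*) a ` R" using Ps by (auto simp: good_def)
    then obtain r where "r \<in> R" "p * b = a * r" by auto
    then show ?thesis using a by (simp add: field_simps)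
  qed
  moreover have "b / a \<notin> R"
  proof
    assume "b / a \<in> R"
    then have "a * (b / a) \<in> (*) a ` R" by blast
    then show False using b a by simp
  qed
  ultimately show ?thesis by blast
qed

text \<open>The fractional ideal \<open>R + xR\<close> inverts \<open>P\<close>; only \<open>1 \<in> P + xP\<close> is needed below.\<close>

lemma prime_inverse:
  assumes "P \<in> nonzero_primes Rg"
  obtains x p p' where "x \<notin> R" "\<And>z. z \<in> P \<Longrightarrow> x * z \<in> R" "p \<in> P" "p' \<in> P" "1 = p + x * p'"
proof -
  note P = assms[unfolded nonzero_primes_iff]
  note Pi = nonzero_primes_ideal[OF assms]
  obtain x where x: "x \<notin> R" "\<And>z. z \<in> P \<Longrightarrow> x * z \<in> R" using exists_prime_multiplier[OF assms] by blast
  define J where "J = {i + x * i' |i i'. i \<in> P \<and> i' \<in> P}"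
  have J: "ideal J Rg" unfolding J_def by (rule ideal_add_smult[OF Pi x(2)])
  have PJ: "P \<subseteq> J" unfolding J_def using ideal_closed(2)[OF Pi] by force
  have xJ: "x * z \<in> J" if "z \<in> P" for z unfolding J_def using ideal_closed(2)[OF Pi] that by force
  \<comment> \<open>Equality would make \<open>x\<close> stabilise \<open>P\<close> and hence lie in
    \<open>R\<close>. As \<open>P\<close> is maximal, strict growth forces
    \<open>J = R\<close>.\<close>
  have "P \<noteq> J" using stabilizer_integral[OF Pi] P x xJ by metis
  then have "J = R" using primeideal_maximal[of P J] P PJ J by blast
  then have "1 \<in> J" using one_closed by simp
  then show ?thesis using that x unfolding J_def by blast
qed

text \<open>The quotient is \<open>J = I + xI\<close>, the ideal \<open>I\<close> times the inverse
  of \<open>P\<close>. It is strictly larger, since otherwise \<open>x\<close> would stabilise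
  \<open>I\<close>; and multiplying \<open>1 = p + x * p'\<close> by an element of \<open>I\<close>
  exhibits that element in the product of \<open>P\<close> and \<open>J\<close>.\<close>

lemma prime_divides:
  assumes P: "P \<in> nonzero_primes Rg" and I: "ideal I Rg" "I \<noteq> {0}" "I \<subseteq> P"
  shows "\<exists>J. ideal J Rg \<and> I \<subset> J \<and> I = ideal_prod Rg P J"
proof -
  obtain x p p' where x: "x \<notin> R" "\<And>z. z \<in> P \<Longrightarrow> x * z \<in> R" and p: "p \<in> P" "p' \<in> P" "1 = p + x * p'"
    using prime_inverse[OF P] by blast
  note Pi = nonzero_primes_ideal[OF P]
  note IR = ideal_closed(5)[OF I(1)]
  define J where "J = {i + x * i' |i i'. i \<in> I \<and> i' \<in> I}"
  have J: "ideal J Rg" unfolding J_def using x I by (intro ideal_add_smult) auto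
  have IJ: "I \<subseteq> J" unfolding J_def using ideal_closed(2)[OF I(1)] by force
  have xJ: "x * z \<in> J" if "z \<in> I" for z unfolding J_def using ideal_closed(2)[OF I(1)] that by force
  have "I \<noteq> J" using stabilizer_integral[OF I(1,2)] x xJ by metis
  moreover have "ideal_prod Rg P J \<subseteq> I"
  proof (rule ideal_prod_subsetI[OF I(1)])
    fix z j assume z: "z \<in> P" and "j \<in> J"
    then obtain i i' where j: "i \<in> I" "i' \<in> I" "j = i + x * i'" by (auto simp: J_def)
    have "z * j = z * i + (x * z) * i'" by (simp add: j algebra_simps)
    then show "z * j \<in> I"
      using ideal_closed(3,4)[OF I(1)] j z x(2) ideal_closed(5)[OF Pi] by simp
  qed
  moreover have "I \<subseteq> ideal_prod Rg P J"
  proof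
    fix i assume i: "i \<in> I"
    have "i = p * i + p' * (x * i)"
      using arg_cong[OF p(3), of "\<lambda>t. t * i"] by (simp add: algebra_simps)
    moreover have "p * i \<in> ideal_prod Rg P J" "p' * (x * i) \<in> ideal_prod Rg P J"
      using i IJ xJ p by (auto intro!: ideal_prod_memI)
    ultimately show "i \<in> ideal_prod Rg P J"
      using ideal_closed(3)[OF Rg.ideal_prod_is_ideal[OF Pi J]] by metis
  qed
  ultimately show ?thesis using J IJ by blast
qed

text \<open>Multiplication by \<open>x\<close> carries the common product back into
  \<open>J\<close>, because \<open>x * P\<close> lies in \<open>R\<close>. So both terms of
  \<open>i = p * i + x * (p' * i)\<close> lie in \<open>J\<close>.\<close>

lemma prime_cancel:
  assumes P: "P \<in> nonzero_primes Rg" and I: "ideal I Rg" and J: "ideal J Rg"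
    and eq: "ideal_prod Rg P I = ideal_prod Rg P J"
  shows "I \<subseteq> J"
proof
  obtain x p p' where x: "x \<notin> R" "\<And>z. z \<in> P \<Longrightarrow> x * z \<in> R" and p: "p \<in> P" "p' \<in> P" "1 = p + x * p'"
    using prime_inverse[OF P] by blast
  note Pi = nonzero_primes_ideal[OF P]
  have *: "x * z \<in> J" if "z \<in> ideal_prod Rg P J" for z
    using that
  proof induction
    case (prod i j)
    then have "(x * i) * j \<in> J" by (intro ideal_closed(4)[OF J] x(2))
    then show ?case by (simp add: mult.assoc)
  next
    case (sum s1 s2)
    then show ?case using ideal_closed(3)[OF J] by (simp add: distrib_left)
  qed
  fix i assume i: "i \<in> I"
  have "p * i \<in> J"
    using ideal_prod_memI[OF p(1) i] eq ideal_prod_subset(2)[OF Pi J] by auto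
  moreover have "x * (p' * i) \<in> J"
    using ideal_prod_memI[OF p(2) i] eq by (intro *) simp
  moreover have "i = p * i + x * (p' * i)"
    using arg_cong[OF p(3), of "\<lambda>t. t * i"] by (simp add: algebra_simps)
  ultimately show "i \<in> J" using ideal_closed(3)[OF J] by metis
qed

lemma prime_above_exists:
  assumes I: "ideal I Rg" "I \<noteq> {0}" "I \<noteq> R"
  shows "\<exists>P\<in>nonzero_primes Rg. I \<subseteq> P"
proof -
  define S where "S = {J. ideal J Rg \<and> I \<subseteq> J} - {R}"
  have "finite S" "S \<noteq> {}" using I finite_ideals_above[OF I(1,2)] by (auto simp: S_def)
  then obtain M where M: "M \<in> S" and max: "\<And>J. J \<in> S \<Longrightarrow> M \<subseteq> J \<Longrightarrow> M = J"
    by (meson finite_has_maximal)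
  have "maximalideal M Rg"
    unfolding maximalideal_def maximalideal_axioms_def
    using M max by (auto simp: S_def)
  then have "primeideal M Rg" by (rule Rg.maximalideal_prime)
  moreover have "M \<noteq> {0}" using M I ideal_closed(2)[OF I(1)] by (auto simp: S_def)
  ultimately show ?thesis using M by (auto simp: nonzero_primes_iff S_def)
qed

text \<open>Dividing off a prime strictly enlarges the ideal, so fewer ideals remain above
  it.\<close>

theorem prime_factorization_exists:
  assumes "ideal I Rg" "I \<noteq> {0}"
  shows "\<exists>Ps. set Ps \<subseteq> nonzero_primes Rg \<and> I = prodl Ps"
  using assms
proof (induction "card {J. ideal J Rg \<and> I \<subseteq> J}" arbitrary: I rule: less_induct)
  case less
  show ?case
  proof (cases "I = R")
    case True
    then show ?thesis by (intro exI[of _ "[]"]) auto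
  next
    case False
    then obtain P where P: "P \<in> nonzero_primes Rg" "I \<subseteq> P" using prime_above_exists less.prems by blast
    then obtain J where J: "ideal J Rg" "I \<subset> J" "I = ideal_prod Rg P J"
      using prime_divides[OF P(1) less.prems P(2)] by auto
    have "J \<noteq> {0}" using J ideal_closed(2) less.prems by blast
    then obtain Ps where "set Ps \<subseteq> nonzero_primes Rg" "J = prodl Ps"
      using less.hyps[OF card_ideals_above_less[OF less.prems J(1,2)] J(1)] by blast
    then show ?thesis using P J by (intro exI[of _ "P # Ps"]) auto
  qed
qed

theorem prime_factorization_unique:
  assumes "set Ps \<subseteq> nonzero_primes Rg" "set Qs \<subseteq> nonzero_primes Rg" "prodl Ps = prodl Qs"
  shows "mset Ps = mset Qs"
  using assms
proof (induction Ps arbitrary: Qs)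
  case Nil
  show ?case
  proof (cases Qs)
    case (Cons Q Qs')
    then have "ideal Q Rg" "ideal (prodl Qs') Rg"
      using Nil nonzero_primes_ideal by (auto intro!: ideal_prodl)
    then have "R \<subseteq> Q" using ideal_prod_subset(1)[of Q "prodl Qs'"] Nil Cons by simp
    then show ?thesis using Nil Cons ideal_closed(1)[of Q] by (auto simp: nonzero_primes_iff primeideal_iff)
  qed simp
next
  case (Cons P Ps)
  have id: "ideal Q Rg" if "Q \<in> set (P # Ps) \<union> set Qs" for Q
    using that Cons.prems nonzero_primes_ideal by auto
  have P: "P \<in> nonzero_primes Rg" "ideal P Rg" using Cons.prems id by auto
  have iPs: "ideal (prodl Ps) Rg" using id by (intro ideal_prodl) auto
  have "prodl Qs \<subseteq> P" using ideal_prod_subset(1)[OF P(2) iPs] Cons.prems(3) by simp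
  then obtain Q where Q: "Q \<in> set Qs" "Q \<subseteq> P"
    using prime_contains_factor[of P Qs] P id by (auto simp: nonzero_primes_iff)
  then have "Q = P" using P Cons.prems by (intro primeideal_eqI) (auto simp: nonzero_primes_iff)
  then obtain us vs where sp: "Qs = us @ P # vs" using Q by (meson split_list)
  have iq: "ideal (prodl (us @ vs)) Rg" using id by (intro ideal_prodl) (auto simp: sp)
  have "prodl Qs = ideal_prod Rg P (prodl (us @ vs))"
    unfolding sp by (rule prodl_split) (use id sp in auto)
  then have "ideal_prod Rg P (prodl Ps) = ideal_prod Rg P (prodl (us @ vs))" using Cons.prems(3) by simp
  then have "prodl Ps = prodl (us @ vs)"
    using prime_cancel[OF P(1) iPs iq] prime_cancel[OF P(1) iq iPs] by auto
  then have "mset Ps = mset (us @ vs)" using Cons.prems by (intro Cons.IH) (auto simp: sp)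
  then show ?case by (simp add: sp)
qed

end

section \<open>Integral closure of the polynomial ring\<close>

lemma card_polys_degree_le:
  "finite {p :: 'a::{finite,zero} poly. degree p \<le> d}"
  "card {p :: 'a poly. degree p \<le> d} \<le> CARD('a) ^ Suc d"
proof -
  have sub: "{p :: 'a poly. degree p \<le> d} \<subseteq> Poly ` {xs. set xs \<subseteq> UNIV \<and> length xs = Suc d}"
  proof
    fix p :: "'a poly" assume p: "p \<in> {p. degree p \<le> d}"
    have "p = Poly (map (coeff p) [0..<Suc d])"
      using p by (intro poly_eqI) (auto simp: nth_default_def coeff_eq_0 simp del: upt_Suc)
    then show "p \<in> Poly ` {xs. set xs \<subseteq> UNIV \<and> length xs = Suc d}" by (intro image_eqI) auto
  qed
  have fin: "finite {xs :: 'a list. set xs \<subseteq> UNIV \<and> length xs = Suc d}"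
    by (rule finite_lists_length_eq) simp
  show "finite {p :: 'a poly. degree p \<le> d}" using finite_subset[OF sub] fin by blast
  have "card {p :: 'a poly. degree p \<le> d} \<le> card (Poly ` {xs :: 'a list. set xs \<subseteq> UNIV \<and> length xs = Suc d})"
    using sub fin by (intro card_mono) auto
  also have "\<dots> \<le> card {xs :: 'a list. set xs \<subseteq> UNIV \<and> length xs = Suc d}"
    using fin by (rule card_image_le)
  also have "\<dots> = CARD('a) ^ Suc d" by (rule card_lists_length_eq) simp
  finally show "card {p :: 'a poly. degree p \<le> d} \<le> CARD('a) ^ Suc d" .
qed

text \<open>The powers of \<open>y / Q\<close> would outgrow any constant \<open>C\<close>. This
  removes the bounded part of the coordinate degrees when digit sums are counted.\<close>

lemma le_of_power_le:
  assumes "\<And>k. y ^ k \<le> C * Q ^ k" "Q > 0" "C > (0::nat)"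
  shows "y \<le> (Q::nat)"
proof (rule ccontr)
  assume "\<not> y \<le> Q"
  then have "1 < real y / real Q" using assms(2) by simp
  then obtain k where "real C < (real y / real Q) ^ k" using real_arch_pow by blast
  then have "real (C * Q ^ k) < real (y ^ k)" using assms(2) by (simp add: power_divide field_simps)
  then show False using assms(1)[of k] by linarith
qed

lemma (in ring) dimension_imp_coordinates:
  assumes "dimension n K E"
  shows "\<exists>us. set us \<subseteq> carrier R \<and> length us = n \<and>
    E \<subseteq> {combine cs us |cs. set cs \<subseteq> K \<and> length cs = n}"
  using assms
proof induction
  case zero_dim
  show ?case by (intro exI[of _ "[]"]) auto
next
  case (Suc_dim v E n K)
  then obtain us where us: "set us \<subseteq> carrier R" "length us = n"
    "E \<subseteq> {combine cs us |cs. set cs \<subseteq> K \<and> length cs = n}" by blast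
  have "line_extension K v E \<subseteq> {combine cs (v # us) |cs. set cs \<subseteq> K \<and> length cs = Suc n}"
  proof
    fix x assume "x \<in> line_extension K v E"
    then obtain k e where k: "k \<in> K" "e \<in> E" "x = k \<otimes> v \<oplus> e" by (auto simp: line_extension_mem_iff)
    then obtain cs where cs: "e = combine cs us" "set cs \<subseteq> K" "length cs = n" using us by blast
    show "x \<in> {combine cs (v # us) |cs. set cs \<subseteq> K \<and> length cs = Suc n}"
      using k cs by (intro CollectI exI[of _ "k # cs"]) auto
  qed
  then show ?case using us Suc_dim.hyps by (intro exI[of _ "v # us"]) auto
qed

locale function_field =
  fixes \<phi> :: "'q::finite_field poly fract \<Rightarrow> 'k::field"
  assumes \<phi>_hom: "\<phi> \<in> Ring.ring_hom ring_of_type_algebra ring_of_type_algebra"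
    and fin_dim: "ring.finite_dimension (ring_of_type_algebra :: 'k ring) (range \<phi>) UNIV"
begin

lemma \<phi>_simps [simp]: "\<phi> (x + y) = \<phi> x + \<phi> y" "\<phi> (x * y) = \<phi> x * \<phi> y" "\<phi> 1 = 1" "\<phi> 0 = 0"
proof -
  show a: "\<phi> (x + y) = \<phi> x + \<phi> y" for x y using ring_hom_add[OF \<phi>_hom, of x y] by simp
  show "\<phi> (x * y) = \<phi> x * \<phi> y" using ring_hom_mult[OF \<phi>_hom, of x y] by simp
  show "\<phi> 1 = 1" using ring_hom_one[OF \<phi>_hom] by simp
  show "\<phi> 0 = 0" using a[of 0 0] by (metis add_cancel_right_right add_0)
qed

lemma \<phi>_eq_0_iff [simp]: "\<phi> x = 0 \<longleftrightarrow> x = 0"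
  using \<phi>_simps(2)[of x "inverse x"] by (cases "x = 0") auto

definition emb :: "'q poly \<Rightarrow> 'k" where "emb = poly_embed \<phi>"

sublocale emb: inj_idom_hom emb
proof
  fix x y
  show "emb (x + y) = emb x + emb y" "emb (x * y) = emb x * emb y"
    by (simp_all add: emb_def poly_embed_def flip: \<phi>_simps)
  show "emb 1 = 1" "emb 0 = 0" by (simp_all add: emb_def poly_embed_def flip: One_fract_def Zero_fract_def)
  show "x = 0" if "emb x = 0"
    using that by (simp add: emb_def poly_embed_def Zero_fract_def eq_fract)
qed

lemma \<phi>_Fract: "b \<noteq> 0 \<Longrightarrow> \<phi> (Fract a b) * emb b = emb a"
proof -
  assume b: "b \<noteq> 0"
  then have "Fract a b * Fract b 1 = Fract a 1" by (simp add: eq_fract)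
  then show ?thesis unfolding emb_def poly_embed_def by (metis \<phi>_simps(2))
qed

definition integers :: "'k set"
  where "integers = {x. \<exists>P. lead_coeff P = 1 \<and> poly (map_poly emb P) x = 0}"

lemma integer_ring_eq: "integer_ring \<phi> = ring_of_type_algebra\<lparr>carrier := integers\<rparr>"
  by (simp add: integer_ring_def integers_def emb_def)

definition poly_span :: "'k set \<Rightarrow> 'k set"
  where "poly_span W = {(\<Sum>w\<in>W. emb (a w) * w) |a. True}"

lemma poly_span_add: "x \<in> poly_span W \<Longrightarrow> y \<in> poly_span W \<Longrightarrow> x + y \<in> poly_span W"
proof -
  assume "x \<in> poly_span W" "y \<in> poly_span W"
  then obtain a b where "x = (\<Sum>w\<in>W. emb (a w) * w)" "y = (\<Sum>w\<in>W. emb (b w) * w)"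
    by (auto simp: poly_span_def)
  then have "x + y = (\<Sum>w\<in>W. emb (a w + b w) * w)"
    by (simp add: emb.hom_add distrib_right sum.distrib)
  then show ?thesis unfolding poly_span_def by (intro CollectI exI[of _ "\<lambda>w. a w + b w"]) simp
qed

lemma poly_span_scale: "x \<in> poly_span W \<Longrightarrow> emb c * x \<in> poly_span W"
proof -
  assume "x \<in> poly_span W"
  then obtain a where "x = (\<Sum>w\<in>W. emb (a w) * w)" by (auto simp: poly_span_def)
  then have "emb c * x = (\<Sum>w\<in>W. emb (c * a w) * w)"
    by (simp add: emb.hom_mult sum_distrib_left mult.assoc)
  then show ?thesis unfolding poly_span_def by (intro CollectI exI[of _ "\<lambda>w. c * a w"]) simp
qed

lemma poly_span_0: "0 \<in> poly_span W"
  unfolding poly_span_def by (intro CollectI exI[of _ "\<lambda>_. 0"]) simp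

lemma poly_span_sum: "(\<And>i. i \<in> A \<Longrightarrow> f i \<in> poly_span W) \<Longrightarrow> sum f A \<in> poly_span W"
  by (induction A rule: infinite_finite_induct) (auto intro: poly_span_add poly_span_0)

lemma poly_span_base: "finite W \<Longrightarrow> w \<in> W \<Longrightarrow> w \<in> poly_span W"
proof -
  assume W: "finite W" "w \<in> W"
  have "(\<Sum>v\<in>W. emb (if v = w then 1 else 0) * v) = (\<Sum>v\<in>W. if v = w then v else 0)"
    by (intro sum.cong) auto
  also have "\<dots> = w" using W by simp
  finally have "(\<Sum>v\<in>W. emb (if v = w then 1 else 0) * v) = w" .
  then show ?thesis unfolding poly_span_def by (intro CollectI exI[of _ "\<lambda>v. if v = w then 1 else 0"]) simp
qed

lemma poly_span_stable:
  assumes "\<And>w. w \<in> W \<Longrightarrow> z * w \<in> poly_span W" "v \<in> poly_span W"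
  shows "z * v \<in> poly_span W"
proof -
  obtain a where v: "v = (\<Sum>w\<in>W. emb (a w) * w)" using assms by (auto simp: poly_span_def)
  have "z * v = (\<Sum>w\<in>W. emb (a w) * (z * w))" by (simp add: v sum_distrib_left mult_ac)
  then show ?thesis by (auto intro: poly_span_sum poly_span_scale assms)
qed

text \<open>The determinant trick: \<open>z\<close> is an eigenvalue of a matrix over the polynomial ring.\<close>

lemma integral_if_stable:
  assumes W: "finite W" "1 \<in> W" and z: "\<And>w. w \<in> W \<Longrightarrow> z * w \<in> poly_span W"
  shows "z \<in> integers"
proof -
  obtain e where e: "bij_betw e {..<card W} W"
    using ex_bij_betw_nat_finite[OF W(1)] by (auto simp: lessThan_atLeast0)
  define r where "r = card W"
  have "\<forall>w\<in>W. \<exists>a. z * w = (\<Sum>v\<in>W. emb (a v) * v)" using z by (auto simp: poly_span_def)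
  then obtain a where a: "\<And>w. w \<in> W \<Longrightarrow> z * w = (\<Sum>v\<in>W. emb (a w v) * v)" by metis
  define M where "M = mat r r (\<lambda>(i, j). a (e i) (e j))"
  have M: "M \<in> carrier_mat r r" by (simp add: M_def)
  have Mh: "map_mat emb M \<in> carrier_mat r r" by (simp add: M_def)
  \<comment> \<open>The eigenvector lists the generators themselves; it is non-zero because 1 is one
    of them.\<close>
  define v where "v = vec r e"
  have "v \<noteq> 0\<^sub>v r"
  proof
    assume *: "v = 0\<^sub>v r"
    have "1 \<in> e ` {..<r}" using e W(2) by (simp add: bij_betw_def r_def)
    then obtain i where i: "i < r" "e i = 1" by (metis imageE lessThan_iff)
    then have "v $ i = 1" by (simp add: v_def)
    then show False using * i by simp
  qed
  moreover have "map_mat emb M *\<^sub>v v = z \<cdot>\<^sub>v v"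
  proof (rule eq_vecI)
    fix i assume "i < dim_vec (z \<cdot>\<^sub>v v)"
    then have i: "i < r" by (simp add: v_def)
    then have "e i \<in> W" using e by (auto simp: bij_betw_def r_def)
    have "(map_mat emb M *\<^sub>v v) $ i = (\<Sum>j<r. emb (a (e i) (e j)) * e j)"
      using i by (simp add: v_def M_def scalar_prod_def lessThan_atLeast0)
    also have "\<dots> = (\<Sum>v\<in>W. emb (a (e i) v) * v)"
      using sum.reindex_bij_betw[OF e, of "\<lambda>v. emb (a (e i) v) * v"] by (simp add: r_def)
    also have "\<dots> = z * e i" using a[OF \<open>e i \<in> W\<close>] by simp
    finally show "(map_mat emb M *\<^sub>v v) $ i = (z \<cdot>\<^sub>v v) $ i" using i by (simp add: v_def)
  qed (simp add: v_def M_def)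
  ultimately have "eigenvalue (map_mat emb M) z"
    unfolding eigenvalue_def eigenvector_def by (intro exI[of _ v]) (simp add: v_def M_def)
  then have "poly (map_poly emb (char_poly M)) z = 0"
    using eigenvalue_root_char_poly[OF Mh] emb.char_poly_hom[OF M] by simp
  moreover have "lead_coeff (char_poly M) = 1" using degree_monic_char_poly[OF M] by simp
  ultimately show ?thesis by (auto simp: integers_def)
qed

lemma integers_relation:
  assumes "x \<in> integers"
  obtains n c where "n > 0" "x ^ n = (\<Sum>i<n. emb (c i) * x ^ i)"
proof -
  obtain P where P: "lead_coeff P = 1" "poly (map_poly emb P) x = 0" using assms by (auto simp: integers_def)
  define n where "n = degree P"
  have "n > 0"
  proof (rule ccontr)
    assume "\<not> n > 0"
    then have "P = 1" using P by (metis n_def degree_0_id gr0I lead_coeff_1 monic_degree_0)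
    then show False using P by simp
  qed
  have "0 = (\<Sum>i\<le>n. emb (coeff P i) * x ^ i)"
    using P(2) by (simp add: poly_altdef n_def)
  also have "\<dots> = x ^ n + (\<Sum>i<n. emb (coeff P i) * x ^ i)"
    using P(1) by (simp add: lessThan_Suc_atMost[symmetric] n_def)
  finally have "x ^ n = - (\<Sum>i<n. emb (coeff P i) * x ^ i)" by (simp add: eq_neg_iff_add_eq_0)
  also have "\<dots> = (\<Sum>i<n. emb (- coeff P i) * x ^ i)" by (simp add: sum_negf emb.hom_uminus)
  finally show ?thesis by (rule that[OF \<open>n > 0\<close>])
qed

text \<open>The monomials \<open>x^s * y^t\<close> below the degrees of the two monic equations span
  a module stable under both elements: an exponent that overflows is rewritten by its equation. One
  module serves for the sum and for the product.\<close>

lemma integers_stable_span: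
  assumes "x \<in> integers" "y \<in> integers"
  shows "\<exists>W. finite W \<and> 1 \<in> W \<and> (\<forall>w\<in>poly_span W. x * w \<in> poly_span W \<and> y * w \<in> poly_span W)"
proof -
  obtain n c where n: "n > 0" "x ^ n = (\<Sum>i<n. emb (c i) * x ^ i)" using integers_relation assms(1) by blast
  obtain m d where m: "m > 0" "y ^ m = (\<Sum>i<m. emb (d i) * y ^ i)" using integers_relation assms(2) by blast
  define W where "W = (\<lambda>(s, t). x ^ s * y ^ t) ` ({..<n} \<times> {..<m})"
  have W: "finite W" by (simp add: W_def)
  have mem: "x ^ s * y ^ t \<in> poly_span W" if "s < n" "t < m" for s t
    using that by (intro poly_span_base[OF W]) (auto simp: W_def)
  have "x * w \<in> poly_span W" if w: "w \<in> W" for w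
  proof -
    obtain s t where st: "s < n" "t < m" "w = x ^ s * y ^ t" using w by (auto simp: W_def)
    show ?thesis
    proof (cases "Suc s < n")
      case True
      then show ?thesis using mem[of "Suc s" t] st by (simp add: mult.assoc)
    next
      case False
      then have "Suc s = n" using st by simp
      then have "x * w = x ^ n * y ^ t" using st by (simp add: mult.assoc flip: power_Suc)
      also have "\<dots> = (\<Sum>i<n. emb (c i) * (x ^ i * y ^ t))"
        unfolding n(2) by (simp add: sum_distrib_right mult.assoc)
      also have "\<dots> \<in> poly_span W" using mem st by (intro poly_span_sum poly_span_scale) auto
      finally show ?thesis .
    qed
  qed
  moreover have "y * w \<in> poly_span W" if w: "w \<in> W" for w
  proof -
    obtain s t where st: "s < n" "t < m" "w = x ^ s * y ^ t" using w by (auto simp: W_def)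
    show ?thesis
    proof (cases "Suc t < m")
      case True
      then show ?thesis using mem[of s "Suc t"] st by (simp add: mult_ac)
    next
      case False
      then have "Suc t = m" using st by simp
      then have "y * w = x ^ s * y ^ m" using st by (simp add: mult_ac flip: power_Suc)
      also have "\<dots> = (\<Sum>i<m. emb (d i) * (x ^ s * y ^ i))"
        unfolding m(2) by (simp add: sum_distrib_left mult_ac)
      also have "\<dots> \<in> poly_span W" using mem st by (intro poly_span_sum poly_span_scale) auto
      finally show ?thesis .
    qed
  qed
  moreover have "1 \<in> W" unfolding W_def using n(1) m(1) by (intro image_eqI[of _ _ "(0, 0)"]) auto
  ultimately show ?thesis using W poly_span_stable by (intro exI[of _ W]) auto
qed

lemma emb_integers: "emb a \<in> integers"
  unfolding integers_def by (intro CollectI exI[of _ "[:- a, 1:]"]) (simp add: emb.hom_uminus)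

lemma subring_integers: "subring_of_field integers"
proof
  show "0 \<in> integers" "1 \<in> integers" using emb_integers[of 0] emb_integers[of 1] by auto
  fix x y assume xy: "x \<in> integers" "y \<in> integers"
  obtain W where W: "finite W" "1 \<in> W"
    "\<forall>w\<in>poly_span W. x * w \<in> poly_span W \<and> y * w \<in> poly_span W"
    using integers_stable_span[OF xy] by (elim exE conjE)
  show "x + y \<in> integers"
    using W poly_span_base by (intro integral_if_stable[OF W(1,2)]) (simp add: distrib_right poly_span_add)
  show "x * y \<in> integers"
    using W poly_span_base by (intro integral_if_stable[OF W(1,2)]) (simp add: mult.assoc)
next
  fix x assume x: "x \<in> integers"
  obtain W where W: "finite W" "1 \<in> W"
    "\<forall>w\<in>poly_span W. x * w \<in> poly_span W \<and> x * w \<in> poly_span W"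
    using integers_stable_span[OF x x] by (elim exE conjE)
  show "- x \<in> integers"
  proof (rule integral_if_stable[OF W(1,2)])
    fix w assume "w \<in> W"
    then have "emb (- 1) * (x * w) \<in> poly_span W" using W poly_span_base by (intro poly_span_scale) auto
    then show "- x * w \<in> poly_span W" by (simp add: emb.hom_uminus)
  qed
qed

sublocale subring_of_field integers by (rule subring_integers)

sublocale emb_poly: map_poly_inj_idom_hom emb ..

text \<open>Substituting \<open>X^j - X^i\<close> into the monic equation of the difference gives an
  equation for \<open>x\<close>; it is monic because \<open>X^j - X^i\<close> is monic of positive
  degree \<open>j\<close>.\<close>

lemma integers_power_diff:
  assumes "x ^ j - x ^ i \<in> integers" "i < j"
  shows "x \<in> integers"
proof -
  obtain P where P: "lead_coeff P = 1" "poly (map_poly emb P) (x ^ j - x ^ i) = 0"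
    using assms by (auto simp: integers_def)
  define Q :: "'q poly poly" where "Q = monom 1 j - monom 1 i"
  have deg: "degree Q = j" "coeff Q j = 1"
  proof -
    show "coeff Q j = 1" using assms(2) by (simp add: Q_def)
    then have "j \<le> degree Q" by (intro le_degree) simp
    moreover have "degree Q \<le> j"
      unfolding Q_def using assms(2) by (intro degree_diff_le) (auto simp: degree_monom_eq)
    ultimately show "degree Q = j" by simp
  qed
  have "lead_coeff (pcompose P Q) = 1"
    using lead_coeff_comp[of Q P] deg P(1) assms(2) by (simp del: degree_pcompose)
  moreover have "poly (map_poly emb (pcompose P Q)) x = 0"
  proof -
    have "poly (map_poly emb Q) x = x ^ j - x ^ i"
      by (simp add: Q_def emb_poly.hom_minus map_poly_monom poly_monom)
    then show ?thesis using P(2) by (simp add: emb.map_poly_pcompose poly_pcompose)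
  qed
  ultimately show ?thesis unfolding integers_def by (intro CollectI exI[of _ "pcompose P Q"] conjI)
qed

section \<open>Coordinates over the polynomial ring and finiteness of quotients\<close>

lemma coordinates:
  obtains n :: nat and u :: "nat \<Rightarrow> 'k" where "\<And>x. \<exists>c. x = (\<Sum>i<n. \<phi> (c i) * u i)"
proof -
  interpret K: ring "ring_of_type_algebra :: 'k ring" by (rule ring_from_type_algebra)
  obtain n where "K.dimension n (range \<phi>) UNIV" using fin_dim by (auto simp: K.finite_dimension_def)
  then obtain us where us: "length us = n"
    "UNIV \<subseteq> {K.combine cs us |cs. set cs \<subseteq> range \<phi> \<and> length cs = n}"
    using K.dimension_imp_coordinates by meson
  have comb: "K.combine cs us = (\<Sum>i<length us. cs ! i * us ! i)" if "length cs = length us" for cs us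
    using that by (induction cs us rule: list_induct2) (auto simp: sum.lessThan_Suc_shift simp del: sum.lessThan_Suc)
  have "\<exists>c. x = (\<Sum>i<n. \<phi> (c i) * us ! i)" for x
  proof -
    obtain cs where cs: "x = K.combine cs us" "set cs \<subseteq> range \<phi>" "length cs = n" using us by blast
    have "\<forall>i<n. \<exists>c. cs ! i = \<phi> c" using cs by (auto simp: subset_iff in_set_conv_nth)
    then obtain c where "\<And>i. i < n \<Longrightarrow> cs ! i = \<phi> (c i)" by metis
    then show ?thesis using cs us comb[of cs us] by (intro exI[of _ c]) simp
  qed
  then show ?thesis using that by blast
qed

lemma emb_common_denominator:
  fixes n :: nat
  shows "\<exists>b g. b \<noteq> 0 \<and> (\<forall>i<n. \<phi> (c i) * emb b = emb (g i))"
proof -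
  have "\<exists>p q. q \<noteq> 0 \<and> c i = Fract p q" for i by (cases "c i") auto
  then obtain p q where pq: "\<And>i. q i \<noteq> 0" "\<And>i. c i = Fract (p i) (q i)" by metis
  define b where "b = (\<Prod>i<n. q i)"
  have "\<phi> (c i) * emb b = emb (p i * (\<Prod>j\<in>{..<n} - {i}. q j))" if "i < n" for i
  proof -
    have "b = q i * (\<Prod>j\<in>{..<n} - {i}. q j)" unfolding b_def using that by (intro prod.remove) auto
    then show ?thesis using \<phi>_Fract[OF pq(1), of "p i" i] pq(2)
      by (simp add: emb.hom_mult mult.assoc[symmetric])
  qed
  then show ?thesis using pq(1) by (intro exI[of _ b] exI[of _ "\<lambda>i. p i * (\<Prod>j\<in>{..<n} - {i}. q j)"]) (auto simp: b_def)
qed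

text \<open>The order of quantifiers matters: \<open>n\<close> and \<open>u\<close> are fixed before
  \<open>Y\<close>, so that a bound in terms of \<open>n\<close> is uniform in \<open>Y\<close>.
  Only the common denominator and the coordinates depend on \<open>Y\<close>.\<close>

lemma coordinates_integral:
  "\<exists>n u. \<forall>Y. finite Y \<longrightarrow> (\<exists>b g. b \<noteq> 0 \<and> (\<forall>y\<in>Y. emb b * y = (\<Sum>i<(n::nat). emb (g y i) * u i)))"
proof -
  obtain n and u :: "nat \<Rightarrow> 'k" where nu: "\<And>x. \<exists>c. x = (\<Sum>i<n. \<phi> (c i) * u i)" using coordinates by blast
  have "\<exists>b g. b \<noteq> 0 \<and> emb b * y = (\<Sum>i<n. emb (g i) * u i)" for y
  proof -
    obtain c where c: "y = (\<Sum>i<n. \<phi> (c i) * u i)" using nu by blast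
    obtain b g where b: "b \<noteq> 0" "\<forall>i<n. \<phi> (c i) * emb b = emb (g i)" using emb_common_denominator by blast
    have "emb b * y = (\<Sum>i<n. (\<phi> (c i) * emb b) * u i)" by (simp add: c sum_distrib_left mult_ac)
    also have "\<dots> = (\<Sum>i<n. emb (g i) * u i)" using b by (intro sum.cong) auto
    finally show ?thesis using b by blast
  qed
  then obtain b g where b: "\<And>y. b y \<noteq> 0" "\<And>y. emb (b y) * y = (\<Sum>i<n. emb (g y i) * u i)" by metis
  have "\<exists>b g. b \<noteq> 0 \<and> (\<forall>y\<in>Y. emb b * y = (\<Sum>i<n. emb (g y i) * u i))" if Y: "finite Y" for Y
  proof (intro exI[of _ "\<Prod>y\<in>Y. b y"] exI[of _ "\<lambda>y i. (\<Prod>z\<in>Y - {y}. b z) * g y i"] conjI ballI)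
    show "(\<Prod>y\<in>Y. b y) \<noteq> 0" using b Y by simp
    fix y assume y: "y \<in> Y"
    have "(\<Prod>y\<in>Y. b y) = (\<Prod>z\<in>Y - {y}. b z) * b y" using Y y by (simp add: prod.remove mult.commute)
    then have "emb (\<Prod>y\<in>Y. b y) * y = emb (\<Prod>z\<in>Y - {y}. b z) * (emb (b y) * y)"
      by (simp add: emb.hom_mult mult.assoc)
    also have "\<dots> = (\<Sum>i<n. emb ((\<Prod>z\<in>Y - {y}. b z) * g y i) * u i)"
      unfolding b(2) by (simp add: emb.hom_mult sum_distrib_left mult.assoc)
    finally show "emb (\<Prod>y\<in>Y. b y) * y = (\<Sum>i<n. emb ((\<Prod>z\<in>Y - {y}. b z) * g y i) * u i)" .
  qed
  then show ?thesis by (intro exI[of _ n] exI[of _ u] allI impI)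
qed

text \<open>Modulo \<open>\<alpha>\<close> only the digits of index 0 survive, and digits are
  pairwise incongruent; after removing them, \<open>\<alpha>\<close> cancels and the remaining sums
  are shorter.\<close>

lemma digit_expansion_unique:
  assumes Y: "Y \<subseteq> integers" "\<forall>y\<in>Y. \<forall>z\<in>Y. y - z \<in> (*) \<alpha> ` integers \<longrightarrow> y = z"
    and \<alpha>: "\<alpha> \<in> integers" "\<alpha> \<noteq> 0"
    and "\<And>j. j < k \<Longrightarrow> f j \<in> Y" "\<And>j. j < k \<Longrightarrow> g j \<in> Y"
    and "(\<Sum>j<k. \<alpha> ^ j * f j) = (\<Sum>j<k. \<alpha> ^ j * g j)" "j < k"
  shows "f j = g j"
  using assms(5-)
proof (induction k arbitrary: f g j)
  case (Suc k)
  define F where "F = (\<Sum>j<k. \<alpha> ^ j * f (Suc j))"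
  define G where "G = (\<Sum>j<k. \<alpha> ^ j * g (Suc j))"
  have "(\<Sum>j<Suc k. \<alpha> ^ j * f j) = f 0 + \<alpha> * F" "(\<Sum>j<Suc k. \<alpha> ^ j * g j) = g 0 + \<alpha> * G"
    unfolding F_def G_def by (simp_all add: sum.lessThan_Suc_shift sum_distrib_left mult.assoc del: sum.lessThan_Suc)
  then have *: "f 0 + \<alpha> * F = g 0 + \<alpha> * G" using Suc.prems(3) by simp
  have s: "sum h A \<in> integers" if "\<And>i. i \<in> A \<Longrightarrow> h i \<in> integers" for h :: "nat \<Rightarrow> 'k" and A
    using that by (induction A rule: infinite_finite_induct) (auto intro: add_closed zero_closed)
  have "F \<in> integers" "G \<in> integers" unfolding F_def G_def
    using Suc.prems Y(1) \<alpha> by (auto intro!: s mult_closed power_closed)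
  moreover have "f 0 - g 0 = \<alpha> * (G - F)" using * by (simp add: algebra_simps)
  ultimately have "f 0 - g 0 \<in> (*) \<alpha> ` integers" by (auto intro: diff_closed)
  then have 0: "f 0 = g 0" using Y(2) Suc.prems(1,2) by blast
  then have "F = G" using * \<alpha> by simp
  then have "f (Suc i) = g (Suc i)" if "i < k" for i
    using Suc.IH[of "\<lambda>j. f (Suc j)" "\<lambda>j. g (Suc j)" i] Suc.prems(1,2) that by (simp add: F_def G_def)
  then show ?case using 0 Suc.prems(4) by (cases j) auto
qed simp

text \<open>Sums \<open>\<Sum>j<k. a\<^sup>j y\<^sub>j\<close> with digits in \<open>Y\<close> are distinct and have coordinates of degree at most
  \<open>k deg a + O(1)\<close>; comparing cardinalities as \<open>k\<close> grows bounds the number of digits.\<close>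

lemma card_incongruent:
  assumes "a \<noteq> 0"
  shows "\<exists>N. \<forall>Y\<subseteq>integers. finite Y \<longrightarrow>
      (\<forall>y\<in>Y. \<forall>z\<in>Y. y - z \<in> (*) (emb a) ` integers \<longrightarrow> y = z) \<longrightarrow> card Y \<le> N"
proof -
  obtain n and u :: "nat \<Rightarrow> 'k" where nu:
    "\<forall>Y. finite Y \<longrightarrow> (\<exists>b g. b \<noteq> 0 \<and> (\<forall>y\<in>Y. emb b * y = (\<Sum>i<n. emb (g y i) * u i)))"
    using coordinates_integral by (elim exE)
  \<comment> \<open>Each further digit multiplies the number of sums by \<open>card Y\<close>, while
    the degree bound of each of the \<open>n\<close> coordinates grows by
    \<open>degree a\<close>.\<close>
  have "card Y \<le> (CARD('q) ^ degree a) ^ n"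
    if Y: "Y \<subseteq> integers" "finite Y" "\<forall>y\<in>Y. \<forall>z\<in>Y. y - z \<in> (*) (emb a) ` integers \<longrightarrow> y = z" for Y
  proof -
    obtain b g where b: "b \<noteq> 0" "\<forall>y\<in>Y. emb b * y = (\<Sum>i<n. emb (g y i) * u i)" using nu Y(2) by blast
    \<comment> \<open>The inserted 0 gives the maximum a meaning when \<open>Y\<close> is empty or
      \<open>n = 0\<close>.\<close>
    define D where "D = Max (insert 0 ((\<lambda>(y, i). degree (g y i)) ` (Y \<times> {..<n})))"
    have D: "degree (g y i) \<le> D" if "y \<in> Y" "i < n" for y i
      unfolding D_def using that Y(2) by (intro Max_ge) auto
    define Pl where "Pl k = {p :: 'q poly. degree p \<le> D + k * degree a}" for k
    have "card Y ^ k \<le> (CARD('q) ^ Suc D) ^ n * ((CARD('q) ^ degree a) ^ n) ^ k" for k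
    proof -
      define F where "F f = (\<Sum>j<k. emb a ^ j * f j)" for f :: "nat \<Rightarrow> 'k"
      define G where "G h = (\<Sum>i<n. emb (h i) * u i) / emb b" for h
      have fin: "finite (PiE {..<n} (\<lambda>_. Pl k))"
        unfolding Pl_def by (intro finite_PiE card_polys_degree_le) auto
      have inj: "inj_on F (PiE {..<k} (\<lambda>_. Y))"
      proof (rule inj_onI)
        fix f g assume fg: "f \<in> PiE {..<k} (\<lambda>_. Y)" "g \<in> PiE {..<k} (\<lambda>_. Y)" "F f = F g"
        have "f j = g j" if "j < k" for j
          using fg that by (intro digit_expansion_unique[OF Y(1,3) emb_integers, of k f g j])
            (auto simp: F_def assms)
        then show "f = g" using fg by (intro PiE_ext[of f "{..<k}" "\<lambda>_. Y" g]) auto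
      qed
      have sub: "F ` PiE {..<k} (\<lambda>_. Y) \<subseteq> G ` PiE {..<n} (\<lambda>_. Pl k)"
      proof
        fix x assume "x \<in> F ` PiE {..<k} (\<lambda>_. Y)"
        then obtain f where f: "f \<in> PiE {..<k} (\<lambda>_. Y)" "x = F f" by blast
        have fY: "f j \<in> Y" if "j < k" for j using f that by auto
        define h where "h i = (\<Sum>j<k. a ^ j * g (f j) i)" for i
        have "emb b * F f = (\<Sum>j<k. emb a ^ j * (emb b * f j))"
          by (simp add: F_def sum_distrib_left mult_ac)
        also have "\<dots> = (\<Sum>j<k. \<Sum>i<n. emb (a ^ j * g (f j) i) * u i)"
          using b fY by (intro sum.cong) (auto simp: sum_distrib_left emb.hom_mult emb.hom_power mult.assoc)
        also have "\<dots> = (\<Sum>i<n. emb (h i) * u i)"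
          by (subst sum.swap) (simp add: h_def emb.hom_sum sum_distrib_right)
        finally have "x = G h" using b(1) f(2) by (simp add: G_def field_simps)
        also have "\<dots> = G (restrict h {..<n})" by (simp add: G_def)
        finally have x: "x = G (restrict h {..<n})" .
        have "degree (h i) \<le> D + k * degree a" if i: "i < n" for i
          unfolding h_def
        proof (rule degree_sum_le)
          fix j assume j: "j \<in> {..<k}"
          have "degree (a ^ j * g (f j) i) \<le> degree (a ^ j) + degree (g (f j) i)" by (rule degree_mult_le)
          also have "degree (a ^ j) \<le> j * degree a" using degree_power_le[of a j] by (simp add: mult.commute)
          also have "\<dots> \<le> k * degree a" using j by auto
          also have "degree (g (f j) i) \<le> D" using D fY j i by auto
          finally show "degree (a ^ j * g (f j) i) \<le> D + k * degree a" by simp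
        qed simp
        then show "x \<in> G ` PiE {..<n} (\<lambda>_. Pl k)"
          unfolding x by (intro imageI) (simp add: restrict_PiE_iff Pl_def del: restrict_apply)
      qed
      have "card Y ^ k = card (PiE {..<k} (\<lambda>_. Y))" by (simp add: card_PiE)
      also have "\<dots> = card (F ` PiE {..<k} (\<lambda>_. Y))" using inj by (simp add: card_image)
      also have "\<dots> \<le> card (G ` PiE {..<n} (\<lambda>_. Pl k))" using sub fin by (intro card_mono) auto
      also have "\<dots> \<le> card (PiE {..<n} (\<lambda>_. Pl k))" using fin by (rule card_image_le)
      also have "\<dots> = card (Pl k) ^ n" by (simp add: card_PiE)
      also have "\<dots> \<le> (CARD('q) ^ Suc (D + k * degree a)) ^ n"
        unfolding Pl_def by (intro power_mono card_polys_degree_le) simp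
      also have "\<dots> = (CARD('q) ^ Suc D) ^ n * ((CARD('q) ^ degree a) ^ n) ^ k"
        by (simp add: power_add power_mult_distrib mult_ac flip: power_mult)
      finally show ?thesis .
    qed
    then show ?thesis by (rule le_of_power_le) auto
  qed
  then show ?thesis by blast
qed

text \<open>In an equation for \<open>x\<close> the lowest non-zero coefficient is a multiple of
  \<open>x\<close>; zero coefficients below it are stripped by cancelling \<open>x\<close>.\<close>

lemma integer_divides_poly:
  assumes "x \<in> integers" "x \<noteq> 0"
  shows "\<exists>a r. a \<noteq> 0 \<and> r \<in> integers \<and> emb a = x * r"
proof -
  obtain P where P: "lead_coeff P = 1" "poly (map_poly emb P) x = 0" using assms by (auto simp: integers_def)
  have "\<exists>a r. a \<noteq> 0 \<and> r \<in> integers \<and> emb a = x * r" if "P \<noteq> 0" "poly (map_poly emb P) x = 0" for P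
    using that
  proof (induction P)
    case (pCons a P)
    have p: "emb a + x * poly (map_poly emb P) x = 0" using pCons.prems(2) by (simp add: emb.map_poly_pCons_hom)
    show ?case
    proof (cases "a = 0")
      case True
      then show ?thesis using pCons p assms(2) by auto
    next
      case False
      have "poly (map_poly emb P) x \<in> integers"
        using assms(1) by (induction P) (auto simp: emb.map_poly_pCons_hom intro: zero_closed add_closed mult_closed emb_integers)
      then show ?thesis using False p
        by (intro exI[of _ a] exI[of _ "- poly (map_poly emb P) x"])
          (auto intro: uminus_closed simp: eq_neg_iff_add_eq_0)
    qed
  qed simp
  moreover have "P \<noteq> 0" using P(1) by auto
  ultimately show ?thesis using P(2) by blast
qed

sublocale finite_quotient_domain integers
proof
  show "x \<in> integers" if "x ^ j - x ^ i \<in> integers" "i < j" for x i j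
    using integers_power_diff that by blast
  fix c assume c: "c \<in> integers" "c \<noteq> 0"
  obtain a r where a: "a \<noteq> 0" "r \<in> integers" "emb a = c * r" using integer_divides_poly c by blast
  \<comment> \<open>Elements incongruent modulo \<open>c\<close> are incongruent modulo its multiple
    \<open>emb a\<close>, where the bound is known.\<close>
  have "(*) (emb a) ` integers \<subseteq> (*) c ` integers" using a by (auto simp: mult.assoc intro: mult_closed)
  then show "\<exists>N. \<forall>Y\<subseteq>integers. finite Y \<longrightarrow>
      (\<forall>y\<in>Y. \<forall>z\<in>Y. y - z \<in> (*) c ` integers \<longrightarrow> y = z) \<longrightarrow> card Y \<le> N"
    using card_incongruent[OF a(1)] by (meson subsetD)
qed

end

section \<open>Primes and norms\<close>

text \<open>An element of least degree generates, by division with remainder. The statement is about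
  a bare set so that it covers both the primes of the polynomial ring and the contractions of primes
  of \<open>K\<close>.\<close>

lemma prime_ideal_poly_generator:
  fixes I :: "'a::field poly set"
  assumes add: "\<And>x y. x \<in> I \<Longrightarrow> y \<in> I \<Longrightarrow> x + y \<in> I"
    and mult: "\<And>x y. y \<in> I \<Longrightarrow> x * y \<in> I"
    and proper: "1 \<notin> I" and prime: "\<And>x y. x * y \<in> I \<Longrightarrow> x \<in> I \<or> y \<in> I"
    and nz: "g \<in> I" "g \<noteq> 0"
  shows "\<exists>f. lead_coeff f = 1 \<and> Factorial_Ring.irreducible f \<and> I = {g. f dvd g}"
proof -
  obtain f0 where f0: "f0 \<in> I" "f0 \<noteq> 0" and min: "\<And>h. h \<in> I \<Longrightarrow> h \<noteq> 0 \<Longrightarrow> degree f0 \<le> degree h"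
    using ex_has_least_nat[of "\<lambda>h. h \<in> I \<and> h \<noteq> 0" g degree] nz by auto
  define f where "f = Polynomial.smult (inverse (lead_coeff f0)) f0"
  have lc: "lead_coeff f = 1" using f0 by (simp add: f_def)
  have f: "f \<in> I" "f \<noteq> 0" using mult[OF f0(1), of "[:inverse (lead_coeff f0):]"] f0 by (auto simp: f_def)
  have deg: "degree f = degree f0" using f0 by (simp add: f_def)
  have I: "I = {g. f dvd g}"
  proof (intro Set.set_eqI iffI)
    fix h assume h: "h \<in> I"
    have "h mod f = h + (- (h div f)) * f" by (simp add: minus_mult_div_eq_mod[symmetric] mult.commute)
    then have "h mod f \<in> I" using add[OF h mult[OF f(1)]] by metis
    then have "h mod f = 0" using min[of "h mod f"] degree_mod_less[OF f(2), of h] deg by (metis leD)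
    then show "h \<in> {g. f dvd g}" by (simp add: mod_eq_0_iff_dvd)
  next
    fix h assume "h \<in> {g. f dvd g}"
    then obtain k where "h = f * k" by (auto simp: dvd_def)
    then show "h \<in> I" using mult[OF f(1), of k] by (simp add: mult.commute)
  qed
  have "Factorial_Ring.irreducible f"
  proof (rule Factorial_Ring.irreducibleI)
    show "f \<noteq> 0" by (rule f)
    show "\<not> f dvd 1" using proper I by blast
    fix a b assume ab: "f = a * b"
    have *: "x dvd 1" if fy: "f dvd y" and fyx: "f = y * x" for x y
    proof -
      obtain k where "y = f * k" using fy by (elim dvdE)
      then have "y * 1 = y * (x * k)" using fyx by (simp add: mult.assoc)
      moreover have "y \<noteq> 0" using fyx f by auto
      ultimately have "x * k = 1" using mult_left_cancel by metis
      then show ?thesis by (metis dvd_triv_left)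
    qed
    have "a \<in> I \<or> b \<in> I" using prime[of a b] f ab by simp
    then show "a dvd 1 \<or> b dvd 1" using *[of a b] *[of b a] ab I by (auto simp: mult.commute)
  qed
  then show ?thesis using lc I by blast
qed

lemma monic_dvd_set_eq:
  assumes "lead_coeff f = 1" "lead_coeff (g :: 'a::field poly) = 1" "{h. f dvd h} = {h. g dvd h}"
  shows "f = g"
proof (rule poly_dvd_antisym)
  have "f dvd h \<longleftrightarrow> g dvd h" for h using assms(3) by (simp add: set_eq_iff)
  then show "f dvd g" "g dvd f" using dvd_refl by blast+
qed (use assms in simp)

text \<open>A least-degree combination \<open>d\<close> of \<open>f\<close> and \<open>a\<close>
  divides both. By irreducibility it is a unit, and a Bezout identity gives \<open>f dvd b\<close>,
  or an associate of \<open>f\<close>, and then \<open>f dvd a\<close>.\<close>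

lemma irreducible_prime_dvd:
  fixes f :: "'a::field poly"
  assumes f: "Factorial_Ring.irreducible f" and "f dvd a * b"
  shows "f dvd a \<or> f dvd b"
proof (rule ccontr)
  assume n: "\<not> ?thesis"
  define I where "I = {u * f + v * a |u v. True}"
  have fI: "f \<in> I" unfolding I_def by (intro CollectI exI[of _ 1] exI[of _ 0]) simp
  have aI: "a \<in> I" unfolding I_def by (intro CollectI exI[of _ 0] exI[of _ 1]) simp
  have f0: "f \<noteq> 0" using f by auto
  obtain d where d: "d \<in> I" "d \<noteq> 0" and min: "\<And>h. h \<in> I \<Longrightarrow> h \<noteq> 0 \<Longrightarrow> degree d \<le> degree h"
    using ex_has_least_nat[of "\<lambda>h. h \<in> I \<and> h \<noteq> 0" f degree] fI f0 by auto
  obtain u v where uv: "d = u * f + v * a" using d by (auto simp: I_def)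
  have dvd: "d dvd h" if h: "h \<in> I" for h
  proof -
    obtain u' v' where "h = u' * f + v' * a" using h by (auto simp: I_def)
    then have "h mod d = (u' - h div d * u) * f + (v' - h div d * v) * a"
      by (simp add: minus_mult_div_eq_mod[symmetric] uv algebra_simps)
    then have "h mod d \<in> I" unfolding I_def by blast
    then have "h mod d = 0" using min[of "h mod d"] degree_mod_less[OF d(2), of h] by (meson leD)
    then show ?thesis by (simp add: mod_eq_0_iff_dvd)
  qed
  obtain k where k: "f = d * k" using dvd[OF fI] by (elim dvdE)
  then have "d dvd 1 \<or> k dvd 1" using f Factorial_Ring.irreducibleD by blast
  then show False
  proof
    assume "d dvd 1"
    then obtain e where e: "1 = d * e" by (elim dvdE)
    have "b = b * (d * e)" by (simp flip: e)
    also have "\<dots> = (b * u * e) * f + (v * e) * (a * b)" by (simp add: uv algebra_simps)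
    also have "f dvd \<dots>" using assms(2) by (intro dvd_add dvd_mult[OF dvd_refl] dvd_mult[OF assms(2)])
    finally show False using n by simp
  next
    assume "k dvd 1"
    then have "f dvd d" using k by (metis dvd_mult_unit_iff dvd_refl)
    then show False using dvd[OF aI] n dvd_trans by blast
  qed
qed

text \<open>This turns the quantifier over prime ideals in \<open>arithmetically_equivalent\<close>
  into one over monic irreducible polynomials.\<close>

lemma nonzero_primes_poly:
  "nonzero_primes (ring_of_type_algebra :: 'a::field poly ring) =
    {{g. f dvd g} |f. lead_coeff f = 1 \<and> Factorial_Ring.irreducible f}"
proof (intro Set.set_eqI iffI)
  have cr: "cring (ring_of_type_algebra :: 'a poly ring)" by (rule cring_from_type_algebra)
  then interpret cring "ring_of_type_algebra :: 'a poly ring" .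
  {
    fix \<pp> :: "'a poly set" assume "\<pp> \<in> nonzero_primes ring_of_type_algebra"
    then have p: "primeideal \<pp> ring_of_type_algebra" "\<pp> \<noteq> {0}" by (auto simp: nonzero_primes_def)
    interpret P: primeideal \<pp> "ring_of_type_algebra :: 'a poly ring" by (rule p)
    obtain g where g: "g \<in> \<pp>" "g \<noteq> 0"
      using p(2) additive_subgroup.zero_closed[OF P.additive_subgroup_axioms] by auto
    have "1 \<notin> \<pp>" using P.one_imp_carrier P.I_notcarr by auto
    then have "\<exists>f. lead_coeff f = 1 \<and> Factorial_Ring.irreducible f \<and> \<pp> = {g. f dvd g}"
      using P.I_prime P.I_l_closed additive_subgroup.a_closed[OF P.additive_subgroup_axioms] g
      by (intro prime_ideal_poly_generator[where g = g]) auto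
    then show "\<pp> \<in> {{g. f dvd g} |f. lead_coeff f = 1 \<and> Factorial_Ring.irreducible f}" by blast
  }
  fix \<pp> :: "'a poly set" assume "\<pp> \<in> {{g. f dvd g} |f. lead_coeff f = 1 \<and> Factorial_Ring.irreducible f}"
  then obtain f where f: "Factorial_Ring.irreducible f" "\<pp> = {g. f dvd g}" by auto
  have "primeideal \<pp> ring_of_type_algebra"
    unfolding primeideal_def primeideal_axioms_def
  proof (intro conjI allI impI)
    show "ideal \<pp> ring_of_type_algebra"
    proof (intro idealI)
      show "subgroup \<pp> (add_monoid ring_of_type_algebra)"
      proof
        fix x assume x: "x \<in> \<pp>"
        have "\<ominus>\<^bsub>ring_of_type_algebra\<^esub> x = - x" by (rule minus_equality) auto
        then show "inv\<^bsub>add_monoid ring_of_type_algebra\<^esub> x \<in> \<pp>" using x f by (simp add: a_inv_def)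
      qed (use f in auto)
    qed (use f ring_axioms in auto)
    show "carrier ring_of_type_algebra \<noteq> \<pp>" using f by auto
  next
    fix a b assume "a \<otimes>\<^bsub>ring_of_type_algebra\<^esub> b \<in> \<pp>"
    then show "a \<in> \<pp> \<or> b \<in> \<pp>" using irreducible_prime_dvd[OF f(1), of a b] f(2) by simp
  qed (rule cr)
  moreover have "f \<in> \<pp>" "f \<noteq> 0" using f by auto
  then have "\<pp> \<noteq> {0}" by blast
  ultimately show "\<pp> \<in> nonzero_primes ring_of_type_algebra" by (simp add: nonzero_primes_def)
qed

section \<open>Primes of the integral closure, the polynomials below them, and ideal norms\<close>

context function_field
begin

abbreviation primes :: "'k set set" where "primes \<equiv> nonzero_primes Rg"

lemma contraction_eq: "contraction \<phi> P = {g. emb g \<in> P}"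
  by (simp add: contraction_def emb_def)

lemma ideal_contains_poly:
  assumes "ideal I Rg" "I \<noteq> {0}"
  shows "\<exists>a. a \<noteq> 0 \<and> emb a \<in> I"
proof -
  obtain c where c: "c \<in> I" "c \<noteq> 0" using ideal_nonzero assms by blast
  obtain a r where "a \<noteq> 0" "r \<in> integers" "emb a = c * r"
    using integer_divides_poly[OF ideal_closed(5)[OF assms(1) c(1)] c(2)] by (elim exE conjE)
  then show ?thesis using ideal_closed(8)[OF assms(1) c(1)] by auto
qed

lemma contraction_generator:
  assumes "P \<in> primes"
  shows "\<exists>f. lead_coeff f = 1 \<and> Factorial_Ring.irreducible f \<and> contraction \<phi> P = {g. f dvd g}"
proof -
  note P = assms[unfolded nonzero_primes_iff primeideal_iff]
  note Pi = nonzero_primes_ideal[OF assms]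
  have "P \<noteq> {0}" using assms by (simp add: nonzero_primes_iff)
  then obtain a where "a \<noteq> 0" "emb a \<in> P" using ideal_contains_poly[OF Pi] by metis
  moreover have "emb x \<in> P \<or> emb y \<in> P" if "emb x * emb y \<in> P" for x y
    using that P emb_integers by blast
  moreover have "1 \<notin> P" using ideal_eq_R_iff[OF Pi] P by simp
  ultimately show ?thesis
    using ideal_closed(3,4)[OF Pi] emb_integers unfolding contraction_eq
    by (intro prime_ideal_poly_generator[where g = a]) (simp_all add: emb.hom_add emb.hom_mult)
qed

text \<open>A name for the definite description inside \<open>prime_norm\<close>.\<close>

definition below :: "'k set \<Rightarrow> 'q poly"
  where "below P = (THE f. lead_coeff f = 1 \<and> Factorial_Ring.irreducible f \<and> contraction \<phi> P = {g. f dvd g})"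

lemma below:
  assumes "P \<in> primes"
  shows "lead_coeff (below P) = 1" "Factorial_Ring.irreducible (below P)"
    "contraction \<phi> P = {g. below P dvd g}"
proof -
  have "\<exists>!f. lead_coeff f = 1 \<and> Factorial_Ring.irreducible f \<and> contraction \<phi> P = {g. f dvd g}"
  proof (rule ex_ex1I[OF contraction_generator[OF assms]])
    fix f g assume f: "lead_coeff f = 1 \<and> Factorial_Ring.irreducible f \<and> contraction \<phi> P = {h. f dvd h}"
      and g: "lead_coeff g = 1 \<and> Factorial_Ring.irreducible g \<and> contraction \<phi> P = {h. g dvd h}"
    have "{h. f dvd h} = {h. g dvd h}" using f g by (elim conjE) (rule trans[OF sym])
    then show "f = g" using f g by (intro monic_dvd_set_eq) blast+
  qed
  from theI'[OF this] show "lead_coeff (below P) = 1" "Factorial_Ring.irreducible (below P)"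
    "contraction \<phi> P = {g. below P dvd g}" unfolding below_def by auto
qed

lemma contraction_eq_iff:
  assumes "P \<in> primes" "lead_coeff f = 1"
  shows "contraction \<phi> P = {g. f dvd g} \<longleftrightarrow> below P = f"
  using below[OF assms(1)] monic_dvd_set_eq[of "below P" f] assms(2) by auto

text \<open>All these primes contain the non-zero element \<open>emb f\<close>. Finiteness matters
  for \<open>splitting_type\<close>, since \<open>mset_set\<close> sends an infinite set to the
  empty multiset.\<close>

lemma finite_primes_below: "finite {P \<in> primes. below P = f}"
proof (cases "\<exists>P\<in>primes. below P = f")
  case True
  then have "f \<noteq> 0" using below(2) by fastforce
  have "{P \<in> primes. below P = f} \<subseteq> {J. ideal J Rg \<and> emb f \<in> J}"
  proof
    fix P assume "P \<in> {P \<in> primes. below P = f}"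
    then have P: "P \<in> primes" "below P = f" by auto
    then have "f \<in> contraction \<phi> P" using below(3) by simp
    then show "P \<in> {J. ideal J Rg \<and> emb f \<in> J}" using P by (simp add: contraction_eq nonzero_primes_ideal)
  qed
  moreover have "finite {J. ideal J Rg \<and> emb f \<in> J}"
    using \<open>f \<noteq> 0\<close> by (intro finite_ideals_containing emb_integers) simp
  ultimately show ?thesis by (rule finite_subset)
next
  case False
  then have e: "{P \<in> primes. below P = f} = {}" by blast
  show ?thesis unfolding e by simp
qed

lemma splitting_type_eq:
  assumes "lead_coeff f = 1"
  shows "splitting_type \<phi> {g. f dvd g} =
    sorted_list_of_multiset (image_mset (inertia_degree \<phi>) (mset_set {P \<in> primes. below P = f}))"
proof -
  have "{P \<in> primes. contraction \<phi> P = {g. f dvd g}} = {P \<in> primes. below P = f}"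
    using contraction_eq_iff[OF _ assms] by (intro Collect_cong conj_cong refl)
  then show ?thesis by (simp add: splitting_type_def integer_ring_eq)
qed

lemma prime_norm_eq: "prime_norm \<phi> P = below P ^ inertia_degree \<phi> P"
  by (simp add: prime_norm_def below_def)

text \<open>The residue field \<open>Q\<close> is finite, so the image \<open>F\<close> of the
  polynomial ring is a subfield and \<open>Q\<close> has finite dimension over it; dimension 0 would
  give \<open>1 = 0\<close>. Positivity makes prime norms non-constant, which bounds the number of
  primes in a factorisation of given norm.\<close>

lemma inertia_degree_pos:
  assumes "P \<in> primes"
  shows "inertia_degree \<phi> P > 0"
proof -
  note P = assms[unfolded nonzero_primes_iff]
  note Pi = nonzero_primes_ideal[OF assms]
  have "maximalideal P Rg"
    unfolding maximalideal_def maximalideal_axioms_def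
  proof (intro conjI allI impI Pi)
    show "carrier Rg \<noteq> P" using P by (auto simp: primeideal_iff)
    fix J assume "ideal J Rg" "P \<subseteq> J" "J \<subseteq> carrier Rg"
    then show "J = P \<or> J = carrier Rg" using primeideal_maximal[of P J] P by auto
  qed
  then interpret M: maximalideal P Rg .
  define Q where "Q = Rg Quot P"
  interpret Q: field Q unfolding Q_def by (rule M.quotient_is_field[OF cring_Rg])
  define q where "q x = P +>\<^bsub>Rg\<^esub> x" for x
  have hom: "q \<in> Ring.ring_hom Rg Q" unfolding q_def[abs_def] Q_def by (rule M.rcos_ring_hom)
  have carrier: "carrier Q = q ` integers"
    by (auto simp: Q_def FactRing_def A_RCOSETS_def' q_def)
  obtain c where c: "c \<in> P" "c \<noteq> 0" using ideal_nonzero[OF Pi] P by blast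
  have cos: "q x = (\<lambda>p. p + x) ` P" for x
    by (auto simp: q_def a_r_coset_def r_coset_def)
  have "finite (carrier Q)"
    unfolding carrier
  proof (rule finite_image_quotient[of c])
    fix x y assume xy: "x \<in> integers" "y \<in> integers" "y - x \<in> (*) c ` integers"
    then have d: "y - x \<in> P" using ideal_closed(8)[OF Pi c(1)] by auto
    show "q x = q y"
    proof (intro Set.set_eqI iffI)
      fix z assume "z \<in> q x"
      then have "z - x \<in> P" by (auto simp: cos)
      from ideal_closed(7)[OF Pi this d] show "z \<in> q y" by (auto simp: cos intro!: image_eqI[of _ _ "z - y"])
    next
      fix z assume "z \<in> q y"
      then have "z - y \<in> P" by (auto simp: cos)
      from ideal_closed(3)[OF Pi this d] show "z \<in> q x" by (auto simp: cos intro!: image_eqI[of _ _ "z - x"])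
    qed
  qed (use c ideal_closed(5)[OF Pi] in auto)
  define F where "F = range (\<lambda>g. q (emb g))"
  have FQ: "F \<subseteq> carrier Q" using emb_integers by (auto simp: F_def carrier)
  have F1: "\<one>\<^bsub>Q\<^esub> \<in> F"
    unfolding F_def using ring_hom_one[OF hom] by (intro image_eqI[of _ _ 1]) auto
  have Fadd: "x \<oplus>\<^bsub>Q\<^esub> y \<in> F" and Fmult: "x \<otimes>\<^bsub>Q\<^esub> y \<in> F" if xy: "x \<in> F" "y \<in> F" for x y
  proof -
    obtain g h where gh: "x = q (emb g)" "y = q (emb h)" using xy by (auto simp: F_def)
    show "x \<oplus>\<^bsub>Q\<^esub> y \<in> F" unfolding F_def gh
      using ring_hom_add[OF hom, of "emb g" "emb h"] emb_integers
      by (intro image_eqI[of _ _ "g + h"]) (auto simp: emb.hom_add)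
    show "x \<otimes>\<^bsub>Q\<^esub> y \<in> F" unfolding F_def gh
      using ring_hom_mult[OF hom, of "emb g" "emb h"] emb_integers
      by (intro image_eqI[of _ _ "g * h"]) (auto simp: emb.hom_mult)
  qed
  have q0: "q 0 = \<zero>\<^bsub>Q\<^esub>"
    using ring_hom_add[OF hom, of 0 0] zero_closed Q.add.l_cancel_one'[of "q 0" "q 0"] carrier by auto
  have Fneg: "\<ominus>\<^bsub>Q\<^esub> x \<in> F" if x: "x \<in> F" for x
  proof -
    obtain g where g: "x = q (emb g)" using x by (auto simp: F_def)
    have "q (emb (- g)) \<oplus>\<^bsub>Q\<^esub> x = \<zero>\<^bsub>Q\<^esub>"
      using ring_hom_add[OF hom, of "emb (- g)" "emb g"] emb_integers[of g] emb_integers[of "- g"] q0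
      by (simp add: g emb.hom_uminus)
    then have "\<ominus>\<^bsub>Q\<^esub> x = q (emb (- g))"
      using FQ x carrier emb_integers by (intro Q.minus_equality) auto
    then show ?thesis by (auto simp: F_def)
  qed
  have sub: "subfield F Q"
  proof (rule Q.subfieldI')
    show "subring F Q"
      using FQ F1 Fadd Fmult Fneg by (intro Q.subringI) auto
    fix k assume k: "k \<in> F - {\<zero>\<^bsub>Q\<^esub>}"
    have finF: "finite F" by (rule finite_subset[OF FQ \<open>finite (carrier Q)\<close>])
    have kQ: "k \<in> carrier Q" using subsetD[OF FQ] k by simp
    \<comment> \<open>An injective self-map of the finite set \<open>F\<close> is surjective, so
      some product with \<open>k\<close> equals 1.\<close>
    have "inj_on (\<lambda>t. k \<otimes>\<^bsub>Q\<^esub> t) F"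
    proof (rule inj_onI)
      fix s t assume "s \<in> F" "t \<in> F" and eq: "k \<otimes>\<^bsub>Q\<^esub> s = k \<otimes>\<^bsub>Q\<^esub> t"
      then have "s \<in> carrier Q" "t \<in> carrier Q" using FQ by auto
      moreover have "k \<noteq> \<zero>\<^bsub>Q\<^esub>" using k by blast
      ultimately show "s = t" using Q.m_lcancel[OF _ kQ] eq by metis
    qed
    then have "(\<lambda>t. k \<otimes>\<^bsub>Q\<^esub> t) ` F = F"
      using k Fmult finF by (intro endo_inj_surj) auto
    then obtain t where t: "t \<in> F" "k \<otimes>\<^bsub>Q\<^esub> t = \<one>\<^bsub>Q\<^esub>" using F1 by (metis imageE)
    then have "inv\<^bsub>Q\<^esub> k = t"
      using kQ FQ by (intro Q.comm_inv_char) auto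
    then show "inv\<^bsub>Q\<^esub> k \<in> F" using t by simp
  qed
  obtain us where us: "set us = carrier Q" using \<open>finite (carrier Q)\<close> finite_list by blast
  have "Q.Span F us = carrier Q"
  proof (rule subset_antisym)
    show "Q.Span F us \<subseteq> carrier Q" by (rule Q.Span_in_carrier[OF FQ]) (simp only: us order_refl)
    have "set us \<subseteq> Q.Span F us" by (rule Q.Span_base_incl[OF sub]) (simp only: us order_refl)
    then show "carrier Q \<subseteq> Q.Span F us" by (simp only: us)
  qed
  then have "Q.finite_dimension F (carrier Q)"
    using Q.Span_finite_dimension[OF sub, of us] us by auto
  then have dim: "Q.dimension (Q.dim F (carrier Q)) F (carrier Q)"
    using Q.finite_dimensionE[OF sub] by (simp add: over_def)
  have "Q.dim F (carrier Q) \<noteq> 0"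
  proof
    assume "Q.dim F (carrier Q) = 0"
    then have "carrier Q = {\<zero>\<^bsub>Q\<^esub>}" using Q.dimension_zero[OF sub] dim by simp
    then show False using Q.one_closed Q.one_not_zero by blast
  qed
  then show ?thesis
    by (simp add: inertia_degree_def integer_ring_eq Let_def F_def Q_def q_def emb_def)
qed

text \<open>The enumeration is arbitrary; by commutativity the product of primes does not depend on
  it.\<close>

definition prodm :: "'k set multiset \<Rightarrow> 'k set"
  where "prodm M = prodl (SOME Ps. mset Ps = M)"

lemma prodm_mset: "set Ps \<subseteq> primes \<Longrightarrow> prodm (mset Ps) = prodl Ps"
  unfolding prodm_def
proof (rule prodl_cong_mset)
  show *: "mset (SOME Qs. mset Qs = mset Ps) = mset Ps" by (rule someI) simp
  assume "set Ps \<subseteq> primes"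
  then show "ideal P Rg" if "P \<in> set (SOME Qs. mset Qs = mset Ps)" for P
    using that nonzero_primes_ideal by (metis * mset_eq_setD subsetD)
qed

lemma prodl_nonzero: "set Ps \<subseteq> primes \<Longrightarrow> prodl Ps \<noteq> {0}"
proof -
  have "\<exists>x\<in>prodl Ps. x \<noteq> 0" if "set Ps \<subseteq> primes"
    using that
  proof (induction Ps)
    case Nil
    show ?case using one_closed by (intro bexI[of _ 1]) auto
  next
    case (Cons P Ps)
    then obtain x where x: "x \<in> prodl Ps" "x \<noteq> 0" by auto
    obtain y where "y \<in> P" "y \<noteq> 0"
      using Cons.prems ideal_nonzero[of P] by (auto simp: nonzero_primes_iff primeideal_iff)
    then show ?case using ideal_prod_memI[of y P x "prodl Ps"] x by (intro bexI[of _ "y * x"]) auto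
  qed
  then show "set Ps \<subseteq> primes \<Longrightarrow> prodl Ps \<noteq> {0}" by blast
qed

lemma bij_betw_prodm:
  "bij_betw prodm {M. set_mset M \<subseteq> primes} {I. ideal I (integer_ring \<phi>) \<and> I \<noteq> {0}}"
  unfolding bij_betw_def
proof
  show "inj_on prodm {M. set_mset M \<subseteq> primes}"
  proof (rule inj_onI)
    fix M N assume MN: "M \<in> {M. set_mset M \<subseteq> primes}" "N \<in> {M. set_mset M \<subseteq> primes}" "prodm M = prodm N"
    obtain Ps Qs where "M = mset Ps" "N = mset Qs" by (metis ex_mset)
    then show "M = N" using MN prime_factorization_unique[of Ps Qs] by (auto simp: prodm_mset)
  qed
  show "prodm ` {M. set_mset M \<subseteq> primes} = {I. ideal I (integer_ring \<phi>) \<and> I \<noteq> {0}}"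
  proof (intro Set.set_eqI iffI)
    fix I assume "I \<in> prodm ` {M. set_mset M \<subseteq> primes}"
    then obtain M where M: "set_mset M \<subseteq> primes" "I = prodm M" by blast
    obtain Ps where Ps: "M = mset Ps" by (metis ex_mset)
    have "ideal (prodl Ps) Rg" using M Ps by (intro ideal_prodl nonzero_primes_ideal) auto
    then show "I \<in> {I. ideal I (integer_ring \<phi>) \<and> I \<noteq> {0}}"
      using M Ps prodl_nonzero[of Ps] by (simp add: prodm_mset integer_ring_eq)
  next
    fix I assume "I \<in> {I. ideal I (integer_ring \<phi>) \<and> I \<noteq> {0}}"
    then obtain Ps where "set Ps \<subseteq> primes" "I = prodl Ps"
      using prime_factorization_exists by (auto simp: integer_ring_eq)
    then show "I \<in> prodm ` {M. set_mset M \<subseteq> primes}"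
      by (intro image_eqI[of _ _ "mset Ps"]) (auto simp: prodm_mset)
  qed
qed

lemma ideal_norm_prodm:
  assumes "set_mset M \<subseteq> primes"
  shows "ideal_norm \<phi> (prodm M) = \<Prod>\<^sub># (image_mset (prime_norm \<phi>) M)"
proof -
  obtain Ps where Ps: "M = mset Ps" by (metis ex_mset)
  have "ideal_norm \<phi> (prodl Ps) = prod_list (map (prime_norm \<phi>) Ps)"
    unfolding ideal_norm_def Let_def integer_ring_eq
  proof (rule the_equality)
    show "\<exists>Qs. set Qs \<subseteq> primes \<and> prodl Ps = foldr (ideal_prod Rg) Qs (carrier Rg) \<and>
        prod_list (map (prime_norm \<phi>) Ps) = prod_list (map (prime_norm \<phi>) Qs)"
      using assms Ps by (intro exI[of _ Ps]) auto
    fix N assume "\<exists>Qs. set Qs \<subseteq> primes \<and> prodl Ps = foldr (ideal_prod Rg) Qs (carrier Rg) \<and>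
        N = prod_list (map (prime_norm \<phi>) Qs)"
    then obtain Qs where Qs: "set Qs \<subseteq> primes" "prodl Ps = prodl Qs" "N = prod_list (map (prime_norm \<phi>) Qs)"
      by auto
    then have "mset Ps = mset Qs" using assms Ps by (intro prime_factorization_unique) auto
    then have "mset (map (prime_norm \<phi>) Ps) = mset (map (prime_norm \<phi>) Qs)" by simp
    then show "N = prod_list (map (prime_norm \<phi>) Ps)" unfolding Qs(3) by (metis prod_mset_prod_list)
  qed
  then show ?thesis using assms Ps by (simp add: prodm_mset flip: prod_mset_prod_list)
qed

text \<open>Reindexing an infinite sum along a bijection is unconditional, so no convergence enters
  here.\<close>

lemma lifted_goss_zeta_eq:
  "lifted_goss_zeta \<iota> \<phi> s = (\<Sum>\<^sub>\<infinity>M\<in>{M. set_mset M \<subseteq> primes}.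
    teichmueller (inverse (goss_power \<iota> (\<Prod>\<^sub># (image_mset (prime_norm \<phi>) M)) s)))"
proof -
  have "lifted_goss_zeta \<iota> \<phi> s = (\<Sum>\<^sub>\<infinity>M\<in>{M. set_mset M \<subseteq> primes}.
      teichmueller (inverse (goss_power \<iota> (ideal_norm \<phi> (prodm M)) s)))"
    unfolding lifted_goss_zeta_def by (rule infsum_reindex_bij_betw[OF bij_betw_prodm, symmetric])
  also have "\<dots> = (\<Sum>\<^sub>\<infinity>M\<in>{M. set_mset M \<subseteq> primes}.
      teichmueller (inverse (goss_power \<iota> (\<Prod>\<^sub># (image_mset (prime_norm \<phi>) M)) s)))"
    by (rule infsum_cong) (simp add: ideal_norm_prodm)
  finally show ?thesis .
qed

end

section \<open>Arithmetic and convergence of Witt vectors\<close>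

text \<open>A congruence modulo \<open>p\<close> between earlier components becomes one modulo
  \<open>p^(n+1)\<close> after raising to the power \<open>p^(n-i)\<close> and multiplying by
  \<open>p^i\<close>. What remains of the ghost difference is \<open>p^n * (S n - S' n)\<close>, and
  \<open>p^n\<close> cancels in integer polynomials.\<close>

lemma ghost_polys_cong:
  fixes S S' :: "nat \<Rightarrow> 'v zpoly"
  assumes p: "p > 0" and S: "\<And>n. of_nat p ^ Suc n dvd ghost p n S - ghost p n S'"
  shows "of_nat p dvd S n - S' n"
proof (induction n rule: less_induct)
  case (less n)
  have tm: "of_nat p ^ Suc n dvd of_nat p ^ i * S i ^ (p ^ (n - i)) - of_nat p ^ i * S' i ^ (p ^ (n - i))"
    if i: "i < n" for i
  proof -
    have "of_nat p ^ i * of_nat p ^ Suc (n - i) dvd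
        of_nat p ^ i * (S i ^ (p ^ (n - i)) - S' i ^ (p ^ (n - i)))"
      using prime_power_cong[OF less[OF i], of "n - i"] by (intro mult_dvd_mono) auto
    moreover have "(of_nat p :: 'v zpoly) ^ i * of_nat p ^ Suc (n - i) = of_nat p ^ Suc n"
      using i by (simp add: power_add[symmetric] flip: power_Suc)
    ultimately show ?thesis by (simp add: right_diff_distrib)
  qed
  have "of_nat p ^ n * (S n - S' n) = (ghost p n S - ghost p n S') -
      (\<Sum>i<n. of_nat p ^ i * S i ^ (p ^ (n - i)) - of_nat p ^ i * S' i ^ (p ^ (n - i)))"
    unfolding ghost_split sum_subtractf by (simp add: algebra_simps)
  moreover have "of_nat p ^ Suc n dvd \<dots>"
    by (rule dvd_diff[OF S dvd_sum]) (simp only: tm lessThan_iff)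
  ultimately obtain r where "of_nat p ^ n * (S n - S' n) = of_nat p ^ Suc n * r"
    by (metis dvdE)
  then have "of_nat (p ^ n) * (S n - S' n) = of_nat (p ^ n) * (of_nat p * r)"
    by (simp add: mult_ac)
  then have "S n - S' n = of_nat p * r" by (rule zpoly_of_nat_cancel) (use p in simp)
  then show ?case by simp
qed

lemma zeval_cong_CHAR:
  assumes "of_nat CHAR('a) dvd P - Q"
  shows "zeval x P = zeval (x :: 'v \<Rightarrow> 'a::comm_ring_1) Q"
proof -
  obtain r where "P - Q = of_nat CHAR('a) * r" using assms by (elim dvdE)
  then have "zeval x (P - Q) = zeval x (of_nat CHAR('a) * r)" by simp
  then show ?thesis by simp
qed

lemma witt_coord_of_nat_mult:
  "witt_coord (of_nat k * w) = ((witt_add CHAR('a) (witt_coord w)) ^^ k) (witt_const 0)"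
  for w :: "'a::comm_ring_prime_char witt"
proof (induction k)
  case (Suc k)
  have "of_nat (Suc k) * w = w + of_nat k * w" by (simp add: distrib_right)
  then show ?case using Suc by (simp add: plus_witt.rep_eq)
qed (simp add: zero_witt.rep_eq)

text \<open>In characteristic \<open>p\<close>, multiplication by \<open>p\<close> is Verschiebung composed with Frobenius.\<close>

lemma witt_coord_CHAR_mult:
  "witt_coord (of_nat CHAR('a) * w) n = (case n of 0 \<Rightarrow> 0 | Suc m \<Rightarrow> witt_coord w m ^ CHAR('a))"
  for w :: "'a::comm_ring_prime_char witt"
proof -
  define p where "p = CHAR('a)"
  have p: "Factorial_Ring.prime p" unfolding p_def by (rule CHAR_prime)
  have p0: "p > 0" using prime_gt_0_nat[OF p] .
  define x where "x = witt_coord w"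
  define T :: "nat \<Rightarrow> nat \<Rightarrow> nat zpoly" where "T k = ((witt_add p zvar) ^^ k) (witt_const 0)" for k
  define V :: "nat \<Rightarrow> nat zpoly" where "V n = (case n of 0 \<Rightarrow> 0 | Suc m \<Rightarrow> zvar m ^ p)" for n
  have gT: "ghost p n (T k) = of_nat k * ghost p n zvar" for n k
  proof (induction k)
    case (Suc k)
    then show ?case by (simp add: T_def ghost_witt_add[OF p] distrib_right)
  qed (simp add: T_def ghost_witt_const[OF p] zero_power p0)
  have gV: "ghost p n V = (\<Sum>i<n. of_nat p ^ Suc i * zvar i ^ (p ^ (n - i)))" for n
  proof (cases n)
    case (Suc m)
    have "ghost p n V = (\<Sum>i<Suc (Suc m). of_nat p ^ i * V i ^ (p ^ (n - i)))"
      unfolding ghost_def lessThan_Suc_atMost Suc ..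
    also have "\<dots> = (\<Sum>i<Suc m. of_nat p ^ Suc i * V (Suc i) ^ (p ^ (n - Suc i)))"
      using p0 by (subst sum.lessThan_Suc_shift) (simp add: V_def zero_power)
    also have "\<dots> = (\<Sum>i<n. of_nat p ^ Suc i * zvar i ^ (p ^ (n - i)))"
      unfolding Suc
    proof (intro sum.cong refl)
      fix i assume "i \<in> {..<Suc m}"
      then have "p ^ (Suc m - i) = p * p ^ (Suc m - Suc i)" by (simp add: Suc_diff_le flip: power_Suc)
      then show "of_nat p ^ Suc i * V (Suc i) ^ (p ^ (Suc m - Suc i)) =
          of_nat p ^ Suc i * zvar i ^ (p ^ (Suc m - i))"
        by (simp add: V_def power_mult)
    qed
    finally show ?thesis .
  qed (simp add: ghost_def V_def)
  \<comment> \<open>\<open>T p\<close> is the universal \<open>p\<close>-fold sum and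
    \<open>V\<close> its claimed value; the ghosts of \<open>V\<close> lack just the last term of
    \<open>p\<close> times the ghost of the variables.\<close>
  have "ghost p n (T p) - ghost p n V = of_nat p ^ Suc n * zvar n" for n
    unfolding gT gV by (simp add: ghost_split distrib_left sum_distrib_left mult.assoc)
  then have "of_nat p dvd T p n - V n"
    by (intro ghost_polys_cong[OF p0]) simp
  then have "zeval x (T p n) = zeval x (V n)" unfolding p_def by (rule zeval_cong_CHAR)
  moreover have "(\<lambda>n. zeval x (T k n)) = ((witt_add p x) ^^ k) (witt_const 0)" for k
  proof (induction k)
    case 0
    show ?case by (simp add: T_def witt_const_def fun_eq_iff)
  next
    case (Suc k)
    have "(\<lambda>n. zeval x (T (Suc k) n)) = witt_add p x (\<lambda>n. zeval x (T k n))"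
      by (simp add: T_def witt_natural[OF p])
    then show ?case using Suc by simp
  qed
  ultimately have "((witt_add p x) ^^ p) (witt_const 0) n = zeval x (V n)" by metis
  then show ?thesis
    unfolding witt_coord_of_nat_mult x_def p_def V_def by (auto split: nat.splits)
qed

text \<open>Each factor \<open>p\<close> shifts by one place and applies Frobenius, so component
  \<open>k\<close> depends only on component 0 of \<open>w\<close>.\<close>

lemma witt_coord_CHAR_power_mult:
  "witt_coord (of_nat CHAR('a) ^ k * w) k = witt_coord w 0 ^ (CHAR('a) ^ k)"
  for w :: "'a::comm_ring_prime_char witt"
proof (induction k)
  case (Suc k)
  have "witt_coord (of_nat CHAR('a) ^ Suc k * w) (Suc k) = witt_coord (of_nat CHAR('a) ^ k * w) k ^ CHAR('a)"
    using witt_coord_CHAR_mult[of "of_nat CHAR('a) ^ k * w" "Suc k"] by (simp add: mult.assoc)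
  also have "\<dots> = witt_coord w 0 ^ (CHAR('a) ^ k * CHAR('a))" by (simp only: Suc power_mult)
  finally show ?case by (simp only: power_Suc2)
qed simp

text \<open>Component 0 is the ghost component 0, which respects the ring operations.\<close>

lemma witt_coord_0_simps:
  fixes v w :: "'a::comm_ring_prime_char witt"
  shows "witt_coord 0 0 = (0::'a)" "witt_coord (v + w) 0 = witt_coord v 0 + witt_coord w 0"
    "witt_coord (- w) 0 = - witt_coord w 0" "witt_coord (v * w) 0 = witt_coord v 0 * witt_coord w 0"
    "witt_coord 1 0 = (1::'a)"
proof -
  have g: "ghost CHAR('a) 0 x = x 0" for x :: "nat \<Rightarrow> 'a" by (simp add: ghost_def)
  note P = CHAR_prime[where ?'a = 'a]
  show "witt_coord (v + w) 0 = witt_coord v 0 + witt_coord w 0"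
    unfolding plus_witt.rep_eq g[symmetric] by (rule ghost_witt_add[OF P])
  show "witt_coord (v * w) 0 = witt_coord v 0 * witt_coord w 0"
    unfolding times_witt.rep_eq g[symmetric] by (rule ghost_witt_mult[OF P])
  show "witt_coord (- w) 0 = - witt_coord w 0"
    unfolding uminus_witt.rep_eq g[symmetric] by (rule ghost_witt_neg[OF P])
qed (simp_all add: zero_witt.rep_eq one_witt.rep_eq witt_const_def)

lemma witt_coord_0_sum: "witt_coord (\<Sum>i\<in>A. f i) 0 = (\<Sum>i\<in>A. witt_coord (f i :: 'a::comm_ring_prime_char witt) 0)"
  by (induction A rule: infinite_finite_induct) (auto simp: witt_coord_0_simps)

lemma witt_coord_0_of_int: "witt_coord (of_int c :: 'a::comm_ring_prime_char witt) 0 = of_int c"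
proof -
  have n: "witt_coord (of_nat n :: 'a witt) 0 = of_nat n" for n
    by (induction n) (auto simp: witt_coord_0_simps)
  show ?thesis by (cases c) (simp_all add: n witt_coord_0_simps del: of_nat_Suc)
qed

lemma witt_coord_teichmueller_0: "witt_coord (teichmueller a) 0 = a"
  by (simp add: teichmueller.rep_eq witt_const_def)

section \<open>Non-archimedean estimates and infinite sums of Teichmueller representatives\<close>

lemma absval_nonneg: "absval (x :: 'a::nonarch_valued_field) \<ge> 0"
  using dist_absval[of x 0] by (metis diff_zero zero_le_dist)

lemma absval_0: "absval (0 :: 'a::nonarch_valued_field) = 0"
  by (simp add: absval_eq_0_iff)

lemma absval_power: "absval (x ^ n) = absval (x :: 'a::nonarch_valued_field) ^ n"
  by (induction n) (auto simp: absval_mult absval_1)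

lemma absval_inverse: "absval (inverse x) = inverse (absval (x :: 'a::nonarch_valued_field))"
proof (cases "x = 0")
  case False
  then have "absval x * absval (inverse x) = 1" by (simp flip: absval_mult add: absval_1)
  then show ?thesis by (rule inverse_unique[symmetric])
qed (simp add: absval_0)

lemma absval_diff_commute: "absval (x - y) = absval (y - x :: 'a::nonarch_valued_field)"
  using absval_minus[of "x - y"] by simp

lemma absval_diff_le_max: "absval (x - y) \<le> max (absval x) (absval (y :: 'a::nonarch_valued_field))"
  using absval_add_le_max[of x "- y"] by (simp add: absval_minus)

lemma absval_sum_le:
  assumes "\<And>i. i \<in> A \<Longrightarrow> absval (f i :: 'a::nonarch_valued_field) \<le> r" "0 \<le> r"
  shows "absval (sum f A) \<le> r"
  using assms
proof (induction A rule: infinite_finite_induct)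
  case (insert a A)
  then show ?case using absval_add_le_max[of "f a" "sum f A"] by fastforce
qed (auto simp: absval_0)

lemma absval_of_int_le_1: "absval (of_int c :: 'a::nonarch_valued_field) \<le> 1"
proof -
  have n: "absval (of_nat n :: 'a) \<le> 1" for n
  proof (induction n)
    case (Suc n)
    then show ?case using absval_add_le_max[of 1 "of_nat n :: 'a"] by (simp add: absval_1)
  qed (simp add: absval_0)
  show ?thesis by (cases c) (simp_all add: n absval_minus del: of_nat_Suc)
qed

text \<open>Integrality of both arguments is built in so that the relation is compatible with
  products.\<close>

definition close :: "real \<Rightarrow> 'a::nonarch_valued_field \<Rightarrow> 'a \<Rightarrow> bool"
  where "close r x y \<longleftrightarrow> absval x \<le> 1 \<and> absval y \<le> 1 \<and> absval (x - y) < r"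

lemma close_const: "absval x \<le> 1 \<Longrightarrow> r > 0 \<Longrightarrow> close r x x"
  by (simp add: close_def absval_0)

lemma close_add: "close r x y \<Longrightarrow> close r x' y' \<Longrightarrow> close r (x + x') (y + y')"
  using absval_add_le_max[of x x'] absval_add_le_max[of y y'] absval_add_le_max[of "x - y" "x' - y'"]
  by (auto simp: close_def algebra_simps)

lemma close_mult:
  assumes "close r x y" "close r x' y'"
  shows "close r (x * x') (y * y')"
proof -
  have "x * x' - y * y' = x * (x' - y') + y' * (x - y)" by (simp add: algebra_simps)
  moreover have "absval (x * (x' - y')) < r"
    using assms mult_right_le_one_le[of "absval (x' - y')" "absval x"] absval_nonneg[of "x' - y'"] absval_nonneg[of x]
    by (simp add: close_def absval_mult mult.commute)
  moreover have "absval (y' * (x - y)) < r"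
    using assms mult_right_le_one_le[of "absval (x - y)" "absval y'"] absval_nonneg[of "x - y"] absval_nonneg[of y']
    by (simp add: close_def absval_mult mult.commute)
  ultimately have "absval (x * x' - y * y') < r"
    using absval_add_le_max[of "x * (x' - y')" "y' * (x - y)"] by simp
  moreover have "absval (x * x') \<le> 1" "absval (y * y') \<le> 1"
    using assms absval_nonneg by (auto simp: close_def absval_mult intro: mult_le_one)
  ultimately show ?thesis by (simp add: close_def)
qed

text \<open>Polynomials with integer coefficients do not increase distances on the unit ball,
  because integers have absolute value at most 1.\<close>

lemma close_zeval:
  fixes x y :: "'v \<Rightarrow> 'a::nonarch_valued_field"
  assumes r: "r > 0" and xy: "\<And>m i. m \<in> Poly_Mapping.keys P \<Longrightarrow> i \<in> Poly_Mapping.keys m \<Longrightarrow> close r (x i) (y i)"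
  shows "close r (zeval x P) (zeval y P)"
proof -
  note c = close_const[OF _ r]
  have pow: "close r (a ^ n) (b ^ n)" if "close r a b" for a b :: 'a and n
    using that by (induction n) (auto intro: close_mult c simp: absval_1)
  have prod: "close r (prod f A) (prod g A)" if "\<And>i. i \<in> A \<Longrightarrow> close r (f i) (g i)" for f g :: "'v \<Rightarrow> 'a" and A
    using that by (induction A rule: infinite_finite_induct) (auto intro: close_mult c simp: absval_1)
  have sum: "close r (sum f A) (sum g A)" if "\<And>i. i \<in> A \<Longrightarrow> close r (f i) (g i)"
    for f g :: "('v \<Rightarrow>\<^sub>0 nat) \<Rightarrow> 'a" and A
    using that by (induction A rule: infinite_finite_induct) (auto intro: close_add c simp: absval_0)
  show ?thesis
    unfolding zeval_def using xy
    by (intro sum close_mult prod pow c absval_of_int_le_1)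
qed

lemma close_witt_add:
  fixes v w v' w' :: "nat \<Rightarrow> 'a::nonarch_valued_field"
  assumes "r > 0" "\<And>i. close r (v i) (v' i)" "\<And>i. close r (w i) (w' i)"
  shows "close r (witt_add p v w n) (witt_add p v' w' n)"
  unfolding witt_add_def by (intro close_zeval assms(1)) (auto intro: assms(2,3) split: sum.splits)

text \<open>Component \<open>n\<close> of a Witt sum is a single polynomial, hence involves finitely
  many variables. This serves componentwise limits, where only finitely many components can be made
  close at once.\<close>

lemma close_witt_add_uniform:
  "\<exists>N. \<forall>r>0. \<forall>v v' w. (\<forall>i. absval (w i :: 'a::nonarch_valued_field) \<le> 1) \<longrightarrow> (\<forall>i\<le>N. close r (v i) (v' i)) \<longrightarrow>
    close r (witt_add p v w n) (witt_add p v' w n)"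
proof -
  define P :: "(nat + nat) zpoly" where
    "P = witt_polys p (\<lambda>n. ghost p n (\<lambda>i. zvar (Inl i)) + ghost p n (\<lambda>i. zvar (Inr i))) n"
  define V where "V = {i. \<exists>m\<in>Poly_Mapping.keys P. Inl i \<in> Poly_Mapping.keys m}"
  have "V = Inl -` (\<Union>m\<in>Poly_Mapping.keys P. Poly_Mapping.keys m)" by (auto simp: V_def)
  then have V: "finite V" by (simp add: finite_vimageI)
  have "close r (witt_add p v w n) (witt_add p v' w n)"
    if "r > 0" "\<forall>i. absval (w i) \<le> 1" "\<forall>i\<le>Max (insert 0 V). close r (v i) (v' i)" for r and v v' w :: "nat \<Rightarrow> 'a"
    unfolding witt_add_def P_def[symmetric]
  proof (rule close_zeval[OF that(1)])
    fix m i assume mi: "m \<in> Poly_Mapping.keys P" "i \<in> Poly_Mapping.keys m"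
    show "close r (case i of Inl a \<Rightarrow> v a | Inr a \<Rightarrow> w a) (case i of Inl a \<Rightarrow> v' a | Inr a \<Rightarrow> w a)"
    proof (cases i)
      case (Inl a)
      then have "a \<in> V" using mi by (auto simp: V_def)
      then have "a \<le> Max (insert 0 V)" using V by simp
      then show ?thesis using that(3) Inl by simp
    next
      case (Inr a)
      then show ?thesis using that(1,2) by (simp add: close_const)
    qed
  qed
  then show ?thesis by blast
qed

lemma weak_nbhd_sum:
  fixes f :: "'x \<Rightarrow> 'a::{nonarch_valued_field, field_prime_char} witt"
  assumes "open_ideal I" "\<And>i. i \<in> A \<Longrightarrow> f i \<in> weak_nbhd I m"
  shows "sum f A \<in> weak_nbhd I m"
  using assms(2)
  by (induction A rule: infinite_finite_induct) (auto intro: weak_nbhd_subgroup[OF assms(1)])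

lemma weak_nbhd_diff:
  fixes v w :: "'a::{nonarch_valued_field, field_prime_char} witt"
  assumes "open_ideal I" "v \<in> weak_nbhd I m" "w \<in> weak_nbhd I m"
  shows "v - w \<in> weak_nbhd I m"
  using weak_nbhd_subgroup(2)[OF assms(1,2) weak_nbhd_subgroup(3)[OF assms(1,3)]] by simp

lemma teichmueller_weak_nbhd:
  assumes "open_ideal (I :: 'a::{nonarch_valued_field, field_prime_char} set)" "a \<in> I"
  shows "teichmueller a \<in> weak_nbhd I m"
  using assms open_ideal_closed(1)[OF assms(1)] by (auto simp: weak_nbhd_def teichmueller.rep_eq witt_const_def)

lemma open_weak_nbhd_translate:
  fixes z :: "'a::{nonarch_valued_field, field_prime_char} witt"
  assumes I: "open_ideal I"
  shows "open ((+) z ` weak_nbhd I m)"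
  unfolding open_witt_def
proof
  fix w assume "w \<in> (+) z ` weak_nbhd I m"
  then have "(+) w ` weak_nbhd I m \<subseteq> (+) z ` weak_nbhd I m"
    using weak_nbhd_subgroup(2)[OF I] by (auto simp: add.assoc)
  then show "\<exists>J n. open_ideal J \<and> (+) w ` weak_nbhd J n \<subseteq> (+) z ` weak_nbhd I m" using I by blast
qed

lemma open_ideal_contains_ball:
  assumes "open_ideal (I :: 'a::nonarch_valued_field set)"
  shows "\<exists>r. 0 < r \<and> r \<le> 1 \<and> {x. absval x < r} \<subseteq> I"
proof -
  have "open I" "0 \<in> I" using assms open_ideal_closed(1) by (auto simp: open_ideal_def)
  then obtain e where e: "e > 0" "\<And>y. dist y 0 < e \<Longrightarrow> y \<in> I" unfolding open_dist by blast
  then show ?thesis by (intro exI[of _ "min e 1"]) (auto simp: dist_absval)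
qed

abbreviation vball :: "real \<Rightarrow> 'a::nonarch_valued_field set"
  where "vball r \<equiv> {x. absval x < r}"

text \<open>A small difference of Witt vectors is not a difference of components. Instead
  \<open>v = (v - w) + w\<close> is compared with \<open>0 + w\<close> through the addition
  polynomials.\<close>

lemma weak_nbhd_close:
  fixes v w :: "'a::{nonarch_valued_field, field_prime_char} witt"
  assumes r: "r > 0" and int: "\<And>i. absval (witt_coord v i) \<le> 1" "\<And>i. absval (witt_coord w i) \<le> 1"
    and d: "\<And>m. v - w \<in> weak_nbhd (vball r) m"
  shows "absval (witt_coord v i - witt_coord w i) < r"
proof -
  have dint: "absval (witt_coord (v - w) i) \<le> 1" for i
    using weak_nbhd_diff[OF open_ideal_carrier, of v i w] int by (auto simp: weak_nbhd_def)
  have "close r (witt_coord (v - w) i) (witt_coord 0 i)" for i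
    using d[of i] dint by (auto simp: close_def zero_witt.rep_eq witt_const_def weak_nbhd_def absval_0)
  then have "close r (witt_add CHAR('a) (witt_coord (v - w)) (witt_coord w) i)
      (witt_add CHAR('a) (witt_coord 0) (witt_coord w) i)"
    using r int by (intro close_witt_add) (auto intro: close_const)
  then have "close r (witt_coord ((v - w) + w) i) (witt_coord (0 + w) i)" by (simp only: plus_witt.rep_eq)
  then show ?thesis by (simp add: close_def)
qed

text \<open>Components of a Cauchy sequence are Cauchy and have limits by completeness. Conversely,
  closeness of finitely many components to these limits makes a given component of the Witt
  difference small.\<close>

lemma witt_Cauchy_convergent:
  fixes S :: "nat \<Rightarrow> 'a::{nonarch_valued_field, field_prime_char, complete_space} witt"
  assumes int: "\<And>n i. absval (witt_coord (S n) i) \<le> 1"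
    and Cauchy: "\<And>r. 0 < r \<Longrightarrow> r \<le> 1 \<Longrightarrow> \<exists>N. \<forall>n\<ge>N. \<forall>n'\<ge>N. \<forall>m. S n - S n' \<in> weak_nbhd (vball r) m"
  shows "\<exists>w. \<forall>r m. 0 < r \<longrightarrow> r \<le> 1 \<longrightarrow> (\<exists>N. \<forall>n\<ge>N. w - S n \<in> weak_nbhd (vball r) m)"
proof -
  have CS: "\<exists>N. \<forall>n\<ge>N. \<forall>n'\<ge>N. absval (witt_coord (S n) i - witt_coord (S n') i) < r" if r: "r > 0" for i r
  proof -
    obtain N where N: "\<forall>n\<ge>N. \<forall>n'\<ge>N. \<forall>m. S n - S n' \<in> weak_nbhd (vball (min r 1)) m"
      using Cauchy[of "min r 1"] r by auto
    have "absval (witt_coord (S n) i - witt_coord (S n') i) < min r 1" if "n \<ge> N" "n' \<ge> N" for n n'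
      using r N that int by (intro weak_nbhd_close) auto
    then show ?thesis by force
  qed
  have "Cauchy (\<lambda>n. witt_coord (S n) i)" for i
    unfolding Cauchy_def dist_absval using CS by blast
  then have "\<exists>l. (\<lambda>n. witt_coord (S n) i) \<longlonglongrightarrow> l" for i
    by (simp add: Cauchy_convergent_iff convergent_def)
  then obtain L where L: "\<And>i. (\<lambda>n. witt_coord (S n) i) \<longlonglongrightarrow> L i" by metis
  have lim: "\<exists>N. \<forall>n\<ge>N. absval (L i - witt_coord (S n) i) < r" if "r > 0" for i r
    using L[of i] that unfolding LIMSEQ_def dist_absval by (metis absval_diff_commute)
  have Lint: "absval (L i) \<le> 1" for i
  proof -
    obtain n where "absval (L i - witt_coord (S n) i) < 1" using lim[of 1 i] by auto
    then show ?thesis using absval_add_le_max[of "L i - witt_coord (S n) i" "witt_coord (S n) i"] int[of n i] by simp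
  qed
  have "\<exists>N. \<forall>n\<ge>N. Witt L - S n \<in> weak_nbhd (vball r) m" if r: "0 < r" "r \<le> 1" for r m
  proof -
    have "\<exists>N. \<forall>n\<ge>N. absval (witt_coord (Witt L - S n) k) < r" for k
    proof -
      obtain K where K: "\<forall>r>0. \<forall>v v' w. (\<forall>i. absval (w i :: 'a) \<le> 1) \<longrightarrow> (\<forall>i\<le>K. close r (v i) (v' i)) \<longrightarrow>
          close r (witt_add CHAR('a) v w k) (witt_add CHAR('a) v' w k)"
        using close_witt_add_uniform[where ?'a = 'a, of "CHAR('a)" k] by (elim exE)
      obtain N where N: "\<And>i n. n \<ge> N i \<Longrightarrow> absval (L i - witt_coord (S n) i) < r" using lim[OF r(1)] by metis
      have "absval (witt_coord (Witt L - S n) k) < r" if n: "n \<ge> Max (N ` {..K})" for n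
      proof -
        have "close r (witt_coord (Witt L) i) (witt_coord (S n) i)" if "i \<le> K" for i
        proof -
          have "N i \<le> Max (N ` {..K})" using that by (intro Max_ge) auto
          then have "n \<ge> N i" using n by linarith
          then show ?thesis using N Lint int by (simp add: close_def Witt_inverse)
        qed
        moreover have "absval (witt_coord (- S n) i) \<le> 1" for i
          using weak_nbhd_subgroup(3)[OF open_ideal_carrier, of "S n" i] int by (auto simp: weak_nbhd_def)
        \<comment> \<open>Adding \<open>- S n\<close> on both sides turns the right-hand side into
          the zero vector.\<close>
        ultimately have "close r (witt_add CHAR('a) (witt_coord (Witt L)) (witt_coord (- S n)) k)
            (witt_add CHAR('a) (witt_coord (S n)) (witt_coord (- S n)) k)"
          using K r by blast
        then have "close r (witt_coord (Witt L + - S n) k) (witt_coord (S n + - S n) k)"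
          by (simp only: plus_witt.rep_eq)
        then show ?thesis by (simp add: close_def zero_witt.rep_eq witt_const_def)
      qed
      then show ?thesis by blast
    qed
    then obtain N where N: "\<And>k n. n \<ge> N k \<Longrightarrow> absval (witt_coord (Witt L - S n) k) < r" by metis
    have "Witt L - S n \<in> weak_nbhd (vball r) m" if n: "n \<ge> Max (N ` {..m})" for n
      unfolding weak_nbhd_def
    proof (intro CollectI allI impI)
      fix k assume "k \<le> m"
      then have "N k \<le> Max (N ` {..m})" by (intro Max_ge) auto
      then show "absval (witt_coord (Witt L - S n) k) < r" using N n by (meson order_trans)
    qed
    then show ?thesis by blast
  qed
  then show ?thesis by blast
qed

text \<open>Finite sums of terms outside \<open>F n\<close> stay in a small subgroup
  \<open>weak_nbhd\<close>. Hence the sums over \<open>F n\<close> are Cauchy, and every finite sum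
  over a set containing \<open>F n\<close> is near their limit.\<close>

lemma teichmueller_summable:
  fixes a :: "'x \<Rightarrow> 'a::{nonarch_valued_field, field_prime_char, complete_space}"
  assumes a: "\<And>x. x \<in> A \<Longrightarrow> absval (a x) \<le> 1" and fin: "\<And>r. r > 0 \<Longrightarrow> finite {x\<in>A. absval (a x) \<ge> r}"
  shows "(\<lambda>x. teichmueller (a x)) summable_on A"
proof -
  define F where "F n = {x\<in>A. absval (a x) \<ge> 1 / real (Suc n)}" for n
  have F: "finite (F n)" "F n \<subseteq> A" for n unfolding F_def using fin by auto
  define S where "S n = (\<Sum>x\<in>F n. teichmueller (a x))" for n
  have small: "(\<Sum>x\<in>B. teichmueller (a x)) - S n \<in> weak_nbhd (vball r) m"
    if B: "finite B" "F n \<subseteq> B" "B \<subseteq> A" and r: "1 / real (Suc n) \<le> r" "r \<le> 1" for B n r m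
  proof -
    have r0: "0 < r" by (rule less_le_trans[OF _ r(1)]) simp
    note I = open_ideal_ball[OF r0 r(2), where ?'a = 'a]
    have "(\<Sum>x\<in>B. teichmueller (a x)) - S n = (\<Sum>x\<in>B - F n. teichmueller (a x))"
      unfolding S_def using B by (simp add: sum_diff)
    also have "\<dots> \<in> weak_nbhd (vball r) m"
      using B r by (intro weak_nbhd_sum[OF I] teichmueller_weak_nbhd[OF I]) (auto simp: F_def)
    finally show ?thesis .
  qed
  have large: "\<exists>N. \<forall>n\<ge>N. 1 / real (Suc n) \<le> r" if r: "r > 0" for r
  proof -
    obtain N where N: "1 / real (Suc N) < r" using r by (rule nat_approx_posE)
    have "1 / real (Suc n) \<le> r" if "n \<ge> N" for n
    proof -
      have "1 / real (Suc n) \<le> 1 / real (Suc N)" using that by (intro frac_le) auto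
      then show ?thesis using N by linarith
    qed
    then show ?thesis by blast
  qed
  have mono: "F n \<subseteq> F n'" if "n \<le> n'" for n n'
  proof -
    have "1 / real (Suc n') \<le> 1 / real (Suc n)" using that by (intro frac_le) auto
    then show ?thesis by (auto simp: F_def)
  qed
  have "\<exists>w. \<forall>r m. 0 < r \<longrightarrow> r \<le> 1 \<longrightarrow> (\<exists>N. \<forall>n\<ge>N. w - S n \<in> weak_nbhd (vball r) m)"
  proof (rule witt_Cauchy_convergent)
    fix n i
    have "S n \<in> weak_nbhd {x. absval x \<le> 1} i"
      unfolding S_def using a F by (intro weak_nbhd_sum teichmueller_weak_nbhd open_ideal_carrier) auto
    then show "absval (witt_coord (S n) i) \<le> 1" by (simp add: weak_nbhd_def)
  next
    fix r :: real assume r: "0 < r" "r \<le> 1"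
    obtain N where N: "\<forall>n\<ge>N. 1 / real (Suc n) \<le> r" using large r by blast
    have *: "S n' - S n \<in> weak_nbhd (vball r) m" if "n \<ge> N" "n \<le> n'" for n n' m
      using small[of "F n'" n r m] F mono that N r by (simp add: S_def)
    have "S n - S n' \<in> weak_nbhd (vball r) m" if "n \<ge> N" "n' \<ge> N" for n n' m
    proof (cases "n' \<le> n")
      case False
      then have "- (S n' - S n) \<in> weak_nbhd (vball r) m"
        using * that by (intro weak_nbhd_subgroup(3)[OF open_ideal_ball[OF r]]) auto
      then show ?thesis by simp
    qed (use * that in auto)
    then show "\<exists>N. \<forall>n\<ge>N. \<forall>n'\<ge>N. \<forall>m. S n - S n' \<in> weak_nbhd (vball r) m" by blast
  qed
  then obtain w where w: "\<And>r m. 0 < r \<Longrightarrow> r \<le> 1 \<Longrightarrow> \<exists>N. \<forall>n\<ge>N. w - S n \<in> weak_nbhd (vball r) m" by blast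
  have "((\<lambda>x. teichmueller (a x)) has_sum w) A"
    unfolding has_sum_def
  proof (rule topological_tendstoI)
    fix U assume "open U" "w \<in> U"
    then obtain I m where I: "open_ideal I" "(+) w ` weak_nbhd I m \<subseteq> U" unfolding open_witt_def by blast
    obtain r where r: "0 < r" "r \<le> 1" "vball r \<subseteq> I" using open_ideal_contains_ball[OF I(1)] by blast
    obtain N1 where N1: "\<forall>n\<ge>N1. w - S n \<in> weak_nbhd (vball r) m" using w r by blast
    obtain N2 where N2: "\<forall>n\<ge>N2. 1 / real (Suc n) \<le> r" using large r by blast
    define n where "n = max N1 N2"
    have "(\<Sum>x\<in>B. teichmueller (a x)) \<in> U" if B: "finite B" "F n \<subseteq> B" "B \<subseteq> A" for B
    proof -
      have "((\<Sum>x\<in>B. teichmueller (a x)) - S n) - (w - S n) \<in> weak_nbhd (vball r) m"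
        using N1 N2 r B by (intro weak_nbhd_diff[OF open_ideal_ball[OF r(1,2)] small]) (auto simp: n_def)
      then have "(\<Sum>x\<in>B. teichmueller (a x)) - w \<in> weak_nbhd I m" using r(3) by (auto simp: weak_nbhd_def)
      then have "w + ((\<Sum>x\<in>B. teichmueller (a x)) - w) \<in> U" using I(2) by blast
      then show ?thesis by simp
    qed
    then show "eventually (\<lambda>B. (\<Sum>x\<in>B. teichmueller (a x)) \<in> U) (finite_subsets_at_top A)"
      unfolding eventually_finite_subsets_at_top using F[of n] by (intro exI[of _ "F n"]) simp
  qed
  then show ?thesis by (auto simp: summable_on_def)
qed

text \<open>Both sums are compared with the sum over \<open>H \<union> F\<close>, where
  \<open>H\<close> witnesses convergence up to the neighbourhood and \<open>F\<close> is the set of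
  large terms; the terms in \<open>H\<close> outside \<open>F\<close> are small.\<close>

lemma infsum_teichmueller_tail:
  fixes a :: "'x \<Rightarrow> 'a::{nonarch_valued_field, field_prime_char, complete_space}"
  assumes a: "\<And>x. x \<in> A \<Longrightarrow> absval (a x) \<le> 1" and fin: "\<And>r. r > 0 \<Longrightarrow> finite {x\<in>A. absval (a x) \<ge> r}"
    and r: "0 < r" "r \<le> 1"
  shows "(\<Sum>\<^sub>\<infinity>x\<in>A. teichmueller (a x)) - (\<Sum>x\<in>{x\<in>A. absval (a x) \<ge> r}. teichmueller (a x)) \<in> weak_nbhd (vball r) m"
proof -
  define w where "w = (\<Sum>\<^sub>\<infinity>x\<in>A. teichmueller (a x))"
  note I = open_ideal_ball[OF r, where ?'a = 'a]
  have "((\<lambda>x. teichmueller (a x)) has_sum w) A"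
    unfolding w_def by (rule has_sum_infsum[OF teichmueller_summable[OF a fin]])
  moreover have "w \<in> (+) w ` weak_nbhd (vball r) m"
    using weak_nbhd_subgroup(1)[OF I] by (intro image_eqI[of _ _ 0]) simp_all
  ultimately have "eventually (\<lambda>B. (\<Sum>x\<in>B. teichmueller (a x)) \<in> (+) w ` weak_nbhd (vball r) m) (finite_subsets_at_top A)"
    unfolding has_sum_def using topological_tendstoD open_weak_nbhd_translate[OF I] by blast
  then obtain H where H: "finite H" "H \<subseteq> A"
    "\<forall>B. finite B \<and> H \<subseteq> B \<and> B \<subseteq> A \<longrightarrow> (\<Sum>x\<in>B. teichmueller (a x)) \<in> (+) w ` weak_nbhd (vball r) m"
    unfolding eventually_finite_subsets_at_top by (elim exE conjE)
  define F where "F = {x\<in>A. absval (a x) \<ge> r}"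
  have F: "finite F" "F \<subseteq> A" using fin r by (auto simp: F_def)
  have "(\<Sum>x\<in>H \<union> F. teichmueller (a x)) \<in> (+) w ` weak_nbhd (vball r) m"
    using H(1,2) F by (intro H(3)[rule_format]) simp_all
  then obtain v where v: "v \<in> weak_nbhd (vball r) m" "(\<Sum>x\<in>H \<union> F. teichmueller (a x)) = w + v"
    by (elim imageE)
  have "(\<Sum>x\<in>H \<union> F. teichmueller (a x)) - (\<Sum>x\<in>F. teichmueller (a x)) = (\<Sum>x\<in>(H \<union> F) - F. teichmueller (a x))"
    using H F by (intro sum_diff[symmetric]) auto
  also have "\<dots> \<in> weak_nbhd (vball r) m"
    using H by (intro weak_nbhd_sum[OF I] teichmueller_weak_nbhd[OF I]) (auto simp: F_def)
  finally have "((\<Sum>x\<in>H \<union> F. teichmueller (a x)) - (\<Sum>x\<in>F. teichmueller (a x))) - v \<in> weak_nbhd (vball r) m"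
    by (rule weak_nbhd_diff[OF I _ v(1)])
  then show ?thesis using v(2) by (simp add: w_def F_def algebra_simps)
qed

section \<open>Independence of the terms of the zeta series\<close>

definition padic_of_nat :: "nat \<Rightarrow> nat \<Rightarrow> nat \<Rightarrow> nat"
  where "padic_of_nat p n k = n mod p ^ k"

lemma padic_of_nat_in: "p > 0 \<Longrightarrow> padic_of_nat p n \<in> padic_integers p"
  by (auto simp: padic_integers_def padic_of_nat_def mod_mod_cancel)

lemma padic_digit_sum: "(\<Sum>i<k. p ^ i * padic_digit p (padic_of_nat p n) i) = n mod p ^ k"
proof (induction k)
  case (Suc k)
  have "n mod p ^ Suc k = p ^ k * ((n mod p ^ Suc k) div p ^ k) + (n mod p ^ Suc k) mod p ^ k" by simp
  also have "(n mod p ^ Suc k) mod p ^ k = n mod p ^ k" by (simp add: mod_mod_cancel)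
  finally show ?case using Suc by (simp add: padic_digit_def padic_of_nat_def)
qed simp

lemma padic_digit_of_nat_0:
  assumes "p > 1" "i \<ge> n"
  shows "padic_digit p (padic_of_nat p n) i = 0"
proof -
  have "n < p ^ n" using assms(1) by (simp add: power_gt_expt)
  also have "\<dots> \<le> p ^ i" using assms by (intro power_increasing) auto
  finally have "n < p ^ i" .
  moreover have "n mod p ^ Suc i \<le> n" by simp
  ultimately show ?thesis unfolding padic_digit_def padic_of_nat_def by (intro div_less) linarith
qed

text \<open>In characteristic \<open>p\<close> each factor \<open>1 + (u - 1)^(p^i)\<close> is
  \<open>u^(p^i)\<close>, so the product collects the \<open>p\<close>-adic expansion of
  \<open>n\<close> in the exponent. The first \<open>n\<close> digits suffice since
  \<open>n < p^n\<close>.\<close>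

lemma one_unit_power_of_nat:
  "one_unit_power u (padic_of_nat CHAR('c) n) = (u :: 'c::{nonarch_valued_field, field_prime_char}) ^ n"
proof -
  define p where "p = CHAR('c)"
  have p: "Factorial_Ring.prime p" unfolding p_def by (rule CHAR_prime)
  define d where "d = padic_digit p (padic_of_nat p n)"
  have fd: "(1 + (u - 1) ^ (p ^ i)) = u ^ (p ^ i)" for i
    using freshmans_dream'[OF CHAR_prime, of "p ^ i" i 1 "u - 1"] by (simp add: p_def)
  have "(\<lambda>i. (1 + (u - 1) ^ (p ^ i)) ^ d i) has_prod (\<Prod>i<n. (1 + (u - 1) ^ (p ^ i)) ^ d i)"
    using padic_digit_of_nat_0[OF prime_gt_1_nat[OF p]] by (intro has_prod_finite) (auto simp: d_def)
  then have "one_unit_power u (padic_of_nat p n) = (\<Prod>i<n. (1 + (u - 1) ^ (p ^ i)) ^ d i)"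
    unfolding one_unit_power_def p_def[symmetric] d_def[symmetric] by (rule has_prod_unique[symmetric])
  also have "\<dots> = u ^ (\<Sum>i<n. p ^ i * d i)" by (simp add: fd power_sum flip: power_mult)
  also have "(\<Sum>i<n. p ^ i * d i) = n mod p ^ n" unfolding d_def by (rule padic_digit_sum)
  also have "\<dots> = n" using prime_gt_1_nat[OF p] by (intro mod_less) (simp add: power_gt_expt)
  finally show ?thesis by (simp add: p_def)
qed

section \<open>Sizes of the terms of the zeta series\<close>

locale goss_embedding =
  fixes \<iota> :: "'q::finite_field poly fract \<Rightarrow> 'c::{nonarch_valued_field, field_prime_char, complete_space}"
  assumes \<iota>_add: "\<iota> (x + y) = \<iota> x + \<iota> y"
    and absval_\<iota>: "absval (\<iota> x) = abs_infinity x"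
begin

lemma q_gt_1: "real CARD('q) > 1"
proof -
  have "card {0, 1 :: 'q} \<le> CARD('q)" by (intro card_mono) auto
  then show ?thesis by simp
qed

definition emb :: "'q poly \<Rightarrow> 'c" where "emb = poly_embed \<iota>"

lemma emb_diff: "emb (f - g) = emb f - emb g"
proof -
  have "emb (f - g) + emb g = emb f" by (simp add: emb_def poly_embed_def flip: \<iota>_add)
  then show ?thesis by (simp add: algebra_simps)
qed

lemma absval_emb: "f \<noteq> 0 \<Longrightarrow> absval (emb f) = real CARD('q) ^ degree f"
proof -
  assume "f \<noteq> 0"
  moreover from this have "Fract f 1 \<noteq> 0" by (simp add: Zero_fract_def eq_fract)
  ultimately show ?thesis
    by (simp add: emb_def poly_embed_def absval_\<iota> abs_infinity_def val_infinity_Fract)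
qed

lemma emb_inj: "emb f = emb g \<Longrightarrow> f = g"
proof (rule ccontr)
  assume "emb f = emb g" "f \<noteq> g"
  then have "absval (emb (f - g)) = 0" by (simp add: emb_diff absval_0)
  then show False using absval_emb[of "f - g"] \<open>f \<noteq> g\<close> by simp
qed

abbreviation "T \<equiv> emb [:0, 1:]"

lemma absval_T: "absval T = real CARD('q)" using absval_emb[of "[:0, 1:]"] by simp

lemma one_unit_part_eq: "one_unit_part \<iota> f = inverse (T ^ degree f) * emb f"
  by (simp add: one_unit_part_def emb_def)

lemma absval_one_unit_part: "f \<noteq> 0 \<Longrightarrow> absval (one_unit_part \<iota> f) = 1"
  by (simp add: one_unit_part_eq absval_mult absval_inverse absval_power absval_T absval_emb)

lemma one_unit_part_inj:
  "one_unit_part \<iota> f = one_unit_part \<iota> g \<Longrightarrow> degree f = degree g \<Longrightarrow> f = g"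
proof -
  have "T \<noteq> 0" using absval_T q_gt_1 by (auto simp: absval_0)
  then show "one_unit_part \<iota> f = one_unit_part \<iota> g \<Longrightarrow> degree f = degree g \<Longrightarrow> f = g"
    using emb_inj by (auto simp: one_unit_part_eq)
qed

definition goss_term :: "'c \<Rightarrow> nat \<Rightarrow> 'q poly \<Rightarrow> 'c"
  where "goss_term x n f = inverse x ^ degree f * inverse (one_unit_part \<iota> f) ^ n"

lemma goss_power_nat:
  "inverse (goss_power \<iota> f (x, padic_of_nat CHAR('c) n)) = goss_term x n f"
  by (simp add: goss_power_def one_unit_power_of_nat goss_term_def power_inverse)

lemma goss_half_plane_nat: "absval (x :: 'c) > 1 \<Longrightarrow> (x, padic_of_nat CHAR('c) n) \<in> goss_half_plane"
  using prime_gt_0_nat[OF CHAR_prime[where ?'a = 'c]]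
  by (auto simp: goss_half_plane_def goss_space_def padic_of_nat_in absval_0)

lemma absval_goss_term: "f \<noteq> 0 \<Longrightarrow> absval (goss_term x n f) = inverse (absval x) ^ degree f"
  by (simp add: goss_term_def absval_mult absval_power absval_inverse absval_one_unit_part)

definition monics :: "nat \<Rightarrow> 'q poly set" where "monics d = {f. lead_coeff f = 1 \<and> degree f \<le> d}"

lemma finite_monics: "finite (monics d)"
  by (rule finite_subset[OF _ card_polys_degree_le(1)[of d]]) (auto simp: monics_def)

text \<open>At these points the size of a term depends only on the degree of the norm, so the terms
  above the threshold are exactly those of degree at most \<open>d\<close>. Grouping them by norm
  yields the multiplicities.\<close>

lemma goss_sum_truncated:
  fixes N :: "'x \<Rightarrow> 'q poly"
  assumes N: "\<And>M. M \<in> A \<Longrightarrow> lead_coeff (N M) = 1" and fin: "\<And>f. finite {M\<in>A. N M = f}"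
    and x: "absval x > 1"
  shows "(\<Sum>\<^sub>\<infinity>M\<in>A. teichmueller (inverse (goss_power \<iota> (N M) (x, padic_of_nat CHAR('c) n)))) -
    (\<Sum>f\<in>monics d. of_nat (card {M\<in>A. N M = f}) * teichmueller (goss_term x n f)) \<in> weak_nbhd (vball (inverse (absval x) ^ d)) m"
proof -
  define y where "y = inverse (absval x)"
  have y: "0 < y" "y < 1" using x by (auto simp: y_def field_simps)
  have nz: "N M \<noteq> 0" if "M \<in> A" for M using N[OF that] by auto
  have av: "absval (goss_term x n (N M)) = y ^ degree (N M)" if "M \<in> A" for M
    using absval_goss_term[OF nz[OF that]] by (simp add: y_def)
  have set_eq: "{M\<in>A. absval (goss_term x n (N M)) \<ge> y ^ d} = (\<Union>f\<in>monics d. {M\<in>A. N M = f})" for d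
    using y av N by (auto simp: monics_def power_decreasing_iff)
  have fin_d: "finite {M\<in>A. absval (goss_term x n (N M)) \<ge> y ^ d}" for d
    unfolding set_eq using fin finite_monics by blast
  have "(\<Sum>\<^sub>\<infinity>M\<in>A. teichmueller (goss_term x n (N M))) -
      (\<Sum>M\<in>{M\<in>A. absval (goss_term x n (N M)) \<ge> y ^ d}. teichmueller (goss_term x n (N M))) \<in> weak_nbhd (vball (y ^ d)) m"
  proof (rule infsum_teichmueller_tail)
    show "absval (goss_term x n (N M)) \<le> 1" if "M \<in> A" for M
      using av[OF that] y by (simp add: power_le_one)
    show "finite {M\<in>A. absval (goss_term x n (N M)) \<ge> r}" if r: "r > 0" for r
    proof -
      obtain k where "y ^ k < r" using real_arch_pow_inv[OF r y(2)] by blast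
      then show ?thesis by (intro finite_subset[OF _ fin_d[of k]]) auto
    qed
    show "0 < y ^ d" "y ^ d \<le> 1" using y by (auto simp: power_le_one)
  qed
  also have "(\<Sum>M\<in>{M\<in>A. absval (goss_term x n (N M)) \<ge> y ^ d}. teichmueller (goss_term x n (N M))) =
      (\<Sum>f\<in>monics d. \<Sum>M\<in>{M\<in>A. N M = f}. teichmueller (goss_term x n (N M)))"
    unfolding set_eq using fin finite_monics by (intro sum.UNION_disjoint) auto
  also have "\<dots> = (\<Sum>f\<in>monics d. of_nat (card {M\<in>A. N M = f}) * teichmueller (goss_term x n f))"
    by (intro sum.cong refl) simp
  finally show ?thesis by (simp add: goss_power_nat y_def)
qed

text \<open>By linearity the powers may be replaced by any polynomial; the one with roots at all
  other nodes isolates the coefficient of \<open>f\<close>.\<close>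

lemma vandermonde_zero:
  fixes c :: "'x \<Rightarrow> 'c"
  assumes F: "finite F" "inj_on v F" and sum0: "\<And>n. (\<Sum>f\<in>F. c f * v f ^ n) = 0" and f: "f \<in> F"
  shows "c f = 0"
proof -
  have *: "(\<Sum>f\<in>F. c f * poly P (v f)) = 0" for P
  proof -
    have "(\<Sum>f\<in>F. c f * poly P (v f)) = (\<Sum>i\<le>degree P. coeff P i * (\<Sum>f\<in>F. c f * v f ^ i))"
      unfolding poly_altdef sum_distrib_left by (subst sum.swap) (simp add: mult_ac)
    then show ?thesis by (simp add: sum0)
  qed
  define P where "P = (\<Prod>g\<in>F - {f}. [:- v g, 1:])"
  have P: "poly P z = (\<Prod>g\<in>F - {f}. z - v g)" for z by (simp add: P_def poly_prod)
  have "poly P (v g) = 0" if "g \<in> F - {f}" for g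
    unfolding P using F that by (intro prod_zero) auto
  then have "(\<Sum>f\<in>F. c f * poly P (v f)) = c f * poly P (v f)"
    using F f by (simp add: sum.remove)
  moreover have "poly P (v f) \<noteq> 0"
    unfolding P using F f by (auto simp: inj_on_def)
  ultimately show ?thesis using * by auto
qed

text \<open>If the integer coefficients \<open>E\<close> did not all vanish modulo \<open>p\<close>, the terms of least degree
  with \<open>E\<close> prime to \<open>p\<close> would dominate as \<open>|x|\<close> grows, contradicting the independence of the powers of
  the distinct one-units \<open>\<langle>f\<rangle>\<close>.\<close>

lemma CHAR_dvd_coefficients:
  fixes E :: "'q poly \<Rightarrow> int"
  assumes small: "\<And>x n d. absval x > 1 \<Longrightarrow>
      absval (\<Sum>f\<in>monics d. of_int (E f) * goss_term x n f) ^ K < inverse (absval x) ^ d"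
    and K: "K > 0" and f: "lead_coeff f = 1"
  shows "(of_int (E f) :: 'c) = 0"
  using f
proof (induction "degree f" arbitrary: f rule: less_induct)
  case less
  define M where "M = degree f"
  define F :: "'q poly set" where "F = {h. lead_coeff h = 1 \<and> degree h = M}"
  have F: "finite F" by (rule finite_subset[OF _ finite_monics[of M]]) (auto simp: F_def monics_def)
  define v where "v h = inverse (one_unit_part \<iota> h)" for h
  define A where "A n = (\<Sum>h\<in>F. of_int (E h) * v h ^ n)" for n
  have bound: "absval (A n) \<le> inverse (absval x)" if x: "absval x > 1" for n and x :: 'c
  proof -
    define y where "y = inverse (absval x)"
    have y: "0 < y" "y < 1" using x by (auto simp: y_def field_simps)
    \<comment> \<open>This truncation makes the \<open>K\<close>-th root of the bound equal to
      \<open>y^(M+1)\<close>, one factor \<open>y\<close> below the size of the terms of degree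
      \<open>M\<close>.\<close>
    define d where "d = Suc M * K"
    define Z where "Z = (\<Sum>h\<in>monics d. of_int (E h) * goss_term x n h)"
    have "absval Z ^ K < y ^ d" using small[OF x, of n d] by (simp only: Z_def y_def)
    also have "y ^ d = (y ^ Suc M) ^ K" by (simp only: d_def power_mult)
    finally have "absval Z ^ K < (y ^ Suc M) ^ K" .
    then have Z: "absval Z < y ^ Suc M" by (rule power_less_imp_less_base) (use y in simp)
    have Md: "M \<le> d" using K by (cases K) (auto simp: d_def)
    define H where "H = {h \<in> monics d. degree h > M}"
    define Lo where "Lo = {h \<in> monics d. degree h < M}"
    have "monics d = Lo \<union> (F \<union> H)" using Md by (auto simp: Lo_def F_def H_def monics_def)
    moreover have fin: "finite Lo" "finite H" unfolding Lo_def H_def by (auto simp: finite_monics)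
    ultimately have "Z = (\<Sum>h\<in>Lo. of_int (E h) * goss_term x n h) + (\<Sum>h\<in>F \<union> H. of_int (E h) * goss_term x n h)"
      unfolding Z_def using F by (simp only:) (intro sum.union_disjoint, auto simp: Lo_def F_def H_def)
    also have "(\<Sum>h\<in>Lo. of_int (E h) * goss_term x n h) = 0"
      \<comment> \<open>The coefficients of lower degree vanish in characteristic \<open>p\<close>
        by the induction hypothesis.\<close>
      by (rule sum.neutral) (use less.hyps in \<open>auto simp: Lo_def M_def monics_def\<close>)
    also have "(\<Sum>h\<in>F \<union> H. of_int (E h) * goss_term x n h) = (\<Sum>h\<in>F. of_int (E h) * goss_term x n h) + (\<Sum>h\<in>H. of_int (E h) * goss_term x n h)"
      using F fin by (intro sum.union_disjoint) (auto simp: F_def H_def)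
    also have "(\<Sum>h\<in>F. of_int (E h) * goss_term x n h) = inverse x ^ M * A n"
      unfolding A_def sum_distrib_left by (intro sum.cong refl) (simp add: F_def goss_term_def v_def)
    finally have eq: "inverse x ^ M * A n = Z - (\<Sum>h\<in>H. of_int (E h) * goss_term x n h)" by simp
    have "absval (\<Sum>h\<in>H. of_int (E h) * goss_term x n h) \<le> y ^ Suc M"
    proof (rule absval_sum_le)
      fix h assume h: "h \<in> H"
      then have "h \<noteq> 0" by (auto simp: H_def monics_def)
      have "absval (of_int (E h) * goss_term x n h) \<le> 1 * y ^ degree h"
        unfolding absval_mult absval_goss_term[OF \<open>h \<noteq> 0\<close>] y_def[symmetric]
        using y by (intro mult_right_mono absval_of_int_le_1) simp
      also have "\<dots> \<le> y ^ Suc M" using power_decreasing[of "Suc M" "degree h" y] h y by (simp add: H_def)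
      finally show "absval (of_int (E h) * goss_term x n h) \<le> y ^ Suc M" .
    qed (use y in simp)
    then have "absval (inverse x ^ M * A n) \<le> y ^ Suc M"
      unfolding eq using absval_diff_le_max[of Z "\<Sum>h\<in>H. of_int (E h) * goss_term x n h"] Z by linarith
    then have "y ^ M * absval (A n) \<le> y ^ M * y"
      by (simp add: absval_mult absval_power absval_inverse y_def mult.commute)
    then have "absval (A n) \<le> y" using y(1) by (simp only: mult_le_cancel_left_pos zero_less_power)
    then show ?thesis by (simp only: y_def)
  qed
  have "A n = 0" for n
  proof (rule ccontr)
    assume "A n \<noteq> 0"
    then have "absval (A n) > 0" using absval_nonneg[of "A n"] absval_eq_0_iff[of "A n"] by linarith
    moreover have "inverse (real CARD('q)) < 1" using q_gt_1 by (simp add: field_simps)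
    ultimately obtain k where k: "inverse (real CARD('q)) ^ k < absval (A n)" using real_arch_pow_inv by blast
    \<comment> \<open>\<open>A n\<close> is independent of \<open>x\<close>, so large powers of
      \<open>T\<close> refute any positive absolute value.\<close>
    have "absval (T ^ Suc k) > 1" using q_gt_1 by (simp only: absval_power absval_T one_less_power zero_less_Suc)
    from bound[OF this, of n] have "absval (A n) \<le> inverse (real CARD('q)) ^ Suc k"
      by (simp only: absval_power absval_T power_inverse)
    also have "\<dots> \<le> inverse (real CARD('q)) ^ k" using q_gt_1 by (intro power_decreasing) (auto simp: field_simps)
    finally show False using k by simp
  qed
  then have sum0: "(\<Sum>h\<in>F. of_int (E h) * v h ^ n) = 0" for n by (simp only: A_def)
  have inj: "inj_on v F"
    by (rule inj_onI) (auto simp: v_def F_def dest: one_unit_part_inj)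
  have "f \<in> F" using less.prems by (simp add: F_def M_def)
  then show ?case by (rule vandermonde_zero[OF F inj sum0])
qed

text \<open>The argument sees only multiplicities, hence the formulation for two families of monic
  polynomials with finite fibres.\<close>

theorem goss_sums_determine_counts:
  fixes N :: "'x \<Rightarrow> 'q poly" and N' :: "'y \<Rightarrow> 'q poly"
  assumes N: "\<And>M. M \<in> A \<Longrightarrow> lead_coeff (N M) = 1" "\<And>f. finite {M\<in>A. N M = f}"
    and N': "\<And>M. M \<in> A' \<Longrightarrow> lead_coeff (N' M) = 1" "\<And>f. finite {M\<in>A'. N' M = f}"
    and eq: "\<And>s. s \<in> goss_half_plane \<Longrightarrow> (\<Sum>\<^sub>\<infinity>M\<in>A. teichmueller (inverse (goss_power \<iota> (N M) s))) =
      (\<Sum>\<^sub>\<infinity>M\<in>A'. teichmueller (inverse (goss_power \<iota> (N' M) s)))"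
  shows "card {M\<in>A. N M = f} = card {M\<in>A'. N' M = f}"
proof -
  define p where "p = CHAR('c)"
  have p: "Factorial_Ring.prime p" unfolding p_def by (rule CHAR_prime)
  define D where "D f = int (card {M\<in>A. N M = f}) - int (card {M\<in>A'. N' M = f})" for f
  have small: "(\<Sum>f\<in>monics d. of_int (D f) * teichmueller (goss_term x n f)) \<in> weak_nbhd (vball (inverse (absval x) ^ d)) m"
    if x: "absval x > 1" for x n d m
  proof -
    have r: "0 < inverse (absval x) ^ d" "inverse (absval x) ^ d \<le> 1"
      using x by (auto intro!: power_le_one simp: field_simps)
    note a = goss_sum_truncated[where N = N, OF N x, of n d m]
    note b = goss_sum_truncated[where N = N', OF N' x, of n d m]
    have "(\<Sum>f\<in>monics d. of_int (D f) * teichmueller (goss_term x n f)) =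
      (\<Sum>f\<in>monics d. of_nat (card {M\<in>A. N M = f}) * teichmueller (goss_term x n f)) -
      (\<Sum>f\<in>monics d. of_nat (card {M\<in>A'. N' M = f}) * teichmueller (goss_term x n f))"
      unfolding sum_subtractf[symmetric] by (intro sum.cong refl) (simp add: D_def left_diff_distrib)
    then show ?thesis
      using weak_nbhd_diff[OF open_ideal_ball[OF r] b a] eq[OF goss_half_plane_nat[OF x]] by simp
  qed
  have dvd: "int p ^ k dvd D f" if "lead_coeff f = 1" for k f
    using that
  proof (induction k arbitrary: f)
    case (Suc k)
    then have "\<forall>f. \<exists>c. lead_coeff f = 1 \<longrightarrow> D f = int p ^ k * c" by (metis dvdE)
    then obtain E where E: "\<And>f. lead_coeff f = 1 \<Longrightarrow> D f = int p ^ k * E f" by metis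
    have "(of_int (E f) :: 'c) = 0"
    proof (rule CHAR_dvd_coefficients[where K = "p ^ k" and E = E])
      show "p ^ k > 0" using prime_gt_0_nat[OF p] by simp
      fix x :: 'c and n d assume x: "absval x > 1"
      define w where "w = (\<Sum>f\<in>monics d. of_int (E f) * teichmueller (goss_term x n f))"
      have "(\<Sum>f\<in>monics d. of_int (D f) * teichmueller (goss_term x n f)) = of_nat p ^ k * w"
        unfolding w_def sum_distrib_left
        by (intro sum.cong refl) (simp add: E monics_def mult.assoc)
      \<comment> \<open>The estimate \<open>small\<close> holds for every \<open>m\<close>; taking
        \<open>m = k\<close> makes component \<open>k\<close> accessible.\<close>
      then have "absval (witt_coord (of_nat p ^ k * w) k) < inverse (absval x) ^ d"
        using small[OF x, of n d k] by (simp add: weak_nbhd_def)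
      also have "witt_coord (of_nat p ^ k * w) k = witt_coord w 0 ^ (p ^ k)"
        unfolding p_def by (rule witt_coord_CHAR_power_mult)
      also have "witt_coord w 0 = (\<Sum>f\<in>monics d. of_int (E f) * goss_term x n f)"
        by (simp add: w_def witt_coord_0_sum witt_coord_0_simps witt_coord_0_of_int witt_coord_teichmueller_0)
      finally show "absval (\<Sum>f\<in>monics d. of_int (E f) * goss_term x n f) ^ (p ^ k) < inverse (absval x) ^ d"
        by (simp add: absval_power)
    qed (rule Suc.prems)
    then have "int p dvd E f" by (simp add: of_int_eq_0_iff_char_dvd p_def)
    then show ?case using E[OF Suc.prems] by (simp add: mult.commute)
  qed simp
  have *: "D f = 0" if f: "lead_coeff f = 1" for f
  proof (rule ccontr)
    assume "D f \<noteq> 0"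
    \<comment> \<open>This exponent suffices because a natural number \<open>a\<close> is less than
      \<open>p^a\<close>.\<close>
    moreover have "int p ^ nat \<bar>D f\<bar> dvd D f" by (rule dvd[OF f])
    ultimately have "\<bar>int p ^ nat \<bar>D f\<bar>\<bar> \<le> \<bar>D f\<bar>" by (rule dvd_imp_le_int)
    then have "int p ^ nat \<bar>D f\<bar> \<le> \<bar>D f\<bar>" by simp
    moreover have "nat \<bar>D f\<bar> < p ^ nat \<bar>D f\<bar>" using prime_gt_1_nat[OF p] by (simp add: power_gt_expt)
    then have "\<bar>D f\<bar> < int (p ^ nat \<bar>D f\<bar>)" by linarith
    ultimately show False by simp
  qed
  show ?thesis
  proof (cases "lead_coeff f = 1")
    case True
    then show ?thesis using *[OF True] by (simp add: D_def)
  next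
    case False
    then have "{M\<in>A. N M = f} = {}" "{M\<in>A'. N' M = f} = {}" using N(1) N'(1) by auto
    then show ?thesis by (simp only: card.empty)
  qed
qed

end

section \<open>Multisets of primes of given degree\<close>

text \<open>The multisets of primes whose degrees sum to \<open>k\<close> are the singletons of degree \<open>k\<close> and
  multisets involving only primes of degree less than \<open>k\<close>; so the counts determine the numbers of
  primes of each degree recursively.\<close>

lemma bij_betw_image_mset:
  assumes "bij_betw b S S'"
  shows "bij_betw (image_mset b) {M. set_mset M \<subseteq> S} {M. set_mset M \<subseteq> S'}"
proof (rule bij_betw_byWitness[where f' = "image_mset (inv_into S b)"])
  have inj: "inj_on b S" and im: "b ` S = S'" using assms by (auto simp: bij_betw_def)
  have id: "image_mset f M = M" if "\<And>x. x \<in># M \<Longrightarrow> f x = x" for f :: "'z \<Rightarrow> 'z" and M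
    using image_mset_cong[of M f id] that by simp
  show "\<forall>M\<in>{M. set_mset M \<subseteq> S}. image_mset (inv_into S b) (image_mset b M) = M"
    using inj by (auto simp: image_mset.compositionality subset_iff intro!: id)
  show "\<forall>M\<in>{M. set_mset M \<subseteq> S'}. image_mset b (image_mset (inv_into S b) M) = M"
    using im by (auto simp: image_mset.compositionality subset_iff f_inv_into_f intro!: id)
  show "image_mset b ` {M. set_mset M \<subseteq> S} \<subseteq> {M. set_mset M \<subseteq> S'}"
    using im by (auto simp: subset_iff)
  show "image_mset (inv_into S b) ` {M. set_mset M \<subseteq> S'} \<subseteq> {M. set_mset M \<subseteq> S}"
    using im by (auto simp: subset_iff inv_into_into)
qed

lemma card_multisets_bij:
  assumes b: "bij_betw b S S'" and d: "\<And>P. P \<in> S \<Longrightarrow> d' (b P) = d P"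
  shows "card {M. set_mset M \<subseteq> S \<and> sum_mset (image_mset d M) = (k::nat)} =
    card {M. set_mset M \<subseteq> S' \<and> sum_mset (image_mset d' M) = k}"
proof (rule bij_betw_same_card)
  have "image_mset d' (image_mset b M) = image_mset d M" if "set_mset M \<subseteq> S" for M
    unfolding image_mset.compositionality o_def using that d by (intro image_mset_cong) auto
  then show "bij_betw (image_mset b) {M. set_mset M \<subseteq> S \<and> sum_mset (image_mset d M) = k}
      {M. set_mset M \<subseteq> S' \<and> sum_mset (image_mset d' M) = k}"
    using bij_betw_Collect[OF bij_betw_image_mset[OF b], of "\<lambda>M. sum_mset (image_mset d' M) = k"
        "\<lambda>M. sum_mset (image_mset d M) = k"] by simp
qed

text \<open>Positive degrees bound the size of the multiset by \<open>k\<close>.\<close>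

lemma finite_multisets_degree:
  assumes S: "finite S" and d: "\<And>P. P \<in> S \<Longrightarrow> d P > (0::nat)"
  shows "finite {M. set_mset M \<subseteq> S \<and> sum_mset (image_mset d M) = k}"
proof (rule finite_subset)
  show "finite {M. set_mset M \<subseteq> S \<and> size M \<le> k}"
  proof -
    have "{M. set_mset M \<subseteq> S \<and> size M \<le> k} \<subseteq> mset ` {xs. set xs \<subseteq> S \<and> length xs \<le> k}"
    proof
      fix M assume "M \<in> {M. set_mset M \<subseteq> S \<and> size M \<le> k}"
      moreover obtain xs where "M = mset xs" by (metis ex_mset)
      ultimately show "M \<in> mset ` {xs. set xs \<subseteq> S \<and> length xs \<le> k}" by auto
    qed
    then show ?thesis using finite_lists_length_le[OF S, of k] by (meson finite_surj)
  qed
  have "size M \<le> sum_mset (image_mset d M)" if "set_mset M \<subseteq> S" for M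
    using that
  proof (induction M)
    case (add P M)
    then show ?case using d[of P] by auto
  qed simp
  then show "{M. set_mset M \<subseteq> S \<and> sum_mset (image_mset d M) = k} \<subseteq> {M. set_mset M \<subseteq> S \<and> size M \<le> k}" by auto
qed

lemma card_multisets_split:
  assumes S: "finite S" and d: "\<And>P. P \<in> S \<Longrightarrow> d P > (0::nat)"
  shows "card {M. set_mset M \<subseteq> S \<and> sum_mset (image_mset d M) = k} = card {P\<in>S. d P = k} +
    card {M. set_mset M \<subseteq> {P\<in>S. d P < k} \<and> sum_mset (image_mset d M) = k}"
proof -
  define Lo where "Lo = {M. set_mset M \<subseteq> {P\<in>S. d P < k} \<and> sum_mset (image_mset d M) = k}"
  define Hi where "Hi = (\<lambda>P. {#P#}) ` {P\<in>S. d P = k}"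
  have "{M. set_mset M \<subseteq> S \<and> sum_mset (image_mset d M) = k} = Hi \<union> Lo"
  proof (intro Set.set_eqI iffI)
    fix M assume M: "M \<in> {M. set_mset M \<subseteq> S \<and> sum_mset (image_mset d M) = k}"
    show "M \<in> Hi \<union> Lo"
    proof (cases "\<exists>P\<in>#M. d P \<ge> k")
      case True
      then obtain P N where P: "M = add_mset P N" "d P \<ge> k" by (metis multi_member_split)
      have PS: "P \<in> S" "set_mset N \<subseteq> S" using M P by auto
      have s: "d P + sum_mset (image_mset d N) = k" using M P by simp
      have "N = {#}"
      \<comment> \<open>Any further element would add a positive degree to one that is already at
        least \<open>k\<close>.\<close>
      proof (rule ccontr)
        assume "N \<noteq> {#}"
        then obtain Q N' where "N = add_mset Q N'" by (metis multiset_cases)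
        then show False using s P(2) PS(2) d[of Q] by auto
      qed
      then show ?thesis using s P PS by (auto simp: Hi_def)
    next
      case False
      then have "M \<in> Lo" using M by (auto simp: Lo_def not_le)
      then show ?thesis ..
    qed
  qed (auto simp: Hi_def Lo_def)
  moreover have "M \<notin> Lo" if "M \<in> Hi" for M
    using that unfolding Hi_def Lo_def by (elim imageE) simp
  then have "Hi \<inter> Lo = {}" by blast
  moreover have "finite Hi" "finite Lo"
    unfolding Hi_def Lo_def using S d by (auto intro!: finite_multisets_degree)
  moreover have "card Hi = card {P\<in>S. d P = k}"
    unfolding Hi_def by (intro card_image) (auto simp: inj_on_def)
  ultimately show ?thesis by (simp add: card_Un_disjoint Lo_def)
qed

text \<open>Bijections between fibres glue, since the degree of an element tells which of them to
  apply.\<close>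

lemma bij_betw_of_card_fibers:
  assumes "\<And>k. finite {P\<in>S. d P = k}" "\<And>k. finite {P\<in>S'. d' P = k}"
    and "\<And>k. card {P\<in>S. d P = k} = card {P\<in>S'. d' P = k}"
  shows "\<exists>b. bij_betw b S S' \<and> (\<forall>P\<in>S. d' (b P) = d P)"
proof -
  have "\<exists>b. bij_betw b {P\<in>S. d P = k} {P\<in>S'. d' P = k}" for k
    using assms by (intro finite_same_card_bij) auto
  then obtain b where b: "\<And>k. bij_betw (b k) {P\<in>S. d P = k} {P\<in>S'. d' P = k}" by metis
  have bd: "b (d P) P \<in> S' \<and> d' (b (d P) P) = d P" if "P \<in> S" for P
    using b[of "d P"] that by (auto simp: bij_betw_def)
  have "bij_betw (\<lambda>P. b (d P) P) S S'"
    unfolding bij_betw_def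
  proof
    show "inj_on (\<lambda>P. b (d P) P) S"
    proof (rule inj_onI)
      fix P Q assume PQ: "P \<in> S" "Q \<in> S" "b (d P) P = b (d Q) Q"
      then have "d P = d Q" using bd by metis
      then show "P = Q" using PQ b[of "d P"] by (auto simp: bij_betw_def inj_on_def)
    qed
    show "(\<lambda>P. b (d P) P) ` S = S'"
    proof
      show "(\<lambda>P. b (d P) P) ` S \<subseteq> S'" using bd by auto
      show "S' \<subseteq> (\<lambda>P. b (d P) P) ` S"
      proof
        fix Q assume "Q \<in> S'"
        then have "Q \<in> b (d' Q) ` {P\<in>S. d P = d' Q}" using b[of "d' Q"] by (simp add: bij_betw_def)
        then show "Q \<in> (\<lambda>P. b (d P) P) ` S" by force
      qed
    qed
  qed
  then show ?thesis using bd by blast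
qed

lemma degree_counts_determined:
  assumes S: "finite S" "\<And>P. P \<in> S \<Longrightarrow> d P > (0::nat)" and S': "finite S'" "\<And>P. P \<in> S' \<Longrightarrow> d' P > (0::nat)"
    and eq: "\<And>k. card {M. set_mset M \<subseteq> S \<and> sum_mset (image_mset d M) = k} =
      card {M. set_mset M \<subseteq> S' \<and> sum_mset (image_mset d' M) = k}"
  shows "card {P\<in>S. d P = k} = card {P\<in>S'. d' P = k}"
proof (induction k rule: less_induct)
  case (less k)
  have "card {P\<in>{P\<in>S. d P < k}. d P = j} = card {P\<in>{P\<in>S'. d' P < k}. d' P = j}" for j
  proof (cases "j < k")
    case True
    then have "{P\<in>{P\<in>S. d P < k}. d P = j} = {P\<in>S. d P = j}" "{P\<in>{P\<in>S'. d' P < k}. d' P = j} = {P\<in>S'. d' P = j}"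
      by auto
    then show ?thesis using less[OF True] by simp
  next
    case False
    then have "{P\<in>{P\<in>S. d P < k}. d P = j} = {}" "{P\<in>{P\<in>S'. d' P < k}. d' P = j} = {}" by auto
    then show ?thesis by (simp only: card.empty)
  qed
  then obtain b where "bij_betw b {P\<in>S. d P < k} {P\<in>S'. d' P < k}" "\<forall>P\<in>{P\<in>S. d P < k}. d' (b P) = d P"
    using bij_betw_of_card_fibers[of "{P\<in>S. d P < k}" d "{P\<in>S'. d' P < k}" d'] S S' by auto
  then have "card {M. set_mset M \<subseteq> {P\<in>S. d P < k} \<and> sum_mset (image_mset d M) = k} =
      card {M. set_mset M \<subseteq> {P\<in>S'. d' P < k} \<and> sum_mset (image_mset d' M) = k}"
    by (intro card_multisets_bij) auto
  then show ?case
    using eq[of k] card_multisets_split[of S d k] card_multisets_split[of S' d' k] S S' by simp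
qed

lemma card_eq_count_image_mset:
  "finite A \<Longrightarrow> card {P\<in>A. f P = k} = count (image_mset f (mset_set A)) k"
proof -
  assume A: "finite A"
  have "(\<Sum>x\<in>f -` {k} \<inter> A. count (mset_set A) x) = (\<Sum>x\<in>f -` {k} \<inter> A. 1)"
    using A by (intro sum.cong) auto
  moreover have "{P\<in>A. f P = k} = f -` {k} \<inter> A" by auto
  ultimately show ?thesis using A by (simp add: count_image_mset)
qed

section \<open>Arithmetic equivalence\<close>

lemma monic_prod_mset:
  fixes N :: "'x \<Rightarrow> 'a::field poly"
  assumes "\<And>P. P \<in># M \<Longrightarrow> lead_coeff (N P) = 1"
  shows "lead_coeff (\<Prod>\<^sub># (image_mset N M)) = 1"
    "degree (\<Prod>\<^sub># (image_mset N M)) = sum_mset (image_mset (\<lambda>P. degree (N P)) M)"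
proof -
  have "lead_coeff (\<Prod>\<^sub># (image_mset N M)) = 1 \<and>
      degree (\<Prod>\<^sub># (image_mset N M)) = sum_mset (image_mset (\<lambda>P. degree (N P)) M)"
    using assms
  proof (induction M)
    case (add P M)
    then have *: "lead_coeff (N P) = 1" "lead_coeff (\<Prod>\<^sub># (image_mset N M)) = 1"
      "degree (\<Prod>\<^sub># (image_mset N M)) = sum_mset (image_mset (\<lambda>P. degree (N P)) M)" by auto
    then have "N P \<noteq> 0" "\<Prod>\<^sub># (image_mset N M) \<noteq> 0" by (metis leading_coeff_0_iff zero_neq_one)+
    then have "degree (N P * \<Prod>\<^sub># (image_mset N M)) = degree (N P) + degree (\<Prod>\<^sub># (image_mset N M))"
      by (rule degree_mult_eq)
    moreover have "lead_coeff (N P * \<Prod>\<^sub># (image_mset N M)) = 1" using * by (simp only: lead_coeff_mult mult_1)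
    ultimately show ?case using * by simp
  qed simp
  then show "lead_coeff (\<Prod>\<^sub># (image_mset N M)) = 1"
    "degree (\<Prod>\<^sub># (image_mset N M)) = sum_mset (image_mset (\<lambda>P. degree (N P)) M)" by auto
qed

lemma monic_irreducible_dvd_power:
  fixes f g :: "'a::field poly"
  assumes f: "lead_coeff f = 1" "Factorial_Ring.irreducible f"
    and g: "lead_coeff g = 1" "Factorial_Ring.irreducible g" and dvd: "g dvd f ^ k"
  shows "g = f"
proof -
  have "g dvd f"
    using dvd
  proof (induction k)
    case 0
    then show ?case using g by auto
  next
    case (Suc k)
    then show ?case using irreducible_prime_dvd[OF g(2), of f "f ^ k"] by auto
  qed
  then obtain c where c: "f = g * c" by (elim dvdE)
  then have "c dvd 1" using Factorial_Ring.irreducibleD[OF f(2), of g c] g(2) by auto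
  then have "f dvd g" using c by (metis dvd_mult_unit_iff dvd_refl)
  then show ?thesis using \<open>g dvd f\<close> f g by (intro poly_dvd_antisym) auto
qed

lemma degree_irreducible_pos:
  "Factorial_Ring.irreducible (f :: 'a::field poly) \<Longrightarrow> degree f > 0"
  using is_unit_iff_degree[of f] by (cases "f = 0") (auto simp: Factorial_Ring.irreducible_def)

section \<open>Multisets of primes with given norm\<close>

context function_field
begin

definition mnorm :: "'k set multiset \<Rightarrow> 'q poly"
  where "mnorm M = \<Prod>\<^sub># (image_mset (prime_norm \<phi>) M)"

lemma prime_norm_monic: "P \<in> primes \<Longrightarrow> lead_coeff (prime_norm \<phi> P) = 1"
  using below(1) by (simp add: prime_norm_eq lead_coeff_power)

lemma degree_prime_norm_pos: "P \<in> primes \<Longrightarrow> degree (prime_norm \<phi> P) > 0"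
proof -
  assume P: "P \<in> primes"
  then have "below P \<noteq> 0" using below(2) by fastforce
  then show ?thesis using P degree_irreducible_pos[OF below(2)[OF P]] inertia_degree_pos[OF P]
    by (simp add: prime_norm_eq degree_power_eq)
qed

lemma mnorm_monic: "set_mset M \<subseteq> primes \<Longrightarrow> lead_coeff (mnorm M) = 1"
  unfolding mnorm_def by (rule monic_prod_mset(1)) (auto intro: prime_norm_monic)

lemma prime_norm_dvd_mnorm: "P \<in># M \<Longrightarrow> prime_norm \<phi> P dvd mnorm M"
  unfolding mnorm_def by (rule dvd_prod_mset) simp

lemma below_dvd_mnorm: "set_mset M \<subseteq> primes \<Longrightarrow> P \<in># M \<Longrightarrow> below P dvd mnorm M"
proof -
  assume M: "set_mset M \<subseteq> primes" "P \<in># M"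
  then have "below P dvd prime_norm \<phi> P"
    unfolding prime_norm_eq using inertia_degree_pos[of P] by (intro dvd_power) auto
  then show ?thesis using prime_norm_dvd_mnorm[OF M(2)] dvd_trans by blast
qed

text \<open>The primes involved lie above divisors of \<open>g\<close>, of which there are finitely
  many over a finite field, and the degree of \<open>g\<close> limits how many can occur.\<close>

lemma finite_mnorm_fiber: "finite {M \<in> {M. set_mset M \<subseteq> primes}. mnorm M = g}"
proof (cases "g = 0")
  case True
  then have "mnorm M \<noteq> g" if "set_mset M \<subseteq> primes" for M using mnorm_monic[OF that] by auto
  then have "{M \<in> {M. set_mset M \<subseteq> primes}. mnorm M = g} = {}" by simp
  then show ?thesis by (simp only: finite.emptyI)
next
  case False
  define S where "S = {P \<in> primes. below P dvd g}"
  have "finite {f :: 'q poly. f dvd g}"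
    using False by (intro finite_subset[OF _ card_polys_degree_le(1)[of "degree g"]]) (auto intro: dvd_imp_degree_le)
  then have "finite (\<Union>f\<in>{f. f dvd g}. {P \<in> primes. below P = f})"
    using finite_primes_below by blast
  then have S: "finite S" by (rule rev_finite_subset) (auto simp: S_def)
  have "finite {M. set_mset M \<subseteq> S \<and> sum_mset (image_mset (\<lambda>P. degree (prime_norm \<phi> P)) M) = degree g}"
    using S degree_prime_norm_pos by (intro finite_multisets_degree) (auto simp: S_def)
  moreover have "{M \<in> {M. set_mset M \<subseteq> primes}. mnorm M = g} \<subseteq>
      {M. set_mset M \<subseteq> S \<and> sum_mset (image_mset (\<lambda>P. degree (prime_norm \<phi> P)) M) = degree g}"
  proof
    fix M assume "M \<in> {M \<in> {M. set_mset M \<subseteq> primes}. mnorm M = g}"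
    then have M: "set_mset M \<subseteq> primes" "mnorm M = g" by auto
    have "set_mset M \<subseteq> S" using M below_dvd_mnorm[OF M(1)] by (auto simp: S_def)
    moreover have "sum_mset (image_mset (\<lambda>P. degree (prime_norm \<phi> P)) M) = degree g"
    proof -
      have "degree (mnorm M) = sum_mset (image_mset (\<lambda>P. degree (prime_norm \<phi> P)) M)"
        unfolding mnorm_def using M(1) prime_norm_monic by (intro monic_prod_mset(2)) auto
      then show ?thesis using M(2) by simp
    qed
    ultimately show "M \<in> {M. set_mset M \<subseteq> S \<and> sum_mset (image_mset (\<lambda>P. degree (prime_norm \<phi> P)) M) = degree g}"
      by blast
  qed
  ultimately show ?thesis by (rule rev_finite_subset)
qed

text \<open>Norms that are powers of \<open>f\<close> isolate the primes above \<open>f\<close>: any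
  other prime would bring in a different monic irreducible divisor. The exponent is determined
  because \<open>f\<close> has positive degree.\<close>

lemma mnorm_prime_power:
  assumes f: "lead_coeff f = 1" "Factorial_Ring.irreducible f"
  shows "{M \<in> {M. set_mset M \<subseteq> primes}. mnorm M = f ^ k} =
    {M. set_mset M \<subseteq> {P \<in> primes. below P = f} \<and> sum_mset (image_mset (inertia_degree \<phi>) M) = k}"
proof -
  have norm: "mnorm M = f ^ sum_mset (image_mset (inertia_degree \<phi>) M)"
    if "set_mset M \<subseteq> {P \<in> primes. below P = f}" for M
    using that by (induction M) (auto simp: mnorm_def prime_norm_eq power_add)
  have inj: "f ^ m = f ^ n \<longleftrightarrow> m = n" for m n
  proof
    assume "f ^ m = f ^ n"
    then have "degree (f ^ m) = degree (f ^ n)" by simp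
    then show "m = n" using f degree_irreducible_pos[OF f(2)] by (auto simp: degree_power_eq)
  qed simp
  have "set_mset M \<subseteq> {P \<in> primes. below P = f}" if M: "set_mset M \<subseteq> primes" "mnorm M = f ^ k" for M
  proof
    fix P assume P: "P \<in># M"
    then have "P \<in> primes" "below P dvd f ^ k" using M below_dvd_mnorm[of M P] by auto
    then show "P \<in> {P \<in> primes. below P = f}"
      using monic_irreducible_dvd_power[OF f below(1,2)] by blast
  qed
  then show ?thesis
    using norm inj by (intro Set.set_eqI iffI; unfold mem_Collect_eq; elim conjE; intro conjI; metis (no_types, lifting) mem_Collect_eq subset_iff)
qed

end

section \<open>Comparison of two extensions\<close>

locale function_field_pair =
  K: function_field \<phi> + L: function_field \<psi>
  for \<phi> :: "'q::finite_field poly fract \<Rightarrow> 'k::field" and \<psi> :: "'q poly fract \<Rightarrow> 'l::field"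
begin

text \<open>Sorting is injective on multisets, with \<open>mset\<close> as left inverse, and
  multisets agree when all counts agree.\<close>

lemma arithmetically_equivalent_iff:
  "arithmetically_equivalent \<phi> \<psi> \<longleftrightarrow> (\<forall>f. lead_coeff f = 1 \<and> Factorial_Ring.irreducible f \<longrightarrow>
    (\<forall>k. card {P \<in> {P \<in> K.primes. K.below P = f}. inertia_degree \<phi> P = k} =
      card {P \<in> {P \<in> L.primes. L.below P = f}. inertia_degree \<psi> P = k}))"
proof -
  have "splitting_type \<phi> {g. f dvd g} = splitting_type \<psi> {g. f dvd g} \<longleftrightarrow>
      (\<forall>k. card {P \<in> {P \<in> K.primes. K.below P = f}. inertia_degree \<phi> P = k} =
        card {P \<in> {P \<in> L.primes. L.below P = f}. inertia_degree \<psi> P = k})" if f: "lead_coeff f = 1" for f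
  proof -
    have "splitting_type \<phi> {g. f dvd g} = splitting_type \<psi> {g. f dvd g} \<longleftrightarrow>
        image_mset (inertia_degree \<phi>) (mset_set {P \<in> K.primes. K.below P = f}) =
        image_mset (inertia_degree \<psi>) (mset_set {P \<in> L.primes. L.below P = f})"
      unfolding K.splitting_type_eq[OF f] L.splitting_type_eq[OF f]
      by (rule inj_eq[OF inj_on_inverseI[of _ mset]]) simp
    then show ?thesis
      unfolding card_eq_count_image_mset[OF K.finite_primes_below] card_eq_count_image_mset[OF L.finite_primes_below]
      by (simp add: multiset_eq_iff)
  qed
  then show ?thesis
    unfolding arithmetically_equivalent_def nonzero_primes_poly by blast
qed

lemma zeta_eq_if_arithmetically_equivalent:
  assumes "arithmetically_equivalent \<phi> \<psi>"
  shows "lifted_goss_zeta \<iota> \<phi> s = lifted_goss_zeta \<iota> \<psi> s"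
proof -
  \<comment> \<open>The pair determines the prime norm, and its fibres are the sets counted in
    \<open>arithmetically_equivalent_iff\<close>.\<close>
  define t where "t P = (K.below P, inertia_degree \<phi> P)" for P
  define t' where "t' P = (L.below P, inertia_degree \<psi> P)" for P
  have tt: "{P \<in> K.primes. t P = (f, k)} = {P \<in> {P \<in> K.primes. K.below P = f}. inertia_degree \<phi> P = k}"
    "{P \<in> L.primes. t' P = (f, k)} = {P \<in> {P \<in> L.primes. L.below P = f}. inertia_degree \<psi> P = k}" for f k
    by (auto simp: t_def t'_def)
  have "\<exists>b. bij_betw b K.primes L.primes \<and> (\<forall>P\<in>K.primes. t' (b P) = t P)"
  proof (rule bij_betw_of_card_fibers)
    fix fk :: "'q poly \<times> nat"
    obtain f k where fk: "fk = (f, k)" by (cases fk)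
    show "finite {P \<in> K.primes. t P = fk}" "finite {P \<in> L.primes. t' P = fk}"
      unfolding fk tt using K.finite_primes_below[of f] L.finite_primes_below[of f]
      by (auto elim!: rev_finite_subset)
    show "card {P \<in> K.primes. t P = fk} = card {P \<in> L.primes. t' P = fk}"
    proof (cases "lead_coeff f = 1 \<and> Factorial_Ring.irreducible f")
      case True
      then show ?thesis unfolding fk tt using assms arithmetically_equivalent_iff by blast
    next
      \<comment> \<open>No prime lies above such an \<open>f\<close>, so both fibres are
        empty.\<close>
      case False
      then have empty: "{P \<in> K.primes. K.below P = f} = {}" "{P \<in> L.primes. L.below P = f} = {}"
        using K.below(1,2) L.below(1,2) by blast+
      show ?thesis unfolding fk tt empty by simp
    qed
  qed
  then obtain b where b: "bij_betw b K.primes L.primes" "\<And>P. P \<in> K.primes \<Longrightarrow> t' (b P) = t P" by blast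
  have norm: "prime_norm \<psi> (b P) = prime_norm \<phi> P" if "P \<in> K.primes" for P
    using b(2)[OF that] by (simp add: t_def t'_def K.prime_norm_eq L.prime_norm_eq)
  have "lifted_goss_zeta \<iota> \<psi> s = (\<Sum>\<^sub>\<infinity>M\<in>{M. set_mset M \<subseteq> K.primes}.
      teichmueller (inverse (goss_power \<iota> (\<Prod>\<^sub># (image_mset (prime_norm \<psi>) (image_mset b M))) s)))"
    unfolding L.lifted_goss_zeta_eq by (rule infsum_reindex_bij_betw[OF bij_betw_image_mset[OF b(1)], symmetric])
  also have "\<dots> = lifted_goss_zeta \<iota> \<phi> s"
    unfolding K.lifted_goss_zeta_eq
  proof (rule infsum_cong)
    fix M assume M: "M \<in> {M. set_mset M \<subseteq> K.primes}"
    have "image_mset (prime_norm \<psi>) (image_mset b M) = image_mset (prime_norm \<phi>) M"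
      unfolding image_mset.compositionality o_def using M norm by (intro image_mset_cong) auto
    then show "teichmueller (inverse (goss_power \<iota> (\<Prod>\<^sub># (image_mset (prime_norm \<psi>) (image_mset b M))) s)) =
        teichmueller (inverse (goss_power \<iota> (\<Prod>\<^sub># (image_mset (prime_norm \<phi>) M)) s))" by simp
  qed
  finally show ?thesis by simp
qed

lemma arithmetically_equivalent_if_zeta_eq:
  assumes "goss_embedding \<iota>"
    and eq: "\<And>s. s \<in> goss_half_plane \<Longrightarrow> lifted_goss_zeta \<iota> \<phi> s = lifted_goss_zeta \<iota> \<psi> s"
  shows "arithmetically_equivalent \<phi> \<psi>"
  unfolding arithmetically_equivalent_iff
proof (intro allI impI)
  interpret goss_embedding \<iota> by (rule assms)
  fix f :: "'q poly" and k assume f: "lead_coeff f = 1 \<and> Factorial_Ring.irreducible f"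
  define S where "S = {P \<in> K.primes. K.below P = f}"
  define S' where "S' = {P \<in> L.primes. L.below P = f}"
  have "card {M \<in> {M. set_mset M \<subseteq> K.primes}. K.mnorm M = h} = card {M \<in> {M. set_mset M \<subseteq> L.primes}. L.mnorm M = h}" for h
    using eq K.mnorm_monic L.mnorm_monic K.finite_mnorm_fiber L.finite_mnorm_fiber
    unfolding K.lifted_goss_zeta_eq L.lifted_goss_zeta_eq K.mnorm_def[symmetric] L.mnorm_def[symmetric]
    by (intro goss_sums_determine_counts) auto
  \<comment> \<open>Specialising the norm to powers of \<open>f\<close> makes the problem one about
    the finitely many primes above \<open>f\<close>, graded by inertia degree.\<close>
  from this[of "f ^ k" for k] have "card {M. set_mset M \<subseteq> S \<and> sum_mset (image_mset (inertia_degree \<phi>) M) = k} =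
      card {M. set_mset M \<subseteq> S' \<and> sum_mset (image_mset (inertia_degree \<psi>) M) = k}" for k
    unfolding S_def S'_def K.mnorm_prime_power[OF conjunct1[OF f] conjunct2[OF f]]
      L.mnorm_prime_power[OF conjunct1[OF f] conjunct2[OF f]] .
  then show "card {P \<in> {P \<in> K.primes. K.below P = f}. inertia_degree \<phi> P = k} =
      card {P \<in> {P \<in> L.primes. L.below P = f}. inertia_degree \<psi> P = k}"
    unfolding S_def[symmetric] S'_def[symmetric]
    using K.finite_primes_below L.finite_primes_below K.inertia_degree_pos L.inertia_degree_pos
    by (intro degree_counts_determined) (auto simp: S_def S'_def)
qed

end

lemma goss_embedding_comp:
  fixes i :: "'q::finite_field poly fract \<Rightarrow> 'f::{nonarch_valued_field, complete_space}"
    and j :: "'f \<Rightarrow> 'g::{nonarch_valued_field, alg_closed_field}"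
    and h :: "'g \<Rightarrow> 'c::{nonarch_valued_field, complete_space, field_prime_char}"
  assumes "completion_map abs_infinity i" and "algebraic_closure_map j" and "completion_map absval h"
  shows "goss_embedding (h \<circ> j \<circ> i)"
proof -
  have i: "i \<in> Ring.ring_hom ring_of_type_algebra ring_of_type_algebra" "\<And>x. absval (i x) = abs_infinity x"
    and j: "j \<in> Ring.ring_hom ring_of_type_algebra ring_of_type_algebra" "\<And>x. absval (j x) = absval x"
    and h: "h \<in> Ring.ring_hom ring_of_type_algebra ring_of_type_algebra" "\<And>x. absval (h x) = absval x"
    using assms by (auto simp: completion_map_def algebraic_closure_map_def)
  show ?thesis
  proof
    fix x y
    show "(h \<circ> j \<circ> i) (x + y) = (h \<circ> j \<circ> i) x + (h \<circ> j \<circ> i) y"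
      using ring_hom_add[OF i(1), of x y] ring_hom_add[OF j(1), of "i x" "i y"]
        ring_hom_add[OF h(1), of "j (i x)" "j (i y)"] by simp
    show "absval ((h \<circ> j \<circ> i) x) = abs_infinity x" using i j h by simp
  qed
qed

theorem theorem5:
  fixes \<phi> :: "'q::finite_field poly fract \<Rightarrow> 'k::field"
    and \<psi> :: "'q poly fract \<Rightarrow> 'l::field"
    and i :: "'q poly fract \<Rightarrow> 'f::{nonarch_valued_field, complete_space}"
    and j :: "'f \<Rightarrow> 'g::{nonarch_valued_field, alg_closed_field}"
    and h :: "'g \<Rightarrow> 'c::{nonarch_valued_field, complete_space, field_prime_char}"
  assumes "finite_separable_extension \<phi>" and "finite_separable_extension \<psi>"
    and "completion_map abs_infinity i" and "algebraic_closure_map j" and "completion_map absval h"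
  shows "arithmetically_equivalent \<phi> \<psi> \<longleftrightarrow>
    (\<forall>s \<in> goss_half_plane.
      lifted_goss_zeta (h \<circ> j \<circ> i) \<phi> s = lifted_goss_zeta (h \<circ> j \<circ> i) \<psi> s)"
proof -
  interpret function_field_pair \<phi> \<psi>
    using assms(1,2) by unfold_locales (auto simp: finite_separable_extension_def)
  show ?thesis
    using zeta_eq_if_arithmetically_equivalent
      arithmetically_equivalent_if_zeta_eq[OF goss_embedding_comp[OF assms(3-5)]] by blast
qed

end
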